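(* Consider a piecewise smooth system $\dot z=X(z)$, $X=\frac12[(1+\operatorname{sgn}(h))X^++(1-\operatorname{sgn}(h))X^-]$, with switching manifold $\Sigma=\{h=0\}$, and an $r$-regularization $X^\delta_r$ of it with transition function $\psi$. In local coordinates $(x,y)\in\mathbb{R}^{n-1}\times\mathbb{R}$ with $h(x,y)=y$, write $X^+=(f_1,g_1)$, $X^-=(f_2,g_2)$. Suppose that $\frac{\partial\psi}{\partial t}(x,t)\neq0$ for all $x\in\Sigma^s$ and $|t|<1$. Then: (a) $\Sigma^w_r\subseteq\Sigma^w$ and $\Sigma^s\subseteq\Sigma^s_r$. (b) If $g_1\neq g_2$ in $\Sigma^s_r\setminus\Sigma^s$, then the sliding vector field $X^\Sigma$ can be smoothly extended from $\Sigma^s$ to $\Sigma^s_r$.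
   Context: Setting: $X^+,X^-$ are smooth vector fields on an open set $\mathcal{U}_0\subset\mathbb{R}^n$, $h:\mathcal{U}_0\to\mathbb{R}$ is smooth and $0$ is a regular value of $h$. Write $Yh=\nabla h\cdot Y$. Local coordinates $(x,y)\in\mathbb{R}^{n-1}\times\mathbb{R}$ are assumed in which $h(x,y)=y$, so $\Sigma=\{y=0\}$ is identified with the $x$-space, and $X^+h=g_1$, $X^-h=g_2$, with $f_i(x,y)\in\mathbb{R}^{n-1}$, $g_i(x,y)\in\mathbb{R}$. Filippov's regions: the sewing region is $\Sigma^w=\{p\in\Sigma:(X^+h)(p)\,(X^-h)(p)>0\}$ and the sliding region is $\Sigma^s=\{p\in\Sigma:(X^+h)(p)\,(X^-h)(p)<0\}$. The sliding vector field on $\Sigma^s$ is $$X^\Sigma=\frac{(X^+h)X^--(X^-h)X^+}{(X^+-X^-)h}=\left(\frac{f_2g_1-f_1g_2}{g_1-g_2},0\right).$$ $r$-regularization: let $\psi:\Sigma\times\mathbb{R}\to[-1,1]$, $(p,t)\mapsto\psi(p,t)$, be smooth with $\psi(p,t)=-1$ for $t\le-1$ and $\psi(p,t)=1$ for $t\ge1$ (no monotonicity is required). The $r$-regularization is the family, $\delta>0$, $$X^\delta_r=\frac{1+\psi(p,h/\delta)}{2}X^++\frac{1-\psi(p,h/\delta)}{2}X^-,$$ which in the local coordinates means $\psi$ evaluated at $(x,y/\delta)$. A point $p\in\Sigma$ is an $r$-sewing point (belongs to $\Sigma^w_r$) if there are an open neighborhood $\mathcal{U}$ of $p$ and local coordinates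 $(x,y)\in\mathbb{R}^{n-1}\times\mathbb{R}$ on $\mathcal{U}$ such that $\Sigma=\{y=0\}$ and, for each sufficiently small $\delta>0$, the vector field $v(x,y)=(0,1)$ is a generator of $X^\delta_r$ in $\mathcal{U}$ (i.e. $v$ generates the one-dimensional foliation by orbits of $X^\delta_r$: $X^\delta_r$ is a nowhere vanishing function multiple of $v$ there). A point $p\in\Sigma$ is an $r$-sliding point (belongs to $\Sigma^s_r$) if there are an open neighborhood $\mathcal{U}\subset\mathbb{R}^n$ of $p$ and a family of smooth manifolds $S_\delta\subset\mathcal{U}$ such that $S_\delta$ is invariant for $X^\delta_r$ and, for each compact $K\subset\mathcal{U}$, $S_\delta\cap K$ converges to $\Sigma\cap K$ in the Hausdorff distance as $\delta\to0$.
   Formalization: Proved with: Σ^w_r ⊆ Σ^w only at points where neither X^+ nor X^- vanishes; in the r-sliding definition, compact K with Σ∩K in the closure of Σ∩int K, and S_δ of class C^k for each k once δ is small (not C^∞ at fixed δ); n ≥ 2. The literal claims fail otherwise. *)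

theory Defs
  imports "HOL-Analysis.Analysis"
begin

text \<open>Differentiability classes on open sets. In finite dimension this is the usual notion of
  \<open>C\<^sup>k\<close>: all iterated directional derivatives up to order \<open>k\<close> exist and are continuous. It is only
  meant to be used with open \<open>S\<close>, since the derivatives are taken at interior points.\<close>

fun Ck_on :: "nat \<Rightarrow> 'a::real_normed_vector set \<Rightarrow> ('a \<Rightarrow> 'b::real_normed_vector) \<Rightarrow> bool" where
  "Ck_on 0 S f \<longleftrightarrow> continuous_on S f"
| "Ck_on (Suc k) S f \<longleftrightarrow>
     (\<forall>x\<in>S. f differentiable (at x)) \<and> (\<forall>v. Ck_on k S (\<lambda>x. frechet_derivative f (at x) v))"

definition smooth_on :: "'a::real_normed_vector set \<Rightarrow> ('a \<Rightarrow> 'b::real_normed_vector) \<Rightarrow> bool" where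
  "smooth_on S f \<longleftrightarrow> (\<forall>k. Ck_on k S f)"

definition Ck_chart :: "nat \<Rightarrow> 'e::euclidean_space set \<Rightarrow> ('e \<Rightarrow> 'e) \<Rightarrow> bool" where
  "Ck_chart k U \<Phi> \<longleftrightarrow> open U \<and> open (\<Phi> ` U) \<and> inj_on \<Phi> U \<and>
     Ck_on k U \<Phi> \<and> Ck_on k (\<Phi> ` U) (inv_into U \<Phi>)"

definition Ck_submanifold :: "nat \<Rightarrow> nat \<Rightarrow> 'e::euclidean_space set \<Rightarrow> bool" where
  "Ck_submanifold k d S \<longleftrightarrow>
     (\<forall>q\<in>S. \<exists>W \<Phi> L. q \<in> W \<and> Ck_chart k W \<Phi> \<and> subspace L \<and> dim L = d \<and>
        \<Phi> ` (S \<inter> W) = L \<inter> \<Phi> ` W)"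

text \<open>The Hausdorff distance, with value \<open>\<infinity>\<close> between an empty and a nonempty set.\<close>

definition hausdorff_dist :: "'e::metric_space set \<Rightarrow> 'e set \<Rightarrow> ereal" where
  "hausdorff_dist A B =
     Inf {ereal e | e. 0 \<le> e \<and> A \<subseteq> (\<Union>b\<in>B. cball b e) \<and> B \<subseteq> (\<Union>a\<in>A. cball a e)}"

text \<open>Invariance inside \<open>U\<close>: a solution staying in \<open>U\<close> that meets \<open>S\<close> at some time lies in \<open>S\<close>,
  in both time directions.\<close>

definition invariant_in ::
    "'e::euclidean_space set \<Rightarrow> ('e \<Rightarrow> 'e) \<Rightarrow> 'e set \<Rightarrow> bool" where
  "invariant_in U X S \<longleftrightarrow>
     (\<forall>\<gamma> a b. (\<forall>t\<in>{a..b}. \<gamma> t \<in> U \<and> (\<gamma> has_vector_derivative X (\<gamma> t)) (at t within {a..b})) \<and>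
        (\<exists>t\<in>{a..b}. \<gamma> t \<in> S) \<longrightarrow> \<gamma> ` {a..b} \<subseteq> S)"

definition lie :: "('e::euclidean_space \<Rightarrow> 'e) \<Rightarrow> ('e \<Rightarrow> real) \<Rightarrow> 'e \<Rightarrow> real" where
  "lie Y h p = frechet_derivative h (at p) (Y p)"

definition switching :: "'e set \<Rightarrow> ('e \<Rightarrow> real) \<Rightarrow> 'e set" where
  "switching U h = {p \<in> U. h p = 0}"

definition sewing ::
    "'e::euclidean_space set \<Rightarrow> ('e \<Rightarrow> real) \<Rightarrow> ('e \<Rightarrow> 'e) \<Rightarrow> ('e \<Rightarrow> 'e) \<Rightarrow> 'e set" where
  "sewing U h Xp Xm = {p \<in> switching U h. lie Xp h p * lie Xm h p > 0}"

definition sliding ::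
    "'e::euclidean_space set \<Rightarrow> ('e \<Rightarrow> real) \<Rightarrow> ('e \<Rightarrow> 'e) \<Rightarrow> ('e \<Rightarrow> 'e) \<Rightarrow> 'e set" where
  "sliding U h Xp Xm = {p \<in> switching U h. lie Xp h p * lie Xm h p < 0}"

definition sliding_field ::
    "('e::euclidean_space \<Rightarrow> real) \<Rightarrow> ('e \<Rightarrow> 'e) \<Rightarrow> ('e \<Rightarrow> 'e) \<Rightarrow> 'e \<Rightarrow> 'e" where
  "sliding_field h Xp Xm p =
     (lie Xp h p *\<^sub>R Xm p - lie Xm h p *\<^sub>R Xp p) /\<^sub>R lie (\<lambda>q. Xp q - Xm q) h p"

text \<open>The regularization in coordinates \<open>(x, y)\<close> with \<open>h (x, y) = y\<close>, the switching manifold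
  being identified with (an open subset of) the \<open>x\<close>-space.\<close>

definition regularization ::
    "('a::euclidean_space \<Rightarrow> real \<Rightarrow> real) \<Rightarrow> ('a \<times> real \<Rightarrow> 'a \<times> real) \<Rightarrow> ('a \<times> real \<Rightarrow> 'a \<times> real) \<Rightarrow>
     real \<Rightarrow> 'a \<times> real \<Rightarrow> 'a \<times> real" where
  "regularization \<psi> Xp Xm \<delta> p =
     ((1 + \<psi> (fst p) (snd p / \<delta>)) / 2) *\<^sub>R Xp p + ((1 - \<psi> (fst p) (snd p / \<delta>)) / 2) *\<^sub>R Xm p"

text \<open>In the next two definitions \<open>X \<delta>\<close> is an arbitrary family of vector fields, \<open>\<delta> > 0\<close>, and
  \<open>\<Sigma> = switching U\<^sub>0 snd\<close>. The chart \<open>\<Phi>\<close> straightens the foliation of all \<open>X \<delta>\<close> with small \<open>\<delta>\<close>: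
  the representative \<open>D\<Phi> (X \<delta>)\<close> is a nowhere vanishing multiple of \<open>(0, 1)\<close>.\<close>

definition r_sewing ::
    "('a::euclidean_space \<times> real) set \<Rightarrow> (real \<Rightarrow> 'a \<times> real \<Rightarrow> 'a \<times> real) \<Rightarrow> ('a \<times> real) set" where
  "r_sewing U\<^sub>0 X = {p \<in> switching U\<^sub>0 snd. \<exists>U \<Phi>. p \<in> U \<and> U \<subseteq> U\<^sub>0 \<and> (\<forall>k. Ck_chart k U \<Phi>) \<and>
     (\<forall>q\<in>U. q \<in> switching U\<^sub>0 snd \<longleftrightarrow> snd (\<Phi> q) = 0) \<and>
     (\<forall>\<^sub>F \<delta> in at_right 0. \<forall>q\<in>U. \<exists>\<alpha>. \<alpha> \<noteq> 0 \<and> frechet_derivative \<Phi> (at q) (X \<delta> q) = \<alpha> *\<^sub>R (0, 1))}"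

text \<open>Two conventions. First, \<open>S \<delta>\<close> is smooth in the sense of invariant manifold theory: for every
  finite \<open>k\<close> it is of class \<open>C\<^sup>k\<close> once \<open>\<delta>\<close> is small enough (depending on \<open>k\<close>); slow manifolds are in
  general not \<open>C\<^sup>\<infinity>\<close> for a fixed \<open>\<delta>\<close>. Second, the compact test sets \<open>K\<close> are in general position
  with respect to \<open>\<Sigma>\<close>, i.e. every point of \<open>\<Sigma> \<inter> K\<close> is a limit of points of \<open>\<Sigma>\<close> interior to \<open>K\<close>. For
  instance a singleton \<open>K = {q}\<close> with \<open>q\<close> in \<open>\<Sigma>\<close> would force \<open>S \<delta>\<close> to contain \<open>q\<close>.\<close>

definition r_sliding ::
    "('a::euclidean_space \<times> real) set \<Rightarrow> (real \<Rightarrow> 'a \<times> real \<Rightarrow> 'a \<times> real) \<Rightarrow> ('a \<times> real) set" where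
  "r_sliding U\<^sub>0 X = {p \<in> switching U\<^sub>0 snd. \<exists>U S. open U \<and> p \<in> U \<and> U \<subseteq> U\<^sub>0 \<and>
     (\<forall>\<^sub>F \<delta> in at_right 0. S \<delta> \<subseteq> U \<and> invariant_in U (X \<delta>) (S \<delta>)) \<and>
     (\<forall>k. \<forall>\<^sub>F \<delta> in at_right 0. \<exists>d. Ck_submanifold k d (S \<delta>)) \<and>
     (\<forall>K. compact K \<and> K \<subseteq> U \<and> switching U\<^sub>0 snd \<inter> K \<subseteq> closure (switching U\<^sub>0 snd \<inter> interior K) \<longrightarrow>
        ((\<lambda>\<delta>. hausdorff_dist (S \<delta> \<inter> K) (switching U\<^sub>0 snd \<inter> K)) \<longlongrightarrow> 0) (at_right 0))}"

lemma lie_snd [simp]: "lie Y snd p = snd (Y p)"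
  using frechet_derivative_at [OF bounded_linear_imp_has_derivative [OF bounded_linear_snd]]
  by (metis lie_def)

lemma sliding_field_coords:
  assumes "Xp p = (f1, g1)" "Xm p = (f2, g2)"
  shows "sliding_field snd Xp Xm p = ((g1 *\<^sub>R f2 - g2 *\<^sub>R f1) /\<^sub>R (g1 - g2), 0)"
  using assms by (simp add: sliding_field_def)

end

theory Submission
  imports Defs
begin

text \<open>
  The inclusion of the sliding region in the \<open>r\<close>-sliding region is a codimension one Fenichel theorem.
  With \<open>y = \<delta> \<tau>\<close>, an invariant graph \<open>\<tau> = \<tau>\<^sub>0 + m x\<close> is a solution of the first order equation
  \<open>\<delta> \<cdot> Dm(x) (F(x, m x)) = m x + N(x, m x)\<close>, where \<open>\<bar>\<partial>N/\<partial>s\<bar> \<le> 1/2\<close> after a cutoff. It is solved without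
  flows: the explicit scheme \<open>m \<mapsto> n - h (n + N(x, n))\<close> with \<open>n(x) = m(x + h \<delta> F(x, m x))\<close> is a
  contraction of rate \<open>1 - h/4\<close> and, for \<open>\<delta>\<close> small depending on \<open>k\<close>, preserves suitable bounds on the
  derivatives of order at most \<open>k\<close>, since the damping \<open>h/2\<close> beats the growth \<open>O(h \<delta>)\<close>. Its iterates solve the
  equation up to \<open>O(h)\<close>, and \<open>h \<rightarrow> 0\<close> gives a \<open>C\<^sup>k\<close> solution. The cutoff function is built from \<open>\<psi>\<close>
  itself. Uniqueness for the linear differential inequality satisfied by \<open>y - \<mu>(x)\<close> makes the graph of
  \<open>\<mu> = \<delta> (\<tau>\<^sub>0 + m)\<close> invariant.

  At an \<open>r\<close>-sewing point the chart yields a continuous line field transverse to \<open>\<Sigma>\<close> that contains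
  \<open>X\<^sup>+\<close> and \<open>X\<^sup>-\<close>; if these pointed to opposite sides, the intermediate value theorem would make the
  regularization tangent to \<open>{y = 0}\<close> somewhere in the layer. The sliding field itself extends
  smoothly, because \<open>g\<^sub>1 \<noteq> g\<^sub>2\<close> on the whole \<open>r\<close>-sliding region.
\<close>

section \<open>Directional derivatives\<close>

text \<open>The order of the quantifiers dictates the form of the estimates. For fixed
  \<open>\<delta>\<close> the step \<open>h\<close> tends to 0, so every bound must be uniform in
  \<open>h\<close>, and the threshold for \<open>\<delta>\<close> may depend on the order of
  differentiability but not on \<open>h\<close>. Hence bounds are stated for indexed families, and
  the constant at the top order is tracked separately: a fixed factor larger than 1 on it would
  defeat the damping. An Euler step is an explicit composition, so the chain rule alone controls its
  derivatives. Contraction holds only in the sup norm; derivatives converge by interpolation with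
  bounds of higher order.

  Attracting and repelling sliding need no case distinction: division by the nonzero fast derivative
  \<open>\<kappa>\<close> normalizes the linear term to +1. For \<open>\<kappa> < 0\<close> this
  reverses time, which an invariance equation does not see. Each finite order of smoothness has its
  own threshold for \<open>\<delta>\<close>, so a diagonal choice finally selects one family of
  graphs.\<close>

abbreviation pdv :: "('a::real_normed_vector \<Rightarrow> 'b::real_normed_vector) \<Rightarrow> 'a \<Rightarrow> 'a \<Rightarrow> 'b" where
  "pdv f v \<equiv> (\<lambda>x. frechet_derivative f (at x) v)"

lemma pdv_eqI: "(f has_derivative f') (at x) \<Longrightarrow> pdv f v x = f' v"
  using frechet_derivative_at by metis

lemma pdv_cong:
  assumes "open D" "x \<in> D" "\<And>y. y \<in> D \<Longrightarrow> f y = g y"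
  shows "pdv f v x = pdv g v x" and "f differentiable at x \<longleftrightarrow> g differentiable at x"
proof -
  have "(f has_derivative f') (at x) \<longleftrightarrow> (g has_derivative f') (at x)" for f'
    using has_derivative_transform_within_open[of f f' x UNIV D g]
      has_derivative_transform_within_open[of g f' x UNIV D f] assms by auto
  then show "pdv f v x = pdv g v x" "f differentiable at x \<longleftrightarrow> g differentiable at x"
    unfolding frechet_derivative_def differentiable_def by auto
qed

lemma pdv_has_derivative: "f differentiable at x \<Longrightarrow> (f has_derivative (\<lambda>v. pdv f v x)) (at x)"
  using frechet_derivative_works by blast

lemma pdv_add:
  assumes "f differentiable at x" "g differentiable at x"
  shows "pdv (\<lambda>x. f x + g x) v x = pdv f v x + pdv g v x"
  by (rule pdv_eqI) (intro derivative_intros pdv_has_derivative assms)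

lemma pdv_mult:
  fixes f g :: "'a::real_normed_vector \<Rightarrow> real"
  assumes "f differentiable at x" "g differentiable at x"
  shows "pdv (\<lambda>x. f x * g x) v x = f x * pdv g v x + pdv f v x * g x"
  by (rule pdv_eqI) (intro derivative_intros pdv_has_derivative assms)

lemma pdv_scaleR:
  fixes g :: "'a::real_normed_vector \<Rightarrow> 'b::real_normed_vector"
  assumes "f differentiable at x" "g differentiable at x"
  shows "pdv (\<lambda>x. f x *\<^sub>R g x) v x = f x *\<^sub>R pdv g v x + pdv f v x *\<^sub>R g x"
  by (rule pdv_eqI) (intro derivative_intros pdv_has_derivative assms)

lemma pdv_const [simp]: "pdv (\<lambda>x. c) v x = 0"
  by (rule pdv_eqI) (intro derivative_intros)

lemma pdv_bounded_linear: "bounded_linear L \<Longrightarrow> pdv L v x = L v"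
  by (intro pdv_eqI bounded_linear_imp_has_derivative)

lemma pdv_linear: "f differentiable at x \<Longrightarrow> linear (\<lambda>v. pdv f v x)"
  using linear_frechet_derivative by blast

lemma pdv_Basis:
  fixes f :: "'a::euclidean_space \<Rightarrow> 'b::real_normed_vector"
  assumes "f differentiable at x"
  shows "pdv f v x = (\<Sum>b\<in>Basis. (v \<bullet> b) *\<^sub>R pdv f b x)"
proof -
  have "pdv f (\<Sum>b\<in>Basis. (v \<bullet> b) *\<^sub>R b) x = (\<Sum>b\<in>Basis. (v \<bullet> b) *\<^sub>R pdv f b x)"
    using pdv_linear[OF assms] by (simp add: linear_sum linear_scale)
  then show ?thesis by (simp add: euclidean_representation)
qed

lemma differentiable_componentwise_at:
  fixes Z :: "'a::real_normed_vector \<Rightarrow> 'b::euclidean_space"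
  shows "Z differentiable at x \<longleftrightarrow> (\<forall>c\<in>Basis. (\<lambda>x. Z x \<bullet> c) differentiable at x)"
  using differentiable_componentwise_within[of Z x UNIV] by simp

lemma pdv_inner:
  assumes "Z differentiable at x"
  shows "pdv (\<lambda>x. Z x \<bullet> c) v x = pdv Z v x \<bullet> c"
  by (rule pdv_eqI) (intro derivative_intros pdv_has_derivative assms)

text \<open>In coordinates the chain rule is a finite sum of products of scalar functions, so bounds
  for sums and products of scalar families suffice to bound compositions.\<close>

lemma pdv_comp:
  fixes f :: "'b::euclidean_space \<Rightarrow> 'c::real_normed_vector" and Z :: "'a::real_normed_vector \<Rightarrow> 'b"
  assumes f: "f differentiable at (Z x)" and Z: "Z differentiable at x"
  shows "pdv (\<lambda>x. f (Z x)) v x = (\<Sum>c\<in>Basis. pdv (\<lambda>x. Z x \<bullet> c) v x *\<^sub>R pdv f c (Z x))"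
proof -
  have "pdv (\<lambda>x. f (Z x)) v x = pdv f (pdv Z v x) (Z x)"
    using diff_chain_at[OF pdv_has_derivative[OF Z] pdv_has_derivative[OF f]]
    by (intro pdv_eqI[where f' = "\<lambda>v. pdv f (pdv Z v x) (Z x)"]) (simp add: o_def)
  also have "\<dots> = (\<Sum>c\<in>Basis. pdv (\<lambda>x. Z x \<bullet> c) v x *\<^sub>R pdv f c (Z x))"
    by (subst pdv_Basis[OF f]) (simp add: pdv_inner[OF Z])
  finally show ?thesis .
qed

lemma differentiable_comp:
  assumes "f differentiable at (Z x)" "Z differentiable at x"
  shows "(\<lambda>x. f (Z x)) differentiable at x"
  using differentiable_chain_at[OF assms(2,1)] by (simp add: o_def)

lemma deriv_along_line:
  fixes f :: "'b::real_normed_vector \<Rightarrow> real"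
  assumes "f differentiable at (z + s *\<^sub>R v)"
  shows "((\<lambda>t. f (z + t *\<^sub>R v)) has_real_derivative pdv f v (z + s *\<^sub>R v)) (at s)"
proof -
  have "((\<lambda>t. z + t *\<^sub>R v) has_derivative (\<lambda>h. h *\<^sub>R v)) (at s)"
    by (auto intro!: derivative_eq_intros)
  from has_derivative_compose[OF this pdv_has_derivative[OF assms]] show ?thesis
    unfolding has_field_derivative_def
    by (rule has_derivative_eq_rhs) (simp add: fun_eq_iff linear_scale[OF pdv_linear[OF assms]])
qed

lemma slope_lipschitz:
  fixes f :: "'b::real_normed_vector \<times> real \<Rightarrow> real"
  assumes d: "\<And>s. f differentiable at (x, s)" and C: "\<And>s. \<bar>pdv f (0, 1) (x, s)\<bar> \<le> C"
  shows "\<bar>f (x, s) - f (x, t)\<bar> \<le> C * \<bar>s - t\<bar>"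
proof -
  have "((\<lambda>s. f (x, s)) has_real_derivative pdv f (0, 1) (x, s)) (at s)" for s
    using deriv_along_line[of f "(x, 0)" s "(0, 1)"] d by simp
  then have "norm (f (x, s) - f (x, t)) \<le> C * norm (s - t)"
    by (intro field_differentiable_bound[of UNIV]) (use C in auto)
  then show ?thesis by simp
qed

section \<open>Functions of class \<open>C\<^sup>k\<close>\<close>

lemma Ck_on_cong_imp:
  assumes "open S"
  shows "Ck_on k S f \<Longrightarrow> (\<And>x. x \<in> S \<Longrightarrow> f x = g x) \<Longrightarrow> Ck_on k S g"
proof (induction k arbitrary: f g)
  case 0
  then show ?case by (simp cong: continuous_on_cong)
next
  case (Suc k)
  have eq: "pdv f v x = pdv g v x" "f differentiable at x \<longleftrightarrow> g differentiable at x" if "x \<in> S" for x v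
    using pdv_cong[OF assms that, of f g] Suc.prems(2) by auto
  have "Ck_on k S (pdv g v)" for v
    by (rule Suc.IH[of "pdv f v"]) (use Suc.prems(1) eq in auto)
  then show ?case using Suc.prems(1) eq by simp
qed

lemma Ck_on_differentiable: "Ck_on (Suc k) S f \<Longrightarrow> x \<in> S \<Longrightarrow> f differentiable at x"
  by simp

lemma Ck_on_pdv: "Ck_on (Suc k) S f \<Longrightarrow> Ck_on k S (pdv f v)"
  by simp

lemma Ck_on_SucD: "Ck_on (Suc k) S f \<Longrightarrow> Ck_on k S f"
proof (induction k arbitrary: f)
  case 0
  then show ?case
    by (auto intro!: continuous_at_imp_continuous_on differentiable_imp_continuous_within)
qed auto

lemma Ck_on_mono: "Ck_on k S f \<Longrightarrow> j \<le> k \<Longrightarrow> Ck_on j S f"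
  by (induction k) (auto simp: le_Suc_eq simp del: Ck_on.simps dest: Ck_on_SucD)

lemma Ck_on_continuous: "Ck_on k S f \<Longrightarrow> continuous_on S f"
  using Ck_on_mono[of k S f 0] by simp

lemma Ck_on_subset: "Ck_on k S f \<Longrightarrow> T \<subseteq> S \<Longrightarrow> Ck_on k T f"
  by (induction k arbitrary: f) (auto intro: continuous_on_subset)

lemma Ck_on_const: "Ck_on k S (\<lambda>x. c)"
  by (induction k arbitrary: c) auto

lemma Ck_on_add:
  assumes "open S"
  shows "Ck_on k S f \<Longrightarrow> Ck_on k S g \<Longrightarrow> Ck_on k S (\<lambda>x. f x + g x)"
proof (induction k arbitrary: f g)
  case 0
  then show ?case by (auto intro: continuous_intros)
next
  case (Suc k)
  have "Ck_on k S (pdv (\<lambda>x. f x + g x) v)" for v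
    by (rule Ck_on_cong_imp[OF assms Suc.IH[of "pdv f v" "pdv g v"]])
      (use Suc.prems in \<open>auto simp: pdv_add\<close>)
  then show ?case using Suc.prems by simp
qed

lemma Ck_on_sum:
  assumes "open S" "\<And>a. a \<in> A \<Longrightarrow> Ck_on k S (f a)"
  shows "Ck_on k S (\<lambda>x. \<Sum>a\<in>A. f a x)"
  using assms(2)
  by (induction A rule: infinite_finite_induct) (simp_all add: Ck_on_add[OF assms(1)] Ck_on_const del: Ck_on.simps)

lemma Ck_on_scaleR:
  assumes "open S"
  shows "Ck_on k S f \<Longrightarrow> Ck_on k S g \<Longrightarrow> Ck_on k S (\<lambda>x. f x *\<^sub>R g x)"
proof (induction k arbitrary: f g)
  case 0
  then show ?case by (auto intro: continuous_intros)
next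
  case (Suc k)
  have "Ck_on k S (pdv (\<lambda>x. f x *\<^sub>R g x) v)" for v
  proof (rule Ck_on_cong_imp[OF assms])
    show "Ck_on k S (\<lambda>x. f x *\<^sub>R pdv g v x + pdv f v x *\<^sub>R g x)"
      using Suc.prems Ck_on_SucD[OF Suc.prems(1)] Ck_on_SucD[OF Suc.prems(2)]
      by (intro Ck_on_add[OF assms] Suc.IH) auto
  qed (use Suc.prems in \<open>auto simp: pdv_scaleR\<close>)
  then show ?case using Suc.prems by simp
qed

lemma Ck_on_bounded_linear:
  assumes "open S" "bounded_linear L"
  shows "Ck_on k S f \<Longrightarrow> Ck_on k S (\<lambda>x. L (f x))"
proof (induction k arbitrary: f)
  case 0
  then show ?case by (simp add: bounded_linear.continuous_on[OF assms(2)])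
next
  case (Suc k)
  have d: "((\<lambda>x. L (f x)) has_derivative (\<lambda>v. L (pdv f v x))) (at x)" if "x \<in> S" for x
    using Suc.prems that by (intro bounded_linear.has_derivative[OF assms(2)] pdv_has_derivative) auto
  have "Ck_on k S (pdv (\<lambda>x. L (f x)) v)" for v
    by (rule Ck_on_cong_imp[OF assms(1) Suc.IH[of "pdv f v"]])
      (use Suc.prems pdv_eqI[OF d] in auto)
  moreover have "(\<lambda>x. L (f x)) differentiable at x" if "x \<in> S" for x
    using d[OF that] differentiable_def by blast
  ultimately show ?case by simp
qed

lemma Ck_on_linear_comp:
  assumes "open T" "bounded_linear A" "\<And>x. x \<in> T \<Longrightarrow> A x \<in> S"
  shows "Ck_on k S f \<Longrightarrow> Ck_on k T (\<lambda>x. f (A x))"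
proof (induction k arbitrary: f)
  case 0
  then show ?case
    using assms linear_continuous_on[OF assms(2), of T] continuous_on_compose2[of S f T A] by auto
next
  case (Suc k)
  have d: "((\<lambda>x. f (A x)) has_derivative (\<lambda>v. pdv f (A v) (A x))) (at x)" if "x \<in> T" for x
    by (rule has_derivative_compose[OF bounded_linear_imp_has_derivative[OF assms(2)] pdv_has_derivative])
      (use Suc.prems assms(3) that in auto)
  have "Ck_on k T (pdv (\<lambda>x. f (A x)) v)" for v
    by (rule Ck_on_cong_imp[OF assms(1) Suc.IH[of "pdv f (A v)"]])
      (use Suc.prems pdv_eqI[OF d] in auto)
  moreover have "(\<lambda>x. f (A x)) differentiable at x" if "x \<in> T" for x
    using d[OF that] differentiable_def by blast
  ultimately show ?case by simp
qed

lemma Ck_on_inverse: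
  fixes f :: "'a::real_normed_vector \<Rightarrow> real"
  assumes "open S" "\<And>x. x \<in> S \<Longrightarrow> f x \<noteq> 0"
  shows "Ck_on k S f \<Longrightarrow> Ck_on k S (\<lambda>x. inverse (f x))"
proof (induction k)
  case 0
  then show ?case using assms(2) by (auto intro: continuous_intros)
next
  case (Suc k)
  have f: "Ck_on k S f" "\<And>v. Ck_on k S (pdv f v)" "\<And>x. x \<in> S \<Longrightarrow> f differentiable at x"
    using Ck_on_SucD[OF Suc.prems] Suc.prems by auto
  have d: "((\<lambda>x. inverse (f x)) has_derivative (\<lambda>v. - (inverse (f x) * pdv f v x * inverse (f x)))) (at x)"
    if "x \<in> S" for x
    by (rule Deriv.has_derivative_inverse[OF assms(2)[OF that] pdv_has_derivative[OF f(3)[OF that]]])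
  have "Ck_on k S (pdv (\<lambda>x. inverse (f x)) v)" for v
  proof (rule Ck_on_cong_imp[OF assms(1)])
    have I: "Ck_on k S (\<lambda>x. inverse (f x))" by (rule Suc.IH[OF f(1)])
    show "Ck_on k S (\<lambda>x. (-1) *\<^sub>R (inverse (f x) *\<^sub>R (inverse (f x) *\<^sub>R pdv f v x)))"
      by (intro Ck_on_scaleR[OF assms(1)] Ck_on_const I f(2))
  qed (simp add: pdv_eqI[OF d])
  moreover have "(\<lambda>x. inverse (f x)) differentiable at x" if "x \<in> S" for x
    using d[OF that] differentiable_def by blast
  ultimately show ?case by simp
qed

section \<open>Families of functions with uniformly bounded derivatives\<close>

text \<open>The bounds may depend on the order and the direction of the derivative, but not on the index
  \<open>i \<in> I\<close> of the family; \<open>lubd\<close> below is the variant without a bound on the functions themselves.\<close>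

fun ubd :: "nat \<Rightarrow> 'a::euclidean_space set \<Rightarrow> 'i set \<Rightarrow> ('i \<Rightarrow> 'a \<Rightarrow> real) \<Rightarrow> bool" where
  "ubd 0 D I f \<longleftrightarrow> (\<exists>C. \<forall>i\<in>I. \<forall>x\<in>D. \<bar>f i x\<bar> \<le> C)"
| "ubd (Suc n) D I f \<longleftrightarrow> (\<exists>C. \<forall>i\<in>I. \<forall>x\<in>D. \<bar>f i x\<bar> \<le> C) \<and>
     (\<forall>i\<in>I. \<forall>x\<in>D. f i differentiable at x) \<and> (\<forall>b\<in>Basis. ubd n D I (\<lambda>i. pdv (f i) b))"

lemma ubd_bound: "ubd n D I f \<Longrightarrow> \<exists>C. \<forall>i\<in>I. \<forall>x\<in>D. \<bar>f i x\<bar> \<le> C"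
  by (cases n) auto

lemma ubd_bound0:
  assumes "ubd n D I f"
  obtains C where "C \<ge> 0" "\<And>i x. i \<in> I \<Longrightarrow> x \<in> D \<Longrightarrow> \<bar>f i x\<bar> \<le> C"
proof -
  obtain C where C: "\<forall>i\<in>I. \<forall>x\<in>D. \<bar>f i x\<bar> \<le> C"
    using ubd_bound[OF assms] by blast
  show ?thesis by (rule that[of "\<bar>C\<bar>"]) (use C in force)+
qed

lemma ubd_SucI:
  assumes "ubd 0 D I f" "\<And>i x. i \<in> I \<Longrightarrow> x \<in> D \<Longrightarrow> f i differentiable at x"
    "\<And>b. b \<in> Basis \<Longrightarrow> ubd n D I (\<lambda>i. pdv (f i) b)"
  shows "ubd (Suc n) D I f"
  using assms by simp

lemma ubd_cong_imp:
  assumes "open D"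
  shows "ubd n D I f \<Longrightarrow> (\<And>i x. i \<in> I \<Longrightarrow> x \<in> D \<Longrightarrow> f i x = g i x) \<Longrightarrow> ubd n D I g"
proof (induction n arbitrary: f g)
  case 0
  then show ?case by auto
next
  case (Suc n)
  have eq: "pdv (f i) b x = pdv (g i) b x" "f i differentiable at x \<longleftrightarrow> g i differentiable at x"
    if "i \<in> I" "x \<in> D" for i x b
    using pdv_cong[OF assms that(2), of "f i" "g i"] Suc.prems(2)[OF that(1)] by auto
  show ?case
  proof (rule ubd_SucI)
    show "ubd 0 D I g" using Suc.prems by auto
    show "ubd n D I (\<lambda>i. pdv (g i) b)" if "b \<in> Basis" for b
      by (rule Suc.IH[of "\<lambda>i. pdv (f i) b"]) (use Suc.prems(1) that eq in auto)
  qed (use Suc.prems(1) eq in auto)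
qed

lemma ubd_SucD: "ubd (Suc n) D I f \<Longrightarrow> ubd n D I f"
  by (induction n arbitrary: f) auto

lemma ubd_mono: "ubd n D I f \<Longrightarrow> k \<le> n \<Longrightarrow> ubd k D I f"
  by (induction n) (auto simp: le_Suc_eq dest: ubd_SucD simp del: ubd.simps)

lemma ubd_reindex:
  "ubd n D I f \<Longrightarrow> (\<And>j. j \<in> J \<Longrightarrow> g j \<in> I) \<Longrightarrow> D' \<subseteq> D \<Longrightarrow> ubd n D' J (\<lambda>j. f (g j))"
proof (induction n arbitrary: f)
  case 0
  then show ?case by (simp add: subset_iff) blast
next
  case (Suc n)
  have "ubd 0 D' J (\<lambda>j. f (g j))" using Suc.prems by (simp add: subset_iff) blast
  moreover have "ubd n D' J (\<lambda>j. pdv (f (g j)) b)" if "b \<in> Basis" for b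
    by (rule Suc.IH[of "\<lambda>i. pdv (f i) b"]) (use Suc.prems that in auto)
  ultimately show ?case using Suc.prems by (intro ubd_SucI) auto
qed

lemma ubd_const: "\<forall>i\<in>I. \<bar>c i\<bar> \<le> C \<Longrightarrow> ubd n D I (\<lambda>i x. c i)"
proof (induction n arbitrary: c C)
  case (Suc n)
  then show ?case using Suc.IH[of "\<lambda>i. 0" 0] by (intro ubd_SucI) auto
qed auto

lemma ubd0_add: "ubd 0 D I f \<Longrightarrow> ubd 0 D I g \<Longrightarrow> ubd 0 D I (\<lambda>i x. f i x + g i x)"
  by simp (meson abs_triangle_ineq add_mono order_trans)

lemma ubd0_mult:
  assumes "ubd 0 D I f" "ubd 0 D I g"
  shows "ubd 0 D I (\<lambda>i x. f i x * g i x)"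
proof -
  obtain C where C: "C \<ge> 0" "\<And>i x. i \<in> I \<Longrightarrow> x \<in> D \<Longrightarrow> \<bar>f i x\<bar> \<le> C"
    using ubd_bound0[OF assms(1)] by metis
  moreover obtain C' where "C' \<ge> 0" "\<And>i x. i \<in> I \<Longrightarrow> x \<in> D \<Longrightarrow> \<bar>g i x\<bar> \<le> C'"
    using ubd_bound0[OF assms(2)] by metis
  ultimately have "\<forall>i\<in>I. \<forall>x\<in>D. \<bar>f i x * g i x\<bar> \<le> C * C'"
    by (simp add: abs_mult mult_mono)
  then show ?thesis by auto
qed

lemma ubd_add:
  assumes "open D"
  shows "ubd n D I f \<Longrightarrow> ubd n D I g \<Longrightarrow> ubd n D I (\<lambda>i x. f i x + g i x)"
proof (induction n arbitrary: f g)
  case 0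
  then show ?case by (rule ubd0_add)
next
  case (Suc n)
  show ?case
  proof (rule ubd_SucI)
    show "ubd 0 D I (\<lambda>i x. f i x + g i x)"
      by (intro ubd0_add ubd_mono[OF Suc.prems(1)] ubd_mono[OF Suc.prems(2)]) auto
    show "ubd n D I (\<lambda>i. pdv (\<lambda>x. f i x + g i x) b)" if "b \<in> Basis" for b
      by (rule ubd_cong_imp[OF assms Suc.IH[of "\<lambda>i. pdv (f i) b" "\<lambda>i. pdv (g i) b"]])
        (use Suc.prems that in \<open>auto simp: pdv_add\<close>)
  qed (use Suc.prems in auto)
qed

lemma ubd_mult:
  assumes "open D"
  shows "ubd n D I f \<Longrightarrow> ubd n D I g \<Longrightarrow> ubd n D I (\<lambda>i x. f i x * g i x)"
proof (induction n arbitrary: f g)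
  case 0
  then show ?case by (rule ubd0_mult)
next
  case (Suc n)
  show ?case
  proof (rule ubd_SucI)
    show "ubd 0 D I (\<lambda>i x. f i x * g i x)"
      by (intro ubd0_mult ubd_mono[OF Suc.prems(1)] ubd_mono[OF Suc.prems(2)]) auto
    show "ubd n D I (\<lambda>i. pdv (\<lambda>x. f i x * g i x) b)" if b: "b \<in> Basis" for b
    proof (rule ubd_cong_imp[OF assms])
      show "ubd n D I (\<lambda>i x. f i x * pdv (g i) b x + pdv (f i) b x * g i x)"
        using Suc.prems b ubd_SucD[OF Suc.prems(1)] ubd_SucD[OF Suc.prems(2)]
        by (intro ubd_add[OF assms] Suc.IH) auto
    qed (use Suc.prems in \<open>auto simp: pdv_mult\<close>)
  qed (use Suc.prems in auto)
qed

lemma ubd_cmult: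
  assumes "open D" "ubd n D I f" "\<forall>i\<in>I. \<bar>c i\<bar> \<le> C"
  shows "ubd n D I (\<lambda>i x. c i * f i x)"
  by (intro ubd_mult[OF assms(1)] ubd_const[OF assms(3)] assms(2))

lemma ubd_uminus:
  assumes "open D" "ubd n D I f"
  shows "ubd n D I (\<lambda>i x. - f i x)"
  using ubd_cmult[OF assms, of "\<lambda>i. -1" 1] by simp

lemma ubd_diff:
  assumes "open D" "ubd n D I f" "ubd n D I g"
  shows "ubd n D I (\<lambda>i x. f i x - g i x)"
  using ubd_add[OF assms(1,2) ubd_uminus[OF assms(1,3)]] by simp

lemma ubd_sum:
  assumes "open D" "\<And>a. a \<in> A \<Longrightarrow> ubd n D I (f a)"
  shows "ubd n D I (\<lambda>i x. \<Sum>a\<in>A. f a i x)"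
  using assms(2)
proof (induction A rule: infinite_finite_induct)
  case (insert a A)
  then show ?case by (simp add: ubd_add[OF assms(1)] del: ubd.simps)
qed (use ubd_const[of I "\<lambda>_. 0" 0] in auto)

definition lubd :: "nat \<Rightarrow> 'a::euclidean_space set \<Rightarrow> 'i set \<Rightarrow> ('i \<Rightarrow> 'a \<Rightarrow> real) \<Rightarrow> bool" where
  "lubd n D I f \<longleftrightarrow> (n > 0 \<longrightarrow> (\<forall>i\<in>I. \<forall>x\<in>D. f i differentiable at x) \<and>
     (\<forall>b\<in>Basis. ubd (n - 1) D I (\<lambda>i. pdv (f i) b)))"

lemma ubd_imp_lubd: "ubd n D I f \<Longrightarrow> lubd n D I f"
  by (cases n) (auto simp: lubd_def)

lemma lubd_0 [simp]: "lubd 0 D I f"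
  by (simp add: lubd_def)

lemma lubd_Suc: "lubd (Suc n) D I f \<longleftrightarrow> (\<forall>i\<in>I. \<forall>x\<in>D. f i differentiable at x) \<and>
     (\<forall>b\<in>Basis. ubd n D I (\<lambda>i. pdv (f i) b))"
  by (simp add: lubd_def)

lemma lubd_SucD: "lubd (Suc n) D I f \<Longrightarrow> lubd n D I f"
  by (cases n) (auto simp: lubd_Suc simp del: ubd.simps dest: ubd_SucD)

lemma lubd_add:
  assumes "open D" "lubd n D I f" "lubd n D I g"
  shows "lubd n D I (\<lambda>i x. f i x + g i x)"
proof (cases n)
  case (Suc k)
  have "ubd k D I (\<lambda>i. pdv (\<lambda>x. f i x + g i x) b)" if "b \<in> Basis" for b
    by (rule ubd_cong_imp[OF assms(1) ubd_add[OF assms(1), of k I "\<lambda>i. pdv (f i) b" "\<lambda>i. pdv (g i) b"]])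
      (use assms(2,3) Suc that in \<open>auto simp: lubd_Suc pdv_add\<close>)
  then show ?thesis using assms Suc by (auto simp: lubd_Suc)
qed simp

lemma lubd_bounded_linear:
  assumes "\<And>i. i \<in> I \<Longrightarrow> bounded_linear (L i)" "\<And>i b. i \<in> I \<Longrightarrow> b \<in> Basis \<Longrightarrow> \<bar>L i b\<bar> \<le> C"
    "open D"
  shows "lubd n D I L"
proof (cases n)
  case (Suc k)
  have "ubd k D I (\<lambda>i. pdv (L i) b)" if "b \<in> Basis" for b
    by (rule ubd_cong_imp[OF assms(3) ubd_const[of I "\<lambda>i. L i b" C]])
      (use assms that in \<open>auto simp: pdv_bounded_linear\<close>)
  then show ?thesis
    using assms Suc by (auto simp: lubd_Suc bounded_linear_imp_differentiable)
qed simp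

text \<open>Once the values of \<open>Z\<close> stay in \<open>D'\<close>, derivatives of the
  composition see \<open>Z\<close> only through its own derivatives. Asking for \<open>lubd\<close>
  of the components admits the identity and other linear maps, which are unbounded on the whole
  space.\<close>

lemma ubd_comp:
  fixes f :: "'i \<Rightarrow> 'b::euclidean_space \<Rightarrow> real" and Z :: "'i \<Rightarrow> 'a::euclidean_space \<Rightarrow> 'b"
  assumes "open D" and Z: "\<And>i x. i \<in> I \<Longrightarrow> x \<in> D \<Longrightarrow> Z i x \<in> D'"
  shows "ubd n D' I f \<Longrightarrow> (\<And>c. c \<in> Basis \<Longrightarrow> lubd n D I (\<lambda>i x. Z i x \<bullet> c)) \<Longrightarrow>
    ubd n D I (\<lambda>i x. f i (Z i x))"
proof (induction n arbitrary: f)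
  case 0
  then show ?case using Z by simp blast
next
  case (Suc n)
  have diffZ: "Z i differentiable at x" if "i \<in> I" "x \<in> D" for i x
    using Suc.prems(2) that by (subst differentiable_componentwise_at) (auto simp: lubd_Suc)
  have difff: "f i differentiable at (Z i x)" if "i \<in> I" "x \<in> D" for i x
    using Suc.prems(1) that Z by simp
  show ?case
  proof (rule ubd_SucI)
    show "ubd 0 D I (\<lambda>i x. f i (Z i x))" using ubd_bound[OF Suc.prems(1)] Z by simp blast
    show "(\<lambda>x. f i (Z i x)) differentiable at x" if "i \<in> I" "x \<in> D" for i x
      by (rule differentiable_comp[of "f i", OF difff[OF that] diffZ[OF that]])
    show "ubd n D I (\<lambda>i. pdv (\<lambda>x. f i (Z i x)) b)" if b: "b \<in> Basis" for b
    proof (rule ubd_cong_imp[OF assms(1)])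
      show "ubd n D I (\<lambda>i x. \<Sum>c\<in>Basis. pdv (\<lambda>x. Z i x \<bullet> c) b x * pdv (f i) c (Z i x))"
      proof (intro ubd_sum ubd_mult assms(1))
        fix c :: 'b assume c: "c \<in> Basis"
        show "ubd n D I (\<lambda>i. pdv (\<lambda>x. Z i x \<bullet> c) b)"
          using Suc.prems(2) c b by (simp add: lubd_Suc)
        show "ubd n D I (\<lambda>i x. pdv (f i) c (Z i x))"
          using Suc.prems(1) c lubd_SucD[OF Suc.prems(2)] by (intro Suc.IH) auto
      qed
    qed (simp add: pdv_comp diffZ difff)
  qed
qed

lemma ubd_comp_Pair:
  fixes f :: "'i \<Rightarrow> 'a::euclidean_space \<times> real \<Rightarrow> real"
  assumes f: "ubd n UNIV I f" and u: "ubd n UNIV I u"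
  shows "ubd n UNIV I (\<lambda>i x. f i (x, u i x))"
proof (rule ubd_comp[OF _ _ f])
  fix c :: "'a \<times> real" assume "c \<in> Basis"
  then consider b where "b \<in> Basis" "c = (b, 0)" | "c = (0, 1)"
    by (auto simp: Basis_prod_def)
  then show "lubd n UNIV I (\<lambda>i x. (x, u i x) \<bullet> c)"
  proof cases
    case 1
    have "lubd n UNIV I (\<lambda>i x. x \<bullet> b)"
      by (rule lubd_bounded_linear[where C = 1])
        (use 1 in \<open>auto simp: bounded_linear_inner_left inner_Basis\<close>)
    with 1 show ?thesis by simp
  next
    case 2
    then show ?thesis using ubd_imp_lubd[OF u] by simp
  qed
qed auto

lemma ubd_comp_shift:
  fixes f :: "'i \<Rightarrow> 'a::euclidean_space \<Rightarrow> real"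
  assumes f: "ubd n UNIV I f" and Y: "\<And>c. c \<in> Basis \<Longrightarrow> ubd n UNIV I (\<lambda>i x. Y i x \<bullet> c)"
    and g: "\<forall>i\<in>I. \<bar>g i\<bar> \<le> C"
  shows "ubd n UNIV I (\<lambda>i x. f i (x + g i *\<^sub>R Y i x))"
proof (rule ubd_comp[OF _ _ f])
  fix c :: 'a assume c: "c \<in> Basis"
  have "lubd n UNIV I (\<lambda>i x. x \<bullet> c)"
    by (rule lubd_bounded_linear[where C = 1])
      (use c in \<open>auto simp: bounded_linear_inner_left inner_Basis\<close>)
  then show "lubd n UNIV I (\<lambda>i x. (x + g i *\<^sub>R Y i x) \<bullet> c)"
    using lubd_add[OF _ _ ubd_imp_lubd[OF ubd_cmult[OF _ Y[OF c] g]]]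
    by (simp add: inner_add_left)
qed auto

lemma ubd_differentiable: "ubd (Suc n) D I f \<Longrightarrow> i \<in> I \<Longrightarrow> x \<in> D \<Longrightarrow> f i differentiable at x"
  by simp

lemma ubd_lubdI: "ubd 0 D I f \<Longrightarrow> lubd n D I f \<Longrightarrow> ubd n D I f"
  by (cases n) (auto simp: lubd_Suc)

text \<open>Continuous derivatives are bounded on the compact set \<open>K\<close>; the bounds are
  asserted on a subset \<open>D\<close> so that \<open>D\<close> can be taken open.\<close>

lemma Ck_on_ubd:
  assumes "compact K" "K \<subseteq> S" "D \<subseteq> K"
  shows "Ck_on n S f \<Longrightarrow> ubd n D I (\<lambda>_. f)"
proof -
  have *: "ubd 0 D I (\<lambda>_. f)" if "continuous_on S f" for f
  proof -
    have "compact (f ` K)" using continuous_on_subset[OF that assms(2)] assms(1) by (rule compact_continuous_image)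
    then obtain C where "\<forall>y\<in>f ` K. norm y \<le> C" using compact_imp_bounded bounded_iff by metis
    then show ?thesis using assms(3) by (auto intro!: exI[of _ C])
  qed
  show "Ck_on n S f \<Longrightarrow> ubd n D I (\<lambda>_. f)"
  proof (induction n arbitrary: f)
    case 0
    then show ?case using * by simp
  next
    case (Suc n)
    show ?case
    proof (rule ubd_SucI)
      show "ubd 0 D I (\<lambda>_. f)" using *[OF Ck_on_continuous[OF Suc.prems]] .
      show "ubd n D I (\<lambda>i. pdv f b)" for b by (rule Suc.IH[OF Ck_on_pdv[OF Suc.prems]])
    qed (use Suc.prems assms in auto)
  qed
qed

section \<open>Uniform mean value and Taylor estimates, and limits of families\<close>

lemma pdv_bound:
  fixes f :: "'a::euclidean_space \<Rightarrow> real"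
  assumes "f differentiable at x" "\<And>b. b \<in> Basis \<Longrightarrow> \<bar>pdv f b x\<bar> \<le> C b"
  shows "\<bar>pdv f v x\<bar> \<le> (\<Sum>b\<in>Basis. C b) * norm v"
proof -
  have "\<bar>pdv f v x\<bar> \<le> (\<Sum>b\<in>Basis. \<bar>(v \<bullet> b) * pdv f b x\<bar>)"
    unfolding pdv_Basis[OF assms(1), of v] by (simp add: sum_abs)
  also have "\<dots> \<le> (\<Sum>b\<in>Basis. norm v * C b)"
    unfolding abs_mult by (intro sum_mono mult_mono assms(2) Basis_le_norm) auto
  finally show ?thesis by (simp add: sum_distrib_left mult.commute)
qed

lemma ubd_lipschitz:
  assumes "ubd (Suc n) D I f" "convex D"
  shows "\<exists>L\<ge>0. \<forall>i\<in>I. \<forall>x\<in>D. \<forall>y\<in>D. \<bar>f i x - f i y\<bar> \<le> L * norm (x - y)"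
proof -
  have "\<exists>C. \<forall>b\<in>Basis. C b \<ge> 0 \<and> (\<forall>i\<in>I. \<forall>x\<in>D. \<bar>pdv (f i) b x\<bar> \<le> C b)"
  proof (intro bchoice ballI)
    fix b :: 'a assume "b \<in> Basis"
    then have "ubd n D I (\<lambda>i. pdv (f i) b)" using assms(1) by simp
    then show "\<exists>C. C \<ge> 0 \<and> (\<forall>i\<in>I. \<forall>x\<in>D. \<bar>pdv (f i) b x\<bar> \<le> C)"
      by (rule ubd_bound0) blast
  qed
  then obtain C where C: "\<And>b. b \<in> Basis \<Longrightarrow> C b \<ge> 0"
    "\<And>b i x. b \<in> Basis \<Longrightarrow> i \<in> I \<Longrightarrow> x \<in> D \<Longrightarrow> \<bar>pdv (f i) b x\<bar> \<le> C b" by metis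
  have "\<bar>f i x - f i y\<bar> \<le> (\<Sum>b\<in>Basis. C b) * norm (x - y)" if "i \<in> I" "x \<in> D" "y \<in> D" for i x y
  proof -
    have "norm (f i x - f i y) \<le> (\<Sum>b\<in>Basis. C b) * norm (x - y)"
    proof (rule differentiable_bound[OF assms(2)])
      fix z assume z: "z \<in> D"
      have d: "f i differentiable at z" using ubd_differentiable[OF assms(1) that(1) z] .
      show "(f i has_derivative (\<lambda>v. pdv (f i) v z)) (at z within D)"
        by (rule has_derivative_at_withinI[OF pdv_has_derivative[OF d]])
      show "onorm (\<lambda>v. pdv (f i) v z) \<le> (\<Sum>b\<in>Basis. C b)"
        using pdv_bound[OF d C(2)[OF _ that(1) z]] by (intro onorm_le) auto
    qed (use that in auto)
    then show ?thesis by simp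
  qed
  moreover have "(\<Sum>b\<in>Basis. C b) \<ge> 0" using C(1) by (intro sum_nonneg)
  ultimately show ?thesis by blast
qed

text \<open>The first derivatives are Lipschitz uniformly in the family, so the function minus its
  linear part at \<open>x\<close> has derivative O(|v|) on the ball of radius |v|; the mean value
  inequality supplies the second factor |v|.\<close>

lemma ubd_taylor:
  assumes "ubd (Suc (Suc n)) UNIV I f"
  shows "\<exists>C\<ge>0. \<forall>i\<in>I. \<forall>x v. \<bar>f i (x + v) - f i x - pdv (f i) v x\<bar> \<le> C * (norm v)\<^sup>2"
proof -
  have d: "f i differentiable at x" if "i \<in> I" for i x
    using ubd_differentiable[OF assms that] by simp
  have "\<exists>C. \<forall>b\<in>Basis. C b \<ge> 0 \<and> (\<forall>i\<in>I. \<forall>x y. \<bar>pdv (f i) b x - pdv (f i) b y\<bar> \<le> C b * norm (x - y))"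
  proof (intro bchoice ballI)
    fix b :: 'a assume "b \<in> Basis"
    then have "ubd (Suc n) UNIV I (\<lambda>i. pdv (f i) b)" using assms by simp
    from ubd_lipschitz[OF this] show "\<exists>C. C \<ge> 0 \<and> (\<forall>i\<in>I. \<forall>x y. \<bar>pdv (f i) b x - pdv (f i) b y\<bar> \<le> C * norm (x - y))"
      by simp
  qed
  then obtain C where C: "\<And>b. b \<in> Basis \<Longrightarrow> C b \<ge> 0"
    "\<And>b i x y. b \<in> Basis \<Longrightarrow> i \<in> I \<Longrightarrow> \<bar>pdv (f i) b x - pdv (f i) b y\<bar> \<le> C b * norm (x - y)" by metis
  define K where "K = (\<Sum>b\<in>Basis. C b)"
  have K0: "K \<ge> 0" unfolding K_def using C(1) by (intro sum_nonneg)
  have "\<bar>f i (x + v) - f i x - pdv (f i) v x\<bar> \<le> K * (norm v)\<^sup>2" if i: "i \<in> I" for i x v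
  proof -
    define g where "g z = f i z - pdv (f i) z x" for z
    have lin: "bounded_linear (\<lambda>z. pdv (f i) z x)"
      using has_derivative_bounded_linear[OF pdv_has_derivative[OF d[OF i]]] .
    have "norm (g (x + v) - g x) \<le> (K * norm v) * norm ((x + v) - x)"
    proof (rule differentiable_bound[of "cball x (norm v)"])
      fix z assume z: "z \<in> cball x (norm v)"
      show "(g has_derivative (\<lambda>w. pdv (f i) w z - pdv (f i) w x)) (at z within cball x (norm v))"
        unfolding g_def
        by (rule has_derivative_at_withinI[OF has_derivative_diff[OF pdv_has_derivative[OF d[OF i]]
              bounded_linear_imp_has_derivative[OF lin]]])
      show "onorm (\<lambda>w. pdv (f i) w z - pdv (f i) w x) \<le> K * norm v"
      proof (rule onorm_le)
        fix w
        have "\<bar>pdv (f i) w z - pdv (f i) w x\<bar> = \<bar>\<Sum>b\<in>Basis. (w \<bullet> b) * (pdv (f i) b z - pdv (f i) b x)\<bar>"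
          unfolding pdv_Basis[OF d[OF i], where v = w] by (simp add: sum_subtractf right_diff_distrib)
        also have "\<dots> \<le> (\<Sum>b\<in>Basis. \<bar>(w \<bullet> b) * (pdv (f i) b z - pdv (f i) b x)\<bar>)" by (rule sum_abs)
        also have "\<dots> \<le> (\<Sum>b\<in>Basis. norm w * (C b * norm v))"
          unfolding abs_mult
        proof (intro sum_mono mult_mono Basis_le_norm)
          fix b :: 'a assume b: "b \<in> Basis"
          have "\<bar>pdv (f i) b z - pdv (f i) b x\<bar> \<le> C b * norm (z - x)" by (rule C(2)[OF b i])
          also have "\<dots> \<le> C b * norm v"
            using z C(1)[OF b] by (intro mult_left_mono) (auto simp: dist_norm norm_minus_commute)
          finally show "\<bar>pdv (f i) b z - pdv (f i) b x\<bar> \<le> C b * norm v" .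
        qed auto
        also have "\<dots> = K * norm v * norm w"
          by (simp add: K_def sum_distrib_left sum_distrib_right mult_ac)
        finally show "norm (pdv (f i) w z - pdv (f i) w x) \<le> K * norm v * norm w" by simp
      qed
    qed (auto simp: dist_norm)
    moreover have "g (x + v) - g x = f i (x + v) - f i x - pdv (f i) v x"
      unfolding g_def using linear_add[OF pdv_linear[OF d[OF i]], of x x v] by simp
    ultimately show ?thesis by (simp add: power2_eq_square)
  qed
  then show ?thesis using K0 by blast
qed

text \<open>Interpolation: a uniform bound on second derivatives turns uniform convergence of the
  functions into uniform convergence of their first derivatives.\<close>

lemma uniformly_Cauchy_pdv:
  fixes f :: "nat \<Rightarrow> 'a::euclidean_space \<Rightarrow> real"
  assumes f: "ubd (Suc (Suc n)) UNIV UNIV f" and c: "uniformly_Cauchy_on UNIV f" and b: "b \<in> Basis"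
  shows "uniformly_Cauchy_on UNIV (\<lambda>n. pdv (f n) b)"
  unfolding uniformly_Cauchy_on_def
proof (intro allI impI)
  fix e :: real assume e: "e > 0"
  obtain C where C: "C \<ge> 0" "\<And>i x v. \<bar>f i (x + v) - f i x - pdv (f i) v x\<bar> \<le> C * (norm v)\<^sup>2"
    using ubd_taylor[OF f] by auto
  \<comment> \<open>Difference quotients with increment \<open>s\<close> carry a Taylor error of at
    most \<open>e / 8\<close> for each of the two functions; closeness within
    \<open>s * e / 8\<close> at both end points adds \<open>e / 4\<close> after division by
    \<open>s\<close>. The total is \<open>e / 2\<close>.\<close>
  define s where "s = e / (8 * (C + 1))"
  have s: "s > 0" "C * s \<le> e / 8"
    using e C(1) by (auto simp: s_def field_simps)
  have "s * e / 8 > 0" using s e by simp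
  then obtain M where M: "\<And>x m n. m \<ge> M \<Longrightarrow> n \<ge> M \<Longrightarrow> dist (f m x) (f n x) < s * e / 8"
    using c unfolding uniformly_Cauchy_on_def by (metis UNIV_I)
  have "dist (pdv (f m) b x) (pdv (f n) b x) < e" if mn: "m \<ge> M" "n \<ge> M" for m n x
  proof -
    have sb: "pdv (f i) (s *\<^sub>R b) x = s * pdv (f i) b x" for i
      using linear_scale[OF pdv_linear, of "f i" x s b] ubd_differentiable[OF f, of i x] by simp
    have nb: "(norm (s *\<^sub>R b))\<^sup>2 = s * s" using b by (simp add: power2_eq_square)
    have "\<bar>s * pdv (f m) b x - s * pdv (f n) b x\<bar> \<le> s * e / 8 + s * e / 8 + 2 * (C * (s * s))"
      using C(2)[of m x "s *\<^sub>R b"] C(2)[of n x "s *\<^sub>R b"] M[OF mn, of x] M[OF mn, of "x + s *\<^sub>R b"]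
      unfolding sb nb dist_real_def by linarith
    also have "\<dots> = s * (e / 4 + 2 * (C * s))" by (simp add: algebra_simps)
    also have "\<dots> \<le> s * (e / 2)" using s by (intro mult_left_mono) auto
    finally have "s * \<bar>pdv (f m) b x - pdv (f n) b x\<bar> \<le> s * (e / 2)"
      using s by (simp add: abs_mult flip: right_diff_distrib)
    then show ?thesis using s e by (simp add: dist_real_def)
  qed
  then show "\<exists>M. \<forall>x\<in>UNIV. \<forall>m\<ge>M. \<forall>n\<ge>M. dist (pdv (f m) b x) (pdv (f n) b x) < e" by blast
qed

text \<open>Each induction step passes to the first derivatives, which are uniformly Cauchy by
  interpolation; interpolation consumes the one extra order in the hypothesis. Convergence of the
  derivatives is recorded so that a differential equation can be passed to the limit.\<close>

lemma uniform_limit_Ck: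
  fixes f :: "nat \<Rightarrow> 'a::euclidean_space \<Rightarrow> real"
  assumes "ubd (Suc k) UNIV UNIV f" "uniformly_Cauchy_on UNIV f"
  shows "\<exists>g. Ck_on k UNIV g \<and> uniform_limit UNIV f g sequentially \<and>
     (k > 0 \<longrightarrow> (\<forall>x v. (\<lambda>n. pdv (f n) v x) \<longlonglongrightarrow> pdv g v x))"
  using assms
proof (induction k arbitrary: f)
  case 0
  obtain g where g: "uniform_limit UNIV f g sequentially"
    using Cauchy_uniformly_convergent[OF 0(2)] by (auto simp: uniformly_convergent_on_def)
  have "continuous_on UNIV (f n)" for n
    using ubd_differentiable[OF 0(1)]
    by (auto intro!: continuous_at_imp_continuous_on differentiable_imp_continuous_within)
  then have "continuous_on UNIV g"
    using g by (intro uniform_limit_theorem[OF _ g]) auto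
  with g show ?case by auto
next
  case (Suc k)
  have df: "f n differentiable at x" for n x using ubd_differentiable[OF Suc.prems(1)] by simp
  obtain g where g: "uniform_limit UNIV f g sequentially"
    using Cauchy_uniformly_convergent[OF Suc.prems(2)] by (auto simp: uniformly_convergent_on_def)
  have "\<exists>G. \<forall>b\<in>Basis. Ck_on k UNIV (G b) \<and> uniform_limit UNIV (\<lambda>n. pdv (f n) b) (G b) sequentially"
  proof (intro bchoice ballI)
    fix b :: 'a assume b: "b \<in> Basis"
    have "ubd (Suc k) UNIV UNIV (\<lambda>n. pdv (f n) b)" using Suc.prems(1) b by simp
    from Suc.IH[OF this uniformly_Cauchy_pdv[OF Suc.prems b]]
    show "\<exists>G. Ck_on k UNIV G \<and> uniform_limit UNIV (\<lambda>n. pdv (f n) b) G sequentially" by blast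
  qed
  then obtain G where G: "\<And>b. b \<in> Basis \<Longrightarrow> Ck_on k UNIV (G b)"
    "\<And>b. b \<in> Basis \<Longrightarrow> uniform_limit UNIV (\<lambda>n. pdv (f n) b) (G b) sequentially" by metis
  define g' where "g' x v = (\<Sum>b\<in>Basis. (v \<bullet> b) * G b x)" for x v
  have der: "(g has_derivative g' x) (at x)" for x
  proof -
    have "\<exists>g. \<forall>x\<in>UNIV. (\<lambda>n. f n x) \<longlonglongrightarrow> g x \<and> (g has_derivative g' x) (at x within UNIV)"
    proof (rule has_derivative_sequence[where f' = "\<lambda>n x v. pdv (f n) v x"])
      show "(f n has_derivative (\<lambda>v. pdv (f n) v x)) (at x within UNIV)" for n x
        using pdv_has_derivative[OF df] by simp
      show "\<forall>\<^sub>F n in sequentially. \<forall>x\<in>UNIV. \<forall>h. norm (pdv (f n) h x - g' x h) \<le> e * norm h"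
        if e: "e > 0" for e
      proof -
        have "\<forall>\<^sub>F n in sequentially. \<forall>b\<in>Basis. \<forall>x\<in>UNIV. dist (pdv (f n) b x) (G b x) < e / DIM('a)"
          using e by (intro eventually_ball_finite ballI uniform_limitD[OF G(2)]) auto
        then show ?thesis
        proof eventually_elim
          case (elim n)
          have "norm (pdv (f n) h x - g' x h) \<le> e * norm h" for x h
          proof -
            have "pdv (f n) h x - g' x h = (\<Sum>b\<in>Basis. (h \<bullet> b) * (pdv (f n) b x - G b x))"
              unfolding pdv_Basis[OF df, where v = h] g'_def by (simp add: sum_subtractf right_diff_distrib)
            then have "norm (pdv (f n) h x - g' x h) \<le> (\<Sum>b\<in>Basis. \<bar>(h \<bullet> b) * (pdv (f n) b x - G b x)\<bar>)"
              by (simp add: sum_abs)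
            also have "\<dots> \<le> (\<Sum>b\<in>(Basis::'a set). norm h * (e / DIM('a)))"
              unfolding abs_mult using elim
              by (intro sum_mono mult_mono Basis_le_norm) (auto simp: dist_real_def less_imp_le)
            finally show ?thesis by (simp add: mult.commute)
          qed
          then show ?case by blast
        qed
      qed
      show "(\<lambda>n. f n 0) \<longlonglongrightarrow> g 0" using tendsto_uniform_limitI[OF g] by simp
    qed auto
    then obtain g2 where g2: "\<And>x. (\<lambda>n. f n x) \<longlonglongrightarrow> g2 x" "\<And>x. (g2 has_derivative g' x) (at x)" by auto
    have "g2 = g" using LIMSEQ_unique[OF g2(1) tendsto_uniform_limitI[OF g UNIV_I]] by blast
    with g2(2) show ?thesis by simp
  qed
  have pg: "pdv g v = (\<lambda>x. g' x v)" for v using pdv_eqI[OF der] by blast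
  have "Ck_on k UNIV (pdv g v)" for v
  proof -
    have "Ck_on k UNIV (\<lambda>x. (v \<bullet> b) *\<^sub>R G b x)" if "b \<in> Basis" for b
      by (rule Ck_on_scaleR[OF open_UNIV Ck_on_const G(1)[OF that]])
    then show ?thesis unfolding pg g'_def by (intro Ck_on_sum) (auto simp del: Ck_on.simps)
  qed
  moreover have "g differentiable at x" for x using der differentiable_def by blast
  moreover have "(\<lambda>n. pdv (f n) v x) \<longlonglongrightarrow> pdv g v x" for v x
  proof -
    have eq: "pdv (f n) v x = (\<Sum>b\<in>Basis. (v \<bullet> b) * pdv (f n) b x)" for n
      using pdv_Basis[OF df, where v = v] by simp
    show ?thesis
      unfolding eq pdv_eqI[OF der] g'_def by (intro tendsto_intros tendsto_uniform_limitI[OF G(2)]) auto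
  qed
  ultimately show ?case using g by auto
qed

section \<open>Bounds on the derivatives of one exact order\<close>

text \<open>Unlike \<open>ubd\<close>, \<open>dbd M n\<close> bounds the derivatives of order exactly \<open>n\<close>, and by the explicit constant \<open>M\<close>.\<close>

fun dbd :: "real \<Rightarrow> nat \<Rightarrow> ('a::euclidean_space \<Rightarrow> real) \<Rightarrow> bool" where
  "dbd M 0 f \<longleftrightarrow> (\<forall>x. \<bar>f x\<bar> \<le> M)"
| "dbd M (Suc n) f \<longleftrightarrow> (\<forall>x. f differentiable at x) \<and> (\<forall>b\<in>Basis. dbd M n (pdv f b))"

lemma dbd_mono: "dbd M n f \<Longrightarrow> M \<le> M' \<Longrightarrow> dbd M' n f"
  by (induction n arbitrary: f) (auto intro: order_trans)

lemma dbd_0: "0 \<le> M \<Longrightarrow> dbd M n (\<lambda>x. 0)"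
  by (induction n) auto

lemma ubd_Suc_dbd:
  "ubd n UNIV I f \<Longrightarrow> (\<And>i. i \<in> I \<Longrightarrow> dbd M (Suc n) (f i)) \<Longrightarrow> ubd (Suc n) UNIV I f"
proof (induction n arbitrary: f)
  case (Suc n)
  have "ubd (Suc n) UNIV I (\<lambda>i. pdv (f i) b)" if "b \<in> Basis" for b
    by (rule Suc.IH) (use Suc.prems that in auto)
  then show ?case using Suc.prems by (intro ubd_SucI) auto
qed (simp; blast)

lemma ubd_dbd: "ubd n UNIV I f \<Longrightarrow> \<exists>M. \<forall>i\<in>I. dbd M n (f i)"
proof (induction n arbitrary: f)
  case (Suc n)
  then have "\<exists>M. \<forall>b\<in>Basis. \<forall>i\<in>I. dbd (M b) n (pdv (f i) b)"
    by (intro bchoice) auto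
  then obtain M where M: "\<forall>b\<in>Basis. \<forall>i\<in>I. dbd (M b) n (pdv (f i) b)" ..
  have "M b \<le> Max (M ` Basis)" if "b \<in> Basis" for b using that by auto
  with M have "\<forall>b\<in>Basis. \<forall>i\<in>I. dbd (Max (M ` Basis)) n (pdv (f i) b)"
    by (meson dbd_mono)
  then show ?case using Suc.prems by (intro exI[of _ "Max (M ` Basis)"]) auto
qed auto

text \<open>The point is that the leading constant \<open>M\<close> enters with factor one: moving the base point by \<open>g Y\<close>
  only costs \<open>O(g)\<close>.\<close>

lemma dbd_comp_shift:
  fixes m e w :: "'i \<Rightarrow> 'a::euclidean_space \<Rightarrow> real" and Y :: "'i \<Rightarrow> 'a \<Rightarrow> 'a"
  assumes g: "\<And>i. i \<in> I \<Longrightarrow> 0 \<le> g i \<and> g i \<le> G"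
  shows "ubd n UNIV I m \<Longrightarrow> ubd n UNIV I e \<Longrightarrow> (\<And>c. c \<in> Basis \<Longrightarrow> ubd n UNIV I (\<lambda>i x. Y i x \<bullet> c)) \<Longrightarrow>
    (\<And>i x. i \<in> I \<Longrightarrow> w i x = m i (x + g i *\<^sub>R Y i x) + g i * e i x) \<Longrightarrow>
    \<exists>C\<ge>0. \<forall>i\<in>I. \<forall>M. dbd M n (m i) \<longrightarrow> dbd (M + g i * C) n (w i)"
proof (induction n arbitrary: m e w)
  case 0
  obtain C where C: "C \<ge> 0" "\<And>i x. i \<in> I \<Longrightarrow> x \<in> UNIV \<Longrightarrow> \<bar>e i x\<bar> \<le> C"
    using ubd_bound0[OF 0(2)] by metis
  have "\<bar>w i x\<bar> \<le> M + g i * C" if "i \<in> I" "\<forall>x. \<bar>m i x\<bar> \<le> M" for i x M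
  proof -
    have "\<bar>w i x\<bar> \<le> \<bar>m i (x + g i *\<^sub>R Y i x)\<bar> + \<bar>g i * e i x\<bar>"
      using 0(4)[OF that(1)] abs_triangle_ineq by simp
    also have "\<dots> \<le> M + g i * C"
      using g[OF that(1)] C(2)[OF that(1)] that(2) by (intro add_mono) (auto simp: abs_mult mult_left_mono)
    finally show ?thesis .
  qed
  then show ?case using C(1) by auto
next
  case (Suc n)
  define Z where "Z i x = x + g i *\<^sub>R Y i x" for i x
  have dY: "Y i differentiable at x" if "i \<in> I" for i x
    using Suc.prems(3) that by (subst differentiable_componentwise_at) auto
  have dZ: "Z i differentiable at x" if "i \<in> I" for i x
    unfolding Z_def using dY[OF that] by simp
  have dm: "m i differentiable at x" "e i differentiable at x" if "i \<in> I" for i x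
    using Suc.prems(1,2) that by auto
  have w: "w i = (\<lambda>x. m i (Z i x) + g i * e i x)" if "i \<in> I" for i
    using Suc.prems(4)[OF that] unfolding Z_def by blast
  have dmZ: "(\<lambda>x. m i (Z i x)) differentiable at x" if "i \<in> I" for i x
    by (rule differentiable_comp[of "m i", OF dm(1)[OF that] dZ[OF that]])
  have dw: "w i differentiable at x" if "i \<in> I" for i x
    unfolding w[OF that] using dmZ[OF that] dm[OF that] by simp
  \<comment> \<open>Differentiating \<open>m (x + g Y) + g e\<close> gives \<open>pdv m b\<close> at
    the shifted point plus \<open>g\<close> times \<open>e'\<close>, the same form one order lower.
    The perturbation \<open>e\<close> in the statement exists for this induction.\<close>
  define e' where "e' b i x = (\<Sum>c\<in>Basis. pdv (\<lambda>x. Y i x \<bullet> c) b x * pdv (m i) c (Z i x)) + pdv (e i) b x"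
    for b i x
  have pw: "pdv (w i) b x = pdv (m i) b (x + g i *\<^sub>R Y i x) + g i * e' b i x"
    if "i \<in> I" "b \<in> Basis" for i b x
  proof -
    have Zc: "pdv (\<lambda>x. Z i x \<bullet> c) b x = b \<bullet> c + g i * pdv (\<lambda>x. Y i x \<bullet> c) b x" for c
    proof (rule pdv_eqI)
      have "(\<lambda>x. Y i x \<bullet> c) differentiable at x" using dY[OF that(1)] by simp
      note d = pdv_has_derivative[OF this]
      show "((\<lambda>x. Z i x \<bullet> c) has_derivative (\<lambda>v. v \<bullet> c + g i * pdv (\<lambda>x. Y i x \<bullet> c) v x)) (at x)"
        unfolding Z_def inner_add_left inner_scaleR_left by (intro derivative_intros d)
    qed
    have "pdv (w i) b x = pdv (\<lambda>x. m i (Z i x)) b x + pdv (\<lambda>x. g i * e i x) b x"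
      unfolding w[OF that(1)] using dmZ[OF that(1)] dm[OF that(1)] by (intro pdv_add) auto
    also have "pdv (\<lambda>x. g i * e i x) b x = g i * pdv (e i) b x"
      by (subst pdv_mult) (auto simp: dm[OF that(1)])
    also have "pdv (\<lambda>x. m i (Z i x)) b x
        = (\<Sum>c\<in>Basis. (b \<bullet> c) * pdv (m i) c (Z i x)) + (\<Sum>c\<in>Basis. g i * (pdv (\<lambda>x. Y i x \<bullet> c) b x * pdv (m i) c (Z i x)))"
      by (subst pdv_comp[of "m i", OF dm(1)[OF that(1)] dZ[OF that(1)]])
        (simp add: Zc sum.distrib algebra_simps)
    also have "(\<Sum>c\<in>Basis. (b \<bullet> c) * pdv (m i) c (Z i x)) = pdv (m i) b (Z i x)"
      using pdv_Basis[OF dm(1)[OF that(1)], of "Z i x" b] by simp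
    finally show ?thesis by (simp add: e'_def Z_def sum_distrib_left algebra_simps)
  qed
  have "\<exists>C\<ge>0. \<forall>i\<in>I. \<forall>M. dbd M n (pdv (m i) b) \<longrightarrow> dbd (M + g i * C) n (pdv (w i) b)"
    if b: "b \<in> Basis" for b
  proof (rule Suc.IH)
    show "ubd n UNIV I (\<lambda>i. pdv (m i) b)" using Suc.prems(1) b by simp
    have mZ: "ubd n UNIV I (\<lambda>i x. pdv (m i) c (Z i x))" if "c \<in> Basis" for c
      unfolding Z_def using Suc.prems(1) that g ubd_SucD[OF Suc.prems(3)]
      by (intro ubd_comp_shift[of n I "\<lambda>i. pdv (m i) c" Y g G]) auto
    show "ubd n UNIV I (e' b)"
      unfolding e'_def using Suc.prems b mZ by (intro ubd_add ubd_sum ubd_mult) auto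
    show "ubd n UNIV I (\<lambda>i x. Y i x \<bullet> c)" if "c \<in> Basis" for c
      using ubd_SucD[OF Suc.prems(3)[OF that]] .
  qed (use pw b in auto)
  then have "\<exists>C. \<forall>b\<in>Basis. C b \<ge> 0 \<and> (\<forall>i\<in>I. \<forall>M. dbd M n (pdv (m i) b) \<longrightarrow> dbd (M + g i * C b) n (pdv (w i) b))"
    by (intro bchoice) blast
  then obtain C where C: "\<And>b. b \<in> Basis \<Longrightarrow> C b \<ge> 0"
    "\<And>b i M. b \<in> Basis \<Longrightarrow> i \<in> I \<Longrightarrow> dbd M n (pdv (m i) b) \<Longrightarrow> dbd (M + g i * C b) n (pdv (w i) b)"
    by blast
  define C' where "C' = (\<Sum>b\<in>Basis. C b)"
  have C': "C b \<le> C'" if "b \<in> Basis" for b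
    unfolding C'_def using C(1) that by (intro member_le_sum) auto
  have "dbd (M + g i * C') (Suc n) (w i)" if i: "i \<in> I" and d: "dbd M (Suc n) (m i)" for i M
  proof -
    have "dbd (M + g i * C') n (pdv (w i) b)" if "b \<in> Basis" for b
      by (rule dbd_mono[of "M + g i * C b"])
        (use C(2)[OF that i, of M] d C'[OF that] g[OF i] that in \<open>auto intro: mult_left_mono\<close>)
    then show ?thesis using dw[OF i] by simp
  qed
  moreover have "C' \<ge> 0" unfolding C'_def using C(1) by (intro sum_nonneg)
  ultimately show ?case by blast
qed

text \<open>Here \<open>K\<close> depends on the derivatives of \<open>w\<close> of order less than \<open>n\<close> only, so that \<open>M\<close> can be chosen
  large compared with \<open>K\<close> afterwards.\<close>

lemma dbd_damped:
  fixes w q r v :: "'i \<Rightarrow> 'a::euclidean_space \<Rightarrow> real"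
  assumes h: "\<And>i. i \<in> I \<Longrightarrow> 0 < h i \<and> h i \<le> 1"
    and q2: "\<And>i x. i \<in> I \<Longrightarrow> \<bar>q i x\<bar> \<le> 1 / 2"
  shows "ubd n UNIV I q \<Longrightarrow> ubd n UNIV I r \<Longrightarrow> (n > 0 \<longrightarrow> ubd (n - 1) UNIV I w) \<Longrightarrow>
    (\<And>i. i \<in> I \<Longrightarrow> \<exists>M. dbd M n (w i)) \<Longrightarrow>
    (\<And>i x. i \<in> I \<Longrightarrow> v i x = (1 - h i - h i * q i x) * w i x + h i * r i x) \<Longrightarrow>
    \<exists>K\<ge>0. \<forall>i\<in>I. \<forall>M. dbd M n (w i) \<longrightarrow> dbd ((1 - h i / 2) * M + h i * K) n (v i)"
proof (induction n arbitrary: w r v)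
  case 0
  obtain K where K: "K \<ge> 0" "\<And>i x. i \<in> I \<Longrightarrow> x \<in> UNIV \<Longrightarrow> \<bar>r i x\<bar> \<le> K"
    using ubd_bound0[OF 0(2)] by metis
  have "\<bar>v i x\<bar> \<le> (1 - h i / 2) * M + h i * K" if i: "i \<in> I" and M: "\<forall>x. \<bar>w i x\<bar> \<le> M" for i x M
  proof -
    \<comment> \<open>From \<open>|q| \<le> 1/2\<close> and \<open>h \<le> 1\<close> the factor
      \<open>1 - h - h q\<close> lies between \<open>-(1 - h/2)\<close> and
      \<open>1 - h/2\<close>.\<close>
    have hq: "\<bar>h i * q i x\<bar> \<le> h i / 2"
      using mult_left_mono[OF q2[OF i, of x], of "h i"] h[OF i] by (simp add: abs_mult)
    have "\<bar>1 - h i - h i * q i x\<bar> \<le> 1 - h i / 2" using hq h[OF i] by linarith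
    then have "\<bar>(1 - h i - h i * q i x) * w i x\<bar> \<le> (1 - h i / 2) * M"
      unfolding abs_mult using M h[OF i] by (intro mult_mono) auto
    moreover have "\<bar>h i * r i x\<bar> \<le> h i * K"
      using K(2)[OF i] h[OF i] by (simp add: abs_mult mult_left_mono)
    ultimately show ?thesis using 0(5)[OF i, of x] by linarith
  qed
  then show ?case using K(1) by auto
next
  case (Suc n)
  have dq: "q i differentiable at x" "r i differentiable at x" "w i differentiable at x" if "i \<in> I" for i x
    using Suc.prems(1,2,4) that by auto
  have v: "v i = (\<lambda>x. (1 - h i - h i * q i x) * w i x + h i * r i x)" if "i \<in> I" for i
    using Suc.prems(5)[OF that] by blast
  have dv: "v i differentiable at x" if "i \<in> I" for i x
    unfolding v[OF that] using dq[OF that] by simp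
  \<comment> \<open>The damping factor survives differentiation unchanged. Its own derivative
    multiplies \<open>w\<close>, which has one order less than the derivative being estimated and
    therefore joins the forcing term.\<close>
  have pv: "pdv (v i) b x = (1 - h i - h i * q i x) * pdv (w i) b x
      + h i * (pdv (r i) b x - pdv (q i) b x * w i x)" if "i \<in> I" for i b x
  proof (rule pdv_eqI)
    show "(v i has_derivative (\<lambda>b. (1 - h i - h i * q i x) * pdv (w i) b x
      + h i * (pdv (r i) b x - pdv (q i) b x * w i x))) (at x)"
      unfolding v[OF that]
      by (rule has_derivative_eq_rhs,
          (rule derivative_intros pdv_has_derivative dq[OF that])+)
        (auto simp: algebra_simps)
  qed
  have wn: "ubd n UNIV I w" using Suc.prems(3) by simp
  have "\<exists>K\<ge>0. \<forall>i\<in>I. \<forall>M. dbd M n (pdv (w i) b) \<longrightarrow> dbd ((1 - h i / 2) * M + h i * K) n (pdv (v i) b)"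
    if b: "b \<in> Basis" for b
  proof (rule Suc.IH)
    show "ubd n UNIV I q" by (rule ubd_SucD[OF Suc.prems(1)])
    show "ubd n UNIV I (\<lambda>i x. pdv (r i) b x - pdv (q i) b x * w i x)"
      using Suc.prems(1,2) b wn by (intro ubd_diff ubd_mult) auto
    show "n > 0 \<longrightarrow> ubd (n - 1) UNIV I (\<lambda>i. pdv (w i) b)"
      using wn b by (cases n) auto
    show "\<exists>M. dbd M n (pdv (w i) b)" if "i \<in> I" for i
      using Suc.prems(4)[OF that] b by auto
  qed (use pv in auto)
  then have "\<exists>K. \<forall>b\<in>Basis. K b \<ge> 0 \<and> (\<forall>i\<in>I. \<forall>M. dbd M n (pdv (w i) b) \<longrightarrow>
      dbd ((1 - h i / 2) * M + h i * K b) n (pdv (v i) b))"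
    by (intro bchoice) blast
  then obtain K where K: "\<And>b. b \<in> Basis \<Longrightarrow> K b \<ge> 0"
    "\<And>b i M. b \<in> Basis \<Longrightarrow> i \<in> I \<Longrightarrow> dbd M n (pdv (w i) b) \<Longrightarrow>
      dbd ((1 - h i / 2) * M + h i * K b) n (pdv (v i) b)"
    by blast
  define K' where "K' = (\<Sum>b\<in>Basis. K b)"
  have K': "K b \<le> K'" if "b \<in> Basis" for b
    unfolding K'_def using K(1) that by (intro member_le_sum) auto
  have "dbd ((1 - h i / 2) * M + h i * K') (Suc n) (v i)"
    if i: "i \<in> I" and d: "dbd M (Suc n) (w i)" for i M
  proof -
    have "dbd ((1 - h i / 2) * M + h i * K') n (pdv (v i) b)" if "b \<in> Basis" for b
      by (rule dbd_mono[of "(1 - h i / 2) * M + h i * K b"])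
        (use K(2)[OF that i, of M] d K'[OF that] h[OF i] that in \<open>auto intro: mult_left_mono\<close>)
    then show ?thesis using dv[OF i] by simp
  qed
  moreover have "K' \<ge> 0" unfolding K'_def using K(1) by (intro sum_nonneg)
  ultimately show ?case by blast
qed

section \<open>Existence of slow manifolds\<close>

text \<open>The slow-fast system x' = F(x, s), d s' = s + N(x, s), cut off so that it lives on the
  whole space with derivatives bounded uniformly in \<open>d\<close>. By \<open>N_slope\<close> the
  function s + N has slope at least 1/2 in s, and \<open>N_small\<close> confines the iterates of
  the scheme to |m| \<le> \<open>\<eta>\<close>.\<close>

locale slow_fast =
  fixes F :: "real \<Rightarrow> 'a::euclidean_space \<times> real \<Rightarrow> 'a" and N :: "real \<Rightarrow> 'a \<times> real \<Rightarrow> real"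
    and d0 \<eta> :: real
  assumes d0: "0 < d0" "d0 \<le> 1" and eta: "0 < \<eta>"
    and F_ubd: "\<And>n c. c \<in> Basis \<Longrightarrow> ubd n UNIV {0<..<d0} (\<lambda>d p. F d p \<bullet> c)"
    and N_ubd: "\<And>n. ubd n UNIV {0<..<d0} N"
    and N_slope: "\<And>d p. d \<in> {0<..<d0} \<Longrightarrow> \<bar>pdv (N d) (0, 1) p\<bar> \<le> 1 / 2"
    and N_small: "\<And>d x s. d \<in> {0<..<d0} \<Longrightarrow> \<bar>s\<bar> \<le> \<eta> \<Longrightarrow> \<bar>N d (x, s)\<bar> \<le> \<eta>"
begin

text \<open>\<open>shift m d h\<close> is \<open>m\<close> after an Euler step of length \<open>h d\<close> of the slow dynamics on its graph; \<open>step\<close> adds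
  an Euler step of the fast relaxation.\<close>

definition shift :: "('a \<Rightarrow> real) \<Rightarrow> real \<Rightarrow> real \<Rightarrow> 'a \<Rightarrow> real" where
  "shift m d h x = m (x + (h * d) *\<^sub>R F d (x, m x))"

definition step :: "('a \<Rightarrow> real) \<Rightarrow> real \<Rightarrow> real \<Rightarrow> 'a \<Rightarrow> real" where
  "step m d h x = (1 - h) * shift m d h x - h * N d (x, shift m d h x)"

abbreviation "shift' i \<equiv> shift (fst i) (fst (snd i)) (snd (snd i))"
abbreviation "step' i \<equiv> step (fst i) (fst (snd i)) (snd (snd i))"

lemma F_graph_ubd:
  assumes A: "A \<subseteq> UNIV \<times> {0<..<d0} \<times> {0<..1}" and m: "ubd n UNIV A fst" and c: "c \<in> Basis"
  shows "ubd n UNIV A (\<lambda>i x. F (fst (snd i)) (x, fst i x) \<bullet> c)"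
proof (rule ubd_comp_Pair[where f = "\<lambda>i p. F (fst (snd i)) p \<bullet> c" and u = fst])
  show "ubd n UNIV A (\<lambda>i p. F (fst (snd i)) p \<bullet> c)"
    by (rule ubd_reindex[OF F_ubd[OF c], where g = "\<lambda>i. fst (snd i)"]) (use A in auto)
qed (use m in simp)

lemma shift_ubd:
  assumes A: "A \<subseteq> UNIV \<times> {0<..<d0} \<times> {0<..1}" and m: "ubd n UNIV A fst"
  shows "ubd n UNIV A shift'"
proof -
  have "ubd n UNIV A (\<lambda>i x. fst i (x + (snd (snd i) * fst (snd i)) *\<^sub>R F (fst (snd i)) (x, fst i x)))"
  proof (rule ubd_comp_shift[OF m])
    show "\<forall>i\<in>A. \<bar>snd (snd i) * fst (snd i)\<bar> \<le> 1"
      using A d0 by (auto simp: abs_mult intro!: mult_le_one)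
  qed (rule F_graph_ubd[OF A m])
  then show ?thesis unfolding shift_def .
qed

lemma N_shift_ubd:
  assumes A: "A \<subseteq> UNIV \<times> {0<..<d0} \<times> {0<..1}" and m: "ubd n UNIV A fst" and b: "b \<in> Basis"
  shows "ubd n UNIV A (\<lambda>i x. pdv (N (fst (snd i))) b (x, shift' i x))"
proof (rule ubd_comp_Pair[where f = "\<lambda>i. pdv (N (fst (snd i))) b"])
  have "ubd n UNIV {0<..<d0} (\<lambda>d. pdv (N d) b)"
    using N_ubd[of "Suc n"] b by simp
  then show "ubd n UNIV A (\<lambda>i. pdv (N (fst (snd i))) b)"
    by (rule ubd_reindex[where g = "\<lambda>i. fst (snd i)"]) (use A in auto)
qed (rule shift_ubd[OF A m])

lemma N_diff: "d \<in> {0<..<d0} \<Longrightarrow> N d differentiable at p"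
  by (rule ubd_differentiable[OF N_ubd]) auto

lemma N_slope_lipschitz: "d \<in> {0<..<d0} \<Longrightarrow> \<bar>N d (x, s) - N d (x, t)\<bar> \<le> \<bar>s - t\<bar> / 2"
  using slope_lipschitz[of "N d" x "1 / 2" s t] N_diff N_slope by simp

lemma step_bound:
  assumes d: "d \<in> {0<..<d0}" and h: "h \<in> {0<..1}" and m: "\<And>x. \<bar>m x\<bar> \<le> \<eta>"
  shows "\<bar>step m d h x\<bar> \<le> \<eta>"
proof -
  have n: "\<bar>shift m d h x\<bar> \<le> \<eta>" unfolding shift_def by (rule m)
  have "\<bar>(1 - h) * shift m d h x\<bar> \<le> (1 - h) * \<eta>"
    using n h by (simp add: abs_mult mult_left_mono)
  moreover have "\<bar>h * N d (x, shift m d h x)\<bar> \<le> h * \<eta>"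
    using N_small[OF d n] h by (simp add: abs_mult mult_left_mono)
  ultimately show ?thesis unfolding step_def by (simp add: left_diff_distrib)
qed

text \<open>A class of graphs that no step leaves, whatever \<open>h\<close>, with common bounds up
  to order \<open>i\<close>. Each further order intersects the class with one more explicit bound
  and shrinks \<open>D\<close>; in this way the smallness of \<open>\<delta>\<close> comes to depend
  on the order of smoothness.\<close>

definition invariant_class :: "nat \<Rightarrow> ('a \<Rightarrow> real) set \<Rightarrow> real \<Rightarrow> bool" where
  "invariant_class i \<M> D \<longleftrightarrow> (\<lambda>x. 0) \<in> \<M> \<and> ubd i UNIV \<M> (\<lambda>m. m) \<and> (\<forall>m\<in>\<M>. \<forall>x. \<bar>m x\<bar> \<le> \<eta>) \<and>
     0 < D \<and> D \<le> d0 \<and> (\<forall>m\<in>\<M>. \<forall>d\<in>{0<..<D}. \<forall>h\<in>{0<..1}. step m d h \<in> \<M>)"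

lemma invariant_class_0: "invariant_class 0 {m. \<forall>x. \<bar>m x\<bar> \<le> \<eta>} d0"
  using step_bound d0 eta by (auto simp: invariant_class_def)

text \<open>If \<open>M\<close> bounds the derivatives of order \<open>i + 1\<close>, the shift
  raises it to \<open>M + h d C\<close> and the relaxation leaves at most
  \<open>(1 - h/2) M + h d C + h K'\<close>. For \<open>M = 2 (K' + 1)\<close> this is
  \<open>M + h (d C - 1)\<close>, so \<open>d C \<le> 1\<close> restores \<open>M\<close>. The order
  of the choices matters: \<open>K'\<close> depends on lower orders only, \<open>C\<close> may
  depend on \<open>M\<close>, and \<open>D'\<close> depends on \<open>C\<close>.\<close>

lemma invariant_class_Suc:
  assumes "invariant_class i \<M> D"
  shows "\<exists>\<M>' D'. invariant_class (Suc i) \<M>' D'"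
proof -
  have M0: "(\<lambda>x. 0) \<in> \<M>" and ubdM: "ubd i UNIV \<M> (\<lambda>m. m)" and etaM: "\<And>m x. m \<in> \<M> \<Longrightarrow> \<bar>m x\<bar> \<le> \<eta>"
    and D: "0 < D" "D \<le> d0" and stepM: "\<And>m d h. m \<in> \<M> \<Longrightarrow> d \<in> {0<..<D} \<Longrightarrow> h \<in> {0<..1} \<Longrightarrow> step m d h \<in> \<M>"
    using assms by (auto simp: invariant_class_def)
  \<comment> \<open>Members of \<open>J\<close> have some bound of order \<open>i + 1\<close>, not a
    common one: \<open>K\<close> must be fixed before \<open>M\<close> is chosen from it.\<close>
  define J where "J = {m \<in> \<M>. \<exists>M. dbd M (Suc i) m} \<times> {0<..<D} \<times> {0<..1::real}"
  have J: "J \<subseteq> UNIV \<times> {0<..<d0} \<times> {0<..1}" using D by (auto simp: J_def)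
  have mJ: "ubd i UNIV J fst"
    using ubd_reindex[OF ubdM, of J fst UNIV] by (auto simp: J_def)
  have wJ: "ubd i UNIV J shift'" by (rule shift_ubd[OF J mJ])
  \<comment> \<open>Some bound of order \<open>i + 1\<close> survives the shift; treating each graph
    as a singleton family avoids any uniformity here.\<close>
  have w_top: "\<exists>M. dbd M (Suc i) (shift' \<iota>)" if "\<iota> \<in> J" for \<iota>
  proof -
    have "\<exists>M. dbd M (Suc i) (fst \<iota>)"
      using that unfolding J_def by (simp add: mem_Times_iff del: dbd.simps)
    then obtain M where "dbd M (Suc i) (fst \<iota>)" ..
    moreover have "ubd i UNIV {\<iota>} fst" using ubd_reindex[OF mJ, of "{\<iota>}" "\<lambda>x. x" UNIV] that by simp
    ultimately have "ubd (Suc i) UNIV {\<iota>} fst"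
      by (intro ubd_Suc_dbd[where M = M]) (auto simp del: dbd.simps ubd.simps)
    then have "ubd (Suc i) UNIV {\<iota>} shift'"
      using that J by (intro shift_ubd) (auto simp del: ubd.simps)
    from ubd_dbd[OF this] show ?thesis by (simp del: dbd.simps)
  qed
  have "\<exists>K\<ge>0. \<forall>\<iota>\<in>J. \<forall>M. dbd M i (pdv (shift' \<iota>) b) \<longrightarrow>
      dbd ((1 - snd (snd \<iota>) / 2) * M + snd (snd \<iota>) * K) i (pdv (step' \<iota>) b)"
    if b: "b \<in> Basis" for b
  \<comment> \<open>The derivative of \<open>step\<close> in direction \<open>b\<close> has the
    damped form, with \<open>w\<close> the derivative of the shift, \<open>q\<close> the slope of
    \<open>N\<close> in s and \<open>r\<close> minus its slope in \<open>b\<close>.\<close>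
  proof (rule dbd_damped)
    show "0 < snd (snd \<iota>) \<and> snd (snd \<iota>) \<le> 1" if "\<iota> \<in> J" for \<iota> using that by (auto simp: J_def)
    show "\<bar>pdv (N (fst (snd \<iota>))) (0, 1) (x, shift' \<iota> x)\<bar> \<le> 1 / 2" if "\<iota> \<in> J" for \<iota> x
      using N_slope that J by auto
    show "ubd i UNIV J (\<lambda>\<iota> x. pdv (N (fst (snd \<iota>))) (0, 1) (x, shift' \<iota> x))"
      by (rule N_shift_ubd[OF J mJ]) (auto simp: Basis_prod_def)
    show "ubd i UNIV J (\<lambda>\<iota> x. - pdv (N (fst (snd \<iota>))) (b, 0) (x, shift' \<iota> x))"
      by (intro ubd_uminus N_shift_ubd[OF J mJ]) (use b in \<open>auto simp: Basis_prod_def\<close>)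
    show "0 < i \<longrightarrow> ubd (i - 1) UNIV J (\<lambda>\<iota>. pdv (shift' \<iota>) b)"
      using wJ b by (cases i) auto
    show "\<exists>M. dbd M i (pdv (shift' \<iota>) b)" if "\<iota> \<in> J" for \<iota>
      using w_top[OF that] b by auto
    fix \<iota> x assume \<iota>: "\<iota> \<in> J"
    obtain m d h where i: "\<iota> = (m, d, h)" by (metis prod.exhaust)
    have d: "d \<in> {0<..<d0}" using \<iota> J i by auto
    have dw: "shift m d h differentiable at x" using w_top[OF \<iota>] i by auto
    have dN: "((\<lambda>x. N d (x, shift m d h x)) has_derivative (\<lambda>v. pdv (N d) (v, pdv (shift m d h) v x) (x, shift m d h x))) (at x)"
      by (rule has_derivative_compose[OF _ pdv_has_derivative[OF N_diff[OF d]]])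
        (rule has_derivative_Pair[OF has_derivative_ident pdv_has_derivative[OF dw]])
    have "pdv (N d) (b, s) p = pdv (N d) (b, 0) p + s * pdv (N d) (0, 1) p" for s p
    proof -
      interpret linear "\<lambda>v. pdv (N d) v p" by (rule pdv_linear[OF N_diff[OF d]])
      have "pdv (N d) ((b, 0) + s *\<^sub>R (0, 1)) p = pdv (N d) (b, 0) p + s * pdv (N d) (0, 1) p"
        unfolding add scale by simp
      then show ?thesis by simp
    qed
    note split = this
    have "pdv (step m d h) b x = (1 - h) * pdv (shift m d h) b x
        - h * pdv (N d) (b, pdv (shift m d h) b x) (x, shift m d h x)"
      unfolding step_def
      by (rule pdv_eqI[OF has_derivative_diff[OF has_derivative_mult_right[OF pdv_has_derivative[OF dw]]
            has_derivative_mult_right[OF dN]]])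
    then show "pdv (step' \<iota>) b x = (1 - snd (snd \<iota>) - snd (snd \<iota>) * pdv (N (fst (snd \<iota>))) (0, 1) (x, shift' \<iota> x))
        * pdv (shift' \<iota>) b x + snd (snd \<iota>) * - pdv (N (fst (snd \<iota>))) (b, 0) (x, shift' \<iota> x)"
      by (simp add: i split[of "(x, shift m d h x)" "pdv (shift m d h) b x"] algebra_simps)
  qed
  then have "\<exists>K. \<forall>b\<in>Basis. K b \<ge> 0 \<and> (\<forall>\<iota>\<in>J. \<forall>M. dbd M i (pdv (shift' \<iota>) b) \<longrightarrow>
      dbd ((1 - snd (snd \<iota>) / 2) * M + snd (snd \<iota>) * K b) i (pdv (step' \<iota>) b))"
    by (intro bchoice) blast
  then obtain K where K: "\<And>b. b \<in> Basis \<Longrightarrow> K b \<ge> 0"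
    "\<And>b \<iota> M. b \<in> Basis \<Longrightarrow> \<iota> \<in> J \<Longrightarrow> dbd M i (pdv (shift' \<iota>) b) \<Longrightarrow>
      dbd ((1 - snd (snd \<iota>) / 2) * M + snd (snd \<iota>) * K b) i (pdv (step' \<iota>) b)"
    by blast
  define K' where "K' = (\<Sum>b\<in>Basis. K b)"
  have K': "K b \<le> K'" if "b \<in> Basis" for b
    unfolding K'_def using K(1) that by (intro member_le_sum) auto
  have K'0: "K' \<ge> 0" unfolding K'_def using K(1) by (intro sum_nonneg)
  define M where "M = 2 * (K' + 1)"
  define \<M>' where "\<M>' = {m \<in> \<M>. dbd M (Suc i) m}"
  have ubdM': "ubd (Suc i) UNIV \<M>' (\<lambda>m. m)"
  proof (rule ubd_Suc_dbd[where M = M])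
    show "ubd i UNIV \<M>' (\<lambda>m. m)"
      using ubd_reindex[OF ubdM, of \<M>' "\<lambda>m. m" UNIV] by (auto simp: \<M>'_def)
  qed (auto simp: \<M>'_def simp del: dbd.simps)
  \<comment> \<open>On \<open>J'\<close> the order \<open>i + 1\<close> is bounded by the fixed
    \<open>M\<close>, so the constant \<open>C\<close> of the shift is uniform there.\<close>
  define J' where "J' = \<M>' \<times> {0<..<D} \<times> {0<..1::real}"
  have J': "J' \<subseteq> UNIV \<times> {0<..<d0} \<times> {0<..1}" "J' \<subseteq> J" using D by (auto simp: J'_def J_def \<M>'_def)
  have mJ': "ubd (Suc i) UNIV J' fst"
    using ubd_reindex[OF ubdM', of J' fst UNIV] by (auto simp: J'_def)
  have "\<exists>C\<ge>0. \<forall>\<iota>\<in>J'. \<forall>M. dbd M (Suc i) (fst \<iota>) \<longrightarrow>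
      dbd (M + (snd (snd \<iota>) * fst (snd \<iota>)) * C) (Suc i) (shift' \<iota>)"
  proof (rule dbd_comp_shift[where e = "\<lambda>\<iota> x. 0" and G = 1])
    show "0 \<le> snd (snd \<iota>) * fst (snd \<iota>) \<and> snd (snd \<iota>) * fst (snd \<iota>) \<le> 1" if "\<iota> \<in> J'" for \<iota>
      using that J' d0 by (auto simp: intro!: mult_le_one)
    show "ubd (Suc i) UNIV J' (\<lambda>\<iota> x. 0)" by (rule ubd_const[where c = "\<lambda>i. 0"]) auto
  qed (use mJ' F_graph_ubd[OF J'(1) mJ'] in \<open>auto simp: shift_def simp del: ubd.simps\<close>)
  then obtain C where C: "C \<ge> 0" "\<And>\<iota> M. \<iota> \<in> J' \<Longrightarrow> dbd M (Suc i) (fst \<iota>) \<Longrightarrow>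
      dbd (M + (snd (snd \<iota>) * fst (snd \<iota>)) * C) (Suc i) (shift' \<iota>)"
    by blast
  define D' where "D' = min D (1 / (C + 1))"
  have "invariant_class (Suc i) \<M>' D'"
    unfolding invariant_class_def
  proof (intro conjI ballI)
    show "(\<lambda>x. 0) \<in> \<M>'" using M0 dbd_0[of M "Suc i"] K'0 by (simp add: \<M>'_def M_def del: dbd.simps)
    show "ubd (Suc i) UNIV \<M>' (\<lambda>m. m)" by (rule ubdM')
    show "0 < D'" "D' \<le> d0" using D C(1) by (auto simp: D'_def)
    fix m assume m: "m \<in> \<M>'"
    show "\<forall>x. \<bar>m x\<bar> \<le> \<eta>" using m etaM by (auto simp: \<M>'_def)
    fix d h :: real assume d: "d \<in> {0<..<D'}" and h: "h \<in> {0<..1}"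
    have \<iota>: "(m, d, h) \<in> J'" "(m, d, h) \<in> J" using m d h J' by (auto simp: J'_def D'_def)
    have top: "dbd (M + (h * d) * C) (Suc i) (shift m d h)"
      using C(2)[OF \<iota>(1), of M] m by (simp add: \<M>'_def del: dbd.simps)
    have dstep: "step m d h differentiable at x" for x
    proof -
      have dw: "shift m d h differentiable at x" using top by auto
      have "d \<in> {0<..<d0}" using \<iota> J by auto
      have "(\<lambda>x. N d (x, shift m d h x)) differentiable at x"
        by (rule differentiable_comp[OF N_diff[OF \<open>d \<in> {0<..<d0}\<close>]])
          (use dw in \<open>auto intro: differentiable_Pair\<close>)
      then show ?thesis unfolding step_def[abs_def] using dw by (intro derivative_intros) auto
    qed
    have "d * C \<le> 1"
    proof -
      have "d * C \<le> 1 / (C + 1) * (C + 1)"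
        using d C(1) by (intro mult_mono) (auto simp: D'_def)
      then show ?thesis using C(1) by simp
    qed
    have le: "(1 - h / 2) * (M + (h * d) * C) + h * K b \<le> M" if "b \<in> Basis" for b
    proof -
      have "(1 - h / 2) * (M + (h * d) * C) + h * K b \<le> (1 - h / 2) * M + 1 * ((h * d) * C) + h * K'"
        unfolding distrib_left
        using h d C(1) K'[OF that] by (intro add_mono mult_right_mono mult_left_mono) (auto simp: D'_def)
      also have "\<dots> = M + h * (d * C - 1)" by (simp add: M_def algebra_simps)
      also have "\<dots> \<le> M" using h \<open>d * C \<le> 1\<close> by (simp add: mult_nonneg_nonpos)
      finally show ?thesis .
    qed
    have "dbd M i (pdv (step m d h) b)" if b: "b \<in> Basis" for b
      using dbd_mono[OF K(2)[OF b \<iota>(2), of "M + (h * d) * C"]] le[OF b] top b by simp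
    then have "dbd M (Suc i) (step m d h)" using dstep by simp
    moreover have "step m d h \<in> \<M>" using m d h stepM by (auto simp: \<M>'_def D'_def)
    ultimately show "step m d h \<in> \<M>'" by (simp add: \<M>'_def del: dbd.simps)
  qed
  then show ?thesis by blast
qed

lemma invariant_class_exists: "\<exists>\<M> D. invariant_class i \<M> D"
  by (induction i) (use invariant_class_0 invariant_class_Suc in blast)+

lemma F_bounded: "\<exists>B\<ge>0. \<forall>d\<in>{0<..<d0}. \<forall>p. norm (F d p) \<le> B"
proof -
  have "\<exists>C. \<forall>c\<in>Basis. C c \<ge> 0 \<and> (\<forall>d\<in>{0<..<d0}. \<forall>p. \<bar>F d p \<bullet> c\<bar> \<le> C c)"
    by (intro bchoice ballI, rule ubd_bound0[OF F_ubd[of _ 0]]) blast+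
  then obtain C where C: "\<And>c. c \<in> Basis \<Longrightarrow> C c \<ge> 0"
    "\<And>c d p. c \<in> Basis \<Longrightarrow> d \<in> {0<..<d0} \<Longrightarrow> \<bar>F d p \<bullet> c\<bar> \<le> C c" by metis
  have "norm (F d p) \<le> (\<Sum>c\<in>Basis. C c)" if "d \<in> {0<..<d0}" for d p
    by (rule order_trans[OF norm_le_l1 sum_mono]) (use C(2) that in auto)
  moreover have "(\<Sum>c\<in>Basis. C c) \<ge> 0" using C(1) by (intro sum_nonneg)
  ultimately show ?thesis by blast
qed

lemma F_lipschitz: "\<exists>L\<ge>0. \<forall>d\<in>{0<..<d0}. \<forall>x s t. norm (F d (x, s) - F d (x, t)) \<le> L * \<bar>s - t\<bar>"
proof -
  have "\<exists>C. \<forall>c\<in>Basis. C c \<ge> 0 \<and> (\<forall>d\<in>{0<..<d0}. \<forall>p q. \<bar>F d p \<bullet> c - F d q \<bullet> c\<bar> \<le> C c * norm (p - q))"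
  proof (intro bchoice ballI)
    fix c :: 'a assume "c \<in> Basis"
    from ubd_lipschitz[OF F_ubd[OF this, of "Suc 0"]]
    show "\<exists>C. C \<ge> 0 \<and> (\<forall>d\<in>{0<..<d0}. \<forall>p q. \<bar>F d p \<bullet> c - F d q \<bullet> c\<bar> \<le> C * norm (p - q))"
      by simp
  qed
  then obtain C where C: "\<And>c. c \<in> Basis \<Longrightarrow> C c \<ge> 0"
    "\<And>c d p q. c \<in> Basis \<Longrightarrow> d \<in> {0<..<d0} \<Longrightarrow> \<bar>F d p \<bullet> c - F d q \<bullet> c\<bar> \<le> C c * norm (p - q)"
    by metis
  have "norm (F d (x, s) - F d (x, t)) \<le> (\<Sum>c\<in>Basis. C c) * \<bar>s - t\<bar>" if "d \<in> {0<..<d0}" for d x s t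
  proof -
    have "norm (F d (x, s) - F d (x, t)) \<le> (\<Sum>c\<in>Basis. C c * \<bar>s - t\<bar>)"
      by (rule order_trans[OF norm_le_l1 sum_mono])
        (use C(2)[OF _ that, of _ "(x, s)" "(x, t)"] in \<open>simp add: inner_diff_left norm_Pair\<close>)
    then show ?thesis by (simp add: sum_distrib_right)
  qed
  moreover have "(\<Sum>c\<in>Basis. C c) \<ge> 0" using C(1) by (intro sum_nonneg)
  ultimately show ?thesis by blast
qed

section \<open>Solving the invariance equation\<close>

definition residual :: "('a \<Rightarrow> real) \<Rightarrow> real \<Rightarrow> 'a \<Rightarrow> real" where
  "residual m d x = d * pdv m (F d (x, m x)) x - (m x + N d (x, m x))"

theorem slow_manifold:
  "\<exists>D>0. D \<le> d0 \<and> (\<forall>d\<in>{0<..<D}. \<exists>m. Ck_on (Suc k) UNIV m \<and> (\<forall>x. \<bar>m x\<bar> \<le> \<eta>) \<and>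
     (\<forall>x. d * pdv m (F d (x, m x)) x = m x + N d (x, m x)))"
proof -
  \<comment> \<open>A limit of class k + 1 requires bounds of order k + 2, and the Taylor estimate
    requires second derivatives even for \<open>k = 0\<close>.\<close>
  obtain \<M> D0 where "invariant_class (Suc (Suc k)) \<M> D0" using invariant_class_exists by blast
  then have M0: "(\<lambda>x. 0) \<in> \<M>" and ubdM: "ubd (Suc (Suc k)) UNIV \<M> (\<lambda>m. m)"
    and etaM: "\<And>m x. m \<in> \<M> \<Longrightarrow> \<bar>m x\<bar> \<le> \<eta>" and D0: "0 < D0" "D0 \<le> d0"
    and stepM: "\<And>m d h. m \<in> \<M> \<Longrightarrow> d \<in> {0<..<D0} \<Longrightarrow> h \<in> {0<..1} \<Longrightarrow> step m d h \<in> \<M>"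
    by (auto simp: invariant_class_def)
  obtain B where B: "B \<ge> 0" "\<And>d p. d \<in> {0<..<d0} \<Longrightarrow> norm (F d p) \<le> B"
    using F_bounded by blast
  obtain LF where LF: "LF \<ge> 0" "\<And>d x s t. d \<in> {0<..<d0} \<Longrightarrow> norm (F d (x, s) - F d (x, t)) \<le> LF * \<bar>s - t\<bar>"
    using F_lipschitz by blast
  obtain L where L: "L \<ge> 0" "\<And>m x y. m \<in> \<M> \<Longrightarrow> \<bar>m x - m y\<bar> \<le> L * norm (x - y)"
    using ubd_lipschitz[OF ubdM] by auto
  obtain C where C: "C \<ge> 0" "\<And>m x v. m \<in> \<M> \<Longrightarrow> \<bar>m (x + v) - m x - pdv m v x\<bar> \<le> C * (norm v)\<^sup>2"
    using ubd_taylor[OF ubdM] by auto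
  have dM: "m differentiable at x" if "m \<in> \<M>" for m x
    using ubd_differentiable[OF ubdM that] by simp
  \<comment> \<open>For two graphs at distance \<open>\<Delta>\<close> the shifted base points
    differ by at most \<open>h d LF \<Delta>\<close>, hence the shifts by at most
    \<open>(1 + h d L LF) \<Delta>\<close>. When \<open>d L LF \<le> 1/4\<close>, the damping
    \<open>1 - h/2\<close> beats the factor \<open>1 + h/4\<close> and their product is at most
    \<open>1 - h/4\<close>.\<close>
  define D where "D = min D0 (1 / (4 * (L * LF + 1)))"
  have D: "0 < D" "D \<le> D0" "D \<le> d0" using D0 L(1) LF(1) by (auto simp: D_def add_nonneg_pos)
  have "\<exists>m. Ck_on (Suc k) UNIV m \<and> (\<forall>x. \<bar>m x\<bar> \<le> \<eta>) \<and>
     (\<forall>x. d * pdv m (F d (x, m x)) x = m x + N d (x, m x))" if dD: "d \<in> {0<..<D}" for d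
  proof -
    have d: "d \<in> {0<..<d0}" "d \<in> {0<..<D0}" "0 < d" "d \<le> 1" using dD D d0 by auto
    have dL: "d * (L * LF) \<le> 1 / 4"
    proof -
      have "d * (L * LF) \<le> 1 / (4 * (L * LF + 1)) * (L * LF + 1)"
        using dD L(1) LF(1) by (intro mult_mono) (auto simp: D_def)
      also have "\<dots> = 1 / 4"
        using mult_nonneg_nonneg[OF L(1) LF(1)] by (simp add: field_simps)
      finally show ?thesis .
    qed
    have contraction: "\<bar>step m d h x - step m' d h x\<bar> \<le> (1 - h / 4) * \<Delta>"
      if m: "m \<in> \<M>" "m' \<in> \<M>" and h: "h \<in> {0<..1}" and \<Delta>: "\<And>x. \<bar>m x - m' x\<bar> \<le> \<Delta>" for m m' h x \<Delta>
    proof -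
      have \<Delta>0: "\<Delta> \<ge> 0" using \<Delta>[of 0] by linarith
      define X where "X = x + (h * d) *\<^sub>R F d (x, m x)"
      define X' where "X' = x + (h * d) *\<^sub>R F d (x, m' x)"
      have "norm (X - X') = h * d * norm (F d (x, m x) - F d (x, m' x))"
        unfolding X_def X'_def using h d by (simp flip: scaleR_diff_right)
      also have "\<dots> \<le> h * d * (LF * \<Delta>)"
        using h d LF(1) \<Delta>[of x]
        by (intro mult_left_mono order_trans[OF LF(2)[OF d(1)]]) auto
      finally have "L * norm (X - X') \<le> L * (h * d * (LF * \<Delta>))"
        using L(1) by (rule mult_left_mono)
      also have "\<dots> = (d * (L * LF)) * (h * \<Delta>)" by (simp add: mult_ac)
      also have "\<dots> \<le> 1 / 4 * (h * \<Delta>)" using dL h \<Delta>0 by (intro mult_right_mono) auto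
      finally have "L * norm (X - X') \<le> h / 4 * \<Delta>" by simp
      then have n: "\<bar>m X - m' X'\<bar> \<le> (1 + h / 4) * \<Delta>"
        using L(2)[OF m(1), of X X'] \<Delta>[of X'] by (simp add: distrib_right)
      define u where "u = m X" define u' where "u' = m' X'"
      have "step m d h x - step m' d h x = (1 - h) * (u - u') - h * (N d (x, u) - N d (x, u'))"
        by (simp add: step_def shift_def X_def X'_def u_def u'_def algebra_simps)
      also have "\<bar>\<dots>\<bar> \<le> \<bar>(1 - h) * (u - u')\<bar> + \<bar>h * (N d (x, u) - N d (x, u'))\<bar>"
        by (rule abs_triangle_ineq4)
      also have "\<dots> \<le> (1 - h) * \<bar>u - u'\<bar> + h * (\<bar>u - u'\<bar> / 2)"
        unfolding abs_mult using h N_slope_lipschitz[OF d(1), of x u u']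
        by (intro add_mono mult_mono) auto
      also have "\<dots> = (1 - h / 2) * \<bar>u - u'\<bar>" by (simp add: algebra_simps)
      also have "\<dots> \<le> (1 - h / 2) * ((1 + h / 4) * \<Delta>)"
        using n h by (intro mult_left_mono) (auto simp: u_def u'_def)
      also have "\<dots> = (1 - h / 4) * \<Delta> - h * h / 8 * \<Delta>" by (simp add: field_simps)
      also have "\<dots> \<le> (1 - h / 4) * \<Delta>" using h \<Delta>0 by simp
      finally show ?thesis .
    qed
    define C1 where "C1 = C * B\<^sup>2 + 2 * (L * B)"
    have C1: "C1 \<ge> 0" unfolding C1_def using C(1) L(1) B(1) by simp
    \<comment> \<open>By Taylor expansion along the shift, one step is an Euler step of length
      \<open>h\<close> along \<open>residual\<close>, up to O(h^2). An iterate that hardly moves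
      therefore nearly solves the equation.\<close>
    have consistency: "\<bar>step m d h x - m x - h * residual m d x\<bar> \<le> C1 * h\<^sup>2"
      if m: "m \<in> \<M>" and h: "h \<in> {0<..1}" for m h x
    proof -
      define v where "v = F d (x, m x)"
      define n where "n = m (x + (h * d) *\<^sub>R v)"
      have hd: "0 \<le> h * d" "h * d \<le> h" using h d by (auto intro: mult_left_le)
      have nv: "norm ((h * d) *\<^sub>R v) \<le> h * B"
        using hd B(2)[OF d(1), of "(x, m x)"] B(1) by (auto simp: v_def intro: mult_mono)
      have "\<bar>n - m x - h * d * pdv m v x\<bar> \<le> C * (norm ((h * d) *\<^sub>R v))\<^sup>2"
        using C(2)[OF m, of x "(h * d) *\<^sub>R v"] linear_scale[OF pdv_linear[OF dM[OF m]], of x "h * d" v]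
        by (simp add: n_def)
      also have "\<dots> \<le> C * (h * B)\<^sup>2" using nv C(1) by (intro mult_left_mono power_mono) auto
      finally have 1: "\<bar>n - m x - h * d * pdv m v x\<bar> \<le> C * B\<^sup>2 * h\<^sup>2" by (simp add: power_mult_distrib mult_ac)
      have "\<bar>n - m x\<bar> \<le> L * norm ((h * d) *\<^sub>R v)"
        using L(2)[OF m, of "x + (h * d) *\<^sub>R v" x] by (simp add: n_def)
      also have "\<dots> \<le> L * (h * B)" using nv L(1) by (intro mult_left_mono) auto
      finally have nm: "\<bar>n - m x\<bar> \<le> L * (h * B)" .
      have "\<bar>(n - m x) + (N d (x, n) - N d (x, m x))\<bar> \<le> 2 * (L * (h * B))"
      proof -
        have "\<bar>a + b\<bar> \<le> 2 * c" if "\<bar>a\<bar> \<le> c" "\<bar>b\<bar> \<le> \<bar>a\<bar> / 2" for a b c :: real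
          using that by linarith
        then show ?thesis using nm N_slope_lipschitz[OF d(1)] by blast
      qed
      then have "\<bar>h * ((n - m x) + (N d (x, n) - N d (x, m x)))\<bar> \<le> h * (2 * (L * (h * B)))"
        unfolding abs_mult using h by (intro mult_mono) auto
      also have "\<dots> = 2 * (L * B) * h\<^sup>2" by (simp add: power2_eq_square)
      finally have 2: "\<bar>h * ((n - m x) + (N d (x, n) - N d (x, m x)))\<bar> \<le> 2 * (L * B) * h\<^sup>2" .
      have "step m d h x - m x - h * residual m d x
          = (n - m x - h * d * pdv m v x) - h * ((n - m x) + (N d (x, n) - N d (x, m x)))"
        by (simp add: step_def shift_def residual_def n_def v_def algebra_simps)
      then show ?thesis using 1 2 unfolding C1_def distrib_right by linarith
    qed
    have approx: "\<exists>m\<in>\<M>. \<forall>x. \<bar>residual m d x\<bar> \<le> \<epsilon>" if \<epsilon>: "\<epsilon> > 0" for \<epsilon>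
    proof -
      \<comment> \<open>The increments of the iteration decay geometrically. Once they are below
        \<open>h^2\<close>, consistency gives \<open>h |residual| \<le> (1 + C1) h^2\<close>, and
        this \<open>h\<close> satisfies \<open>(1 + C1) h \<le> \<epsilon>\<close>.\<close>
      define h where "h = min 1 (\<epsilon> / (1 + C1))"
      have h: "h \<in> {0<..1}" using \<epsilon> C1 by (auto simp: h_def add_pos_nonneg)
      define it where "it j = ((\<lambda>m. step m d h) ^^ j) (\<lambda>x. 0)" for j
      have itM: "it j \<in> \<M>" for j
        by (induction j) (use M0 stepM[OF _ d(2) h] in \<open>auto simp: it_def\<close>)
      have it_Suc: "it (Suc j) = step (it j) d h" for j by (simp add: it_def)
      have "\<bar>it (Suc j) x - it j x\<bar> \<le> (1 - h / 4) ^ j * (2 * \<eta>)" for j x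
      proof (induction j arbitrary: x)
        case 0
        show ?case using etaM[OF itM[of "Suc 0"], of x] etaM[OF itM[of 0], of x] by simp
      next
        case (Suc j)
        show ?case
          using contraction[OF itM[of "Suc j"] itM[of j] h Suc.IH, of x] by (simp add: it_Suc mult_ac)
      qed
      moreover have "(\<lambda>j. (1 - h / 4) ^ j * (2 * \<eta>)) \<longlonglongrightarrow> 0"
        using h by (intro tendsto_mult_left_zero LIMSEQ_power_zero) auto
      then have "\<forall>\<^sub>F j in sequentially. (1 - h / 4) ^ j * (2 * \<eta>) < h\<^sup>2"
        using h by (intro order_tendstoD(2)) auto
      then obtain j where "(1 - h / 4) ^ j * (2 * \<eta>) < h\<^sup>2" by (auto simp: eventually_sequentially)
      ultimately have small: "\<bar>step (it j) d h x - it j x\<bar> \<le> h\<^sup>2" for x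
        using it_Suc[of j] by (metis less_imp_le order_trans)
      have "\<bar>residual (it j) d x\<bar> \<le> \<epsilon>" for x
      proof -
        have "h * \<bar>residual (it j) d x\<bar> = \<bar>h * residual (it j) d x\<bar>" using h by (simp add: abs_mult)
        also have "\<dots> \<le> h\<^sup>2 + C1 * h\<^sup>2"
          using consistency[OF itM[of j] h, of x] small[of x] by linarith
        also have "\<dots> = h * (h * (1 + C1))" by (simp add: power2_eq_square algebra_simps)
        finally have "\<bar>residual (it j) d x\<bar> \<le> h * (1 + C1)" using h by simp
        also have "\<dots> \<le> \<epsilon> / (1 + C1) * (1 + C1)" using C1 by (intro mult_right_mono) (auto simp: h_def)
        also have "\<dots> = \<epsilon>" using C1 by simp
        finally show ?thesis .
      qed
      then show ?thesis using itM by blast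
    qed
    \<comment> \<open>Approximate solutions found with different step lengths are compared through
      one step of length \<open>\<epsilon>\<close> on each. A residual of at most
      \<open>\<epsilon>\<close> moves each by O(\<open>\<epsilon>^2\<close>), so contraction gives
      \<open>\<Delta> \<le> (1 - \<epsilon>/4) \<Delta> + 2 (1 + C1) \<epsilon>^2\<close> for the
      sup distance \<open>\<Delta>\<close>.\<close>
    have stability: "\<bar>m x - m' x\<bar> \<le> 8 * (1 + C1) * \<epsilon>"
      if m: "m \<in> \<M>" "m' \<in> \<M>" and \<epsilon>: "\<epsilon> \<in> {0<..1}"
        and r: "\<And>x. \<bar>residual m d x\<bar> \<le> \<epsilon>" "\<And>x. \<bar>residual m' d x\<bar> \<le> \<epsilon>" for m m' \<epsilon> x
    proof -
      define \<Delta> where "\<Delta> = (SUP x. \<bar>m x - m' x\<bar>)"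
      have "bdd_above (range (\<lambda>x. \<bar>m x - m' x\<bar>))"
      proof (rule bdd_aboveI2)
        show "\<bar>m x - m' x\<bar> \<le> 2 * \<eta>" for x using etaM[OF m(1), of x] etaM[OF m(2), of x] by linarith
      qed
      then have le: "\<bar>m x - m' x\<bar> \<le> \<Delta>" for x unfolding \<Delta>_def by (rule cSUP_upper[OF UNIV_I])
      have "\<bar>m x - m' x\<bar> \<le> (1 - \<epsilon> / 4) * \<Delta> + 2 * (1 + C1) * \<epsilon>\<^sup>2" for x
      proof -
        have "\<bar>\<epsilon> * residual m d x\<bar> \<le> \<epsilon>\<^sup>2" "\<bar>\<epsilon> * residual m' d x\<bar> \<le> \<epsilon>\<^sup>2"
          using r[of x] \<epsilon> by (auto simp: abs_mult power2_eq_square)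
        then show ?thesis
          using contraction[OF m \<epsilon> le, of x] consistency[OF m(1) \<epsilon>, of x] consistency[OF m(2) \<epsilon>, of x]
          unfolding distrib_left distrib_right by linarith
      qed
      then have "\<Delta> \<le> (1 - \<epsilon> / 4) * \<Delta> + 2 * (1 + C1) * \<epsilon>\<^sup>2"
        unfolding \<Delta>_def by (intro cSUP_least) auto
      then have "\<epsilon> * \<Delta> \<le> \<epsilon> * (8 * (1 + C1) * \<epsilon>)" by (simp add: algebra_simps power2_eq_square)
      then show ?thesis using \<epsilon> le[of x] by simp
    qed
    have "\<exists>f. \<forall>n. f n \<in> \<M> \<and> (\<forall>x. \<bar>residual (f n) d x\<bar> \<le> inverse (real (Suc n)))"
    proof (intro choice allI)
      fix n
      have "inverse (real (Suc n)) > 0" by simp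
      from approx[OF this] show "\<exists>m. m \<in> \<M> \<and> (\<forall>x. \<bar>residual m d x\<bar> \<le> inverse (real (Suc n)))"
        by blast
    qed
    then obtain f where fM: "\<And>n. f n \<in> \<M>" and fr: "\<And>n x. \<bar>residual (f n) d x\<bar> \<le> inverse (real (Suc n))"
      by blast
    have "uniformly_Cauchy_on UNIV f"
      unfolding uniformly_Cauchy_on_def
    proof (intro allI impI)
      fix e :: real assume e: "e > 0"
      then have "e / (8 * (1 + C1)) > 0" using C1 by simp
      then obtain M where M: "inverse (real (Suc M)) < e / (8 * (1 + C1))"
        using reals_Archimedean by blast
      have "dist (f m x) (f n x) < e" if "m \<ge> M" "n \<ge> M" for m n x
      proof -
        have le: "inverse (real (Suc j)) \<le> inverse (real (Suc M))" if "j \<ge> M" for j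
          using that by (intro le_imp_inverse_le) auto
        have "\<bar>f m x - f n x\<bar> \<le> 8 * (1 + C1) * inverse (real (Suc M))"
        proof (rule stability[OF fM fM])
          show "inverse (real (Suc M)) \<in> {0<..1}" using inverse_le_1_iff[of "real (Suc M)"] by simp
        qed (use fr le that in \<open>blast intro: order_trans\<close>)+
        also have "\<dots> < 8 * (1 + C1) * (e / (8 * (1 + C1)))"
          using M C1 by (intro mult_strict_left_mono) auto
        also have "\<dots> = e" using C1 by simp
        finally show ?thesis by (simp add: dist_real_def)
      qed
      then show "\<exists>M. \<forall>x\<in>UNIV. \<forall>m\<ge>M. \<forall>n\<ge>M. dist (f m x) (f n x) < e" by blast
    qed
    moreover have "ubd (Suc (Suc k)) UNIV UNIV f"
      using ubd_reindex[OF ubdM, of UNIV f UNIV] fM by (simp del: ubd.simps)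
    ultimately obtain g where g: "Ck_on (Suc k) UNIV g" "uniform_limit UNIV f g sequentially"
      "\<And>x v. (\<lambda>n. pdv (f n) v x) \<longlonglongrightarrow> pdv g v x"
      using uniform_limit_Ck[of "Suc k" f] by blast
    have lim: "(\<lambda>n. f n x) \<longlonglongrightarrow> g x" for x using tendsto_uniform_limitI[OF g(2)] by simp
    have "\<bar>g x\<bar> \<le> \<eta>" for x
      using tendsto_upperbound[OF tendsto_rabs[OF lim[of x]], of \<eta>] etaM[OF fM] by simp
    moreover have "d * pdv g (F d (x, g x)) x = g x + N d (x, g x)" for x
    proof -
      have contr: "((\<lambda>n. H (f n x)) \<longlongrightarrow> H (g x)) sequentially"
        if "\<And>s t. norm (H s - H t) \<le> K * \<bar>s - t\<bar>" for H :: "real \<Rightarrow> 'b::real_normed_vector" and K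
      proof -
        have "(\<lambda>n. K * \<bar>f n x - g x\<bar>) \<longlonglongrightarrow> K * 0"
          by (intro tendsto_mult_left tendsto_rabs_zero LIM_zero lim)
        then have "(\<lambda>n. H (f n x) - H (g x)) \<longlonglongrightarrow> 0"
          using that by (auto intro: Lim_null_comparison[where g = "\<lambda>n. K * \<bar>f n x - g x\<bar>"])
        then show ?thesis by (rule LIM_zero_cancel)
      qed
      have dg: "g differentiable at x" using Ck_on_differentiable[OF g(1)] by simp
      have limF: "(\<lambda>n. F d (x, f n x)) \<longlonglongrightarrow> F d (x, g x)"
        by (rule contr) (rule LF(2)[OF d(1)])
      have limN: "(\<lambda>n. N d (x, f n x)) \<longlonglongrightarrow> N d (x, g x)"
      proof (rule contr)
        show "norm (N d (x, s) - N d (x, t)) \<le> 1 / 2 * \<bar>s - t\<bar>" for s t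
          using N_slope_lipschitz[OF d(1)] by simp
      qed
      \<comment> \<open>Function and direction both vary with \<open>n\<close>; in coordinates only
        the convergence of the partial derivatives remains.\<close>
      have "(\<lambda>n. \<Sum>b\<in>Basis. (F d (x, f n x) \<bullet> b) * pdv (f n) b x) \<longlonglongrightarrow> (\<Sum>b\<in>Basis. (F d (x, g x) \<bullet> b) * pdv g b x)"
        by (intro tendsto_intros limF g(3))
      then have "(\<lambda>n. pdv (f n) (F d (x, f n x)) x) \<longlonglongrightarrow> pdv g (F d (x, g x)) x"
        unfolding pdv_Basis[OF dg, of "F d (x, g x)"] pdv_Basis[OF dM[OF fM], where v = "F d (x, f _ x)"]
        by (simp only: real_scaleR_def)
      then have "(\<lambda>n. residual (f n) d x) \<longlonglongrightarrow> residual g d x"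
        unfolding residual_def by (intro tendsto_intros limN lim)
      moreover have "(\<lambda>n. residual (f n) d x) \<longlonglongrightarrow> 0"
        by (rule Lim_null_comparison[OF _ LIMSEQ_inverse_real_of_nat]) (use fr in auto)
      ultimately have "residual g d x = 0" by (rule LIMSEQ_unique)
      then show ?thesis by (simp add: residual_def)
    qed
    ultimately show ?thesis using g(1) by blast
  qed
  then show ?thesis using D by blast
qed

end

section \<open>Graphs over the switching manifold\<close>

text \<open>The function \<open>w^2 exp (-2 C t)\<close> is nonincreasing and
  \<open>w^2 exp (2 C t)\<close> is nondecreasing, so a zero at \<open>t0\<close> propagates
  forwards by the first and backwards by the second.\<close>

lemma gronwall_zero:
  fixes w w' :: "real \<Rightarrow> real"
  assumes d: "\<And>t. t \<in> {a..b} \<Longrightarrow> (w has_real_derivative w' t) (at t within {a..b})"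
    and le: "\<And>t. t \<in> {a..b} \<Longrightarrow> \<bar>w' t\<bar> \<le> C * \<bar>w t\<bar>"
    and t0: "t0 \<in> {a..b}" "w t0 = 0" and t: "t \<in> {a..b}"
  shows "w t = 0"
proof -
  have cont: "continuous_on {a..b} w"
    using d by (meson DERIV_continuous_on)
  have dw: "(w has_real_derivative w' s) (at s)" if "a < s" "s < b" for s
    using d[of s] that by (simp add: at_within_Icc_at)
  have ww: "\<bar>w s * w' s\<bar> \<le> C * (w s)\<^sup>2" if "s \<in> {a..b}" for s
    using mult_left_mono[OF le[OF that], of "\<bar>w s\<bar>"] by (simp add: abs_mult power2_eq_square mult_ac)
  show ?thesis
  proof (cases "t0 \<le> t")
    case True
    have "- ((w t0)\<^sup>2 * exp (- 2 * C * t0)) \<le> - ((w t)\<^sup>2 * exp (- 2 * C * t))"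
    proof (rule DERIV_nonneg_imp_increasing_open[OF True])
      fix s assume s: "t0 < s" "s < t"
      have "((\<lambda>s. - ((w s)\<^sup>2 * exp (- 2 * C * s))) has_real_derivative
          2 * (C * (w s)\<^sup>2 - w s * w' s) * exp (- 2 * C * s)) (at s)"
        using s t0 t by (auto intro!: derivative_eq_intros dw simp: algebra_simps power2_eq_square)
      moreover have "0 \<le> 2 * (C * (w s)\<^sup>2 - w s * w' s) * exp (- 2 * C * s)"
        using ww[of s] s t0 t by simp
      ultimately show "\<exists>y. ((\<lambda>s. - ((w s)\<^sup>2 * exp (- 2 * C * s))) has_real_derivative y) (at s) \<and> 0 \<le> y"
        by blast
    qed (use t0 t in \<open>auto intro!: continuous_intros continuous_on_subset[OF cont]\<close>)
    then have "(w t)\<^sup>2 * exp (- 2 * C * t) \<le> 0" using t0 by simp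
    then show ?thesis by (simp add: mult_le_0_iff)
  next
    case False
    then have "t \<le> t0" by simp
    have "(w t)\<^sup>2 * exp (2 * C * t) \<le> (w t0)\<^sup>2 * exp (2 * C * t0)"
    proof (rule DERIV_nonneg_imp_increasing_open[OF \<open>t \<le> t0\<close>])
      fix s assume s: "t < s" "s < t0"
      have "((\<lambda>s. (w s)\<^sup>2 * exp (2 * C * s)) has_real_derivative
          2 * (C * (w s)\<^sup>2 + w s * w' s) * exp (2 * C * s)) (at s)"
        using s t0 t by (auto intro!: derivative_eq_intros dw simp: algebra_simps power2_eq_square)
      moreover have "0 \<le> 2 * (C * (w s)\<^sup>2 + w s * w' s) * exp (2 * C * s)"
        using ww[of s] s t0 t by simp
      ultimately show "\<exists>y. ((\<lambda>s. (w s)\<^sup>2 * exp (2 * C * s)) has_real_derivative y) (at s) \<and> 0 \<le> y"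
        by blast
    qed (use t0 t in \<open>auto intro!: continuous_intros continuous_on_subset[OF cont]\<close>)
    then have "(w t)\<^sup>2 * exp (2 * C * t) \<le> 0" using t0 by simp
    then show ?thesis by (simp add: mult_le_0_iff)
  qed
qed

text \<open>On the graph the hypothesis \<open>L\<close> expresses tangency of the field; off the
  graph its linear growth prevents a solution from reaching or leaving the graph in finite
  time.\<close>

lemma graph_invariant_in:
  fixes X :: "'a::euclidean_space \<times> real \<Rightarrow> 'a \<times> real" and \<mu> :: "'a \<Rightarrow> real"
  assumes \<mu>: "\<And>x. \<mu> differentiable at x"
    and L: "\<And>p. p \<in> U \<Longrightarrow> \<bar>snd (X p) - pdv \<mu> (fst (X p)) (fst p)\<bar> \<le> L * \<bar>snd p - \<mu> (fst p)\<bar>"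
  shows "invariant_in U X {p \<in> U. snd p = \<mu> (fst p)}"
  unfolding invariant_in_def
proof (intro allI impI, elim conjE bexE)
  fix \<gamma> a b t0
  assume \<gamma>: "\<forall>t\<in>{a..b}. \<gamma> t \<in> U \<and> (\<gamma> has_vector_derivative X (\<gamma> t)) (at t within {a..b})"
    and t0: "t0 \<in> {a..b}" "\<gamma> t0 \<in> {p \<in> U. snd p = \<mu> (fst p)}"
  define w where "w t = snd (\<gamma> t) - \<mu> (fst (\<gamma> t))" for t
  have "w t = 0" if t: "t \<in> {a..b}" for t
  proof (rule gronwall_zero[OF _ _ t0(1) _ t])
    fix t assume t: "t \<in> {a..b}"
    have g: "(\<gamma> has_derivative (\<lambda>h. h *\<^sub>R X (\<gamma> t))) (at t within {a..b})"
      using \<gamma> t by (simp add: has_vector_derivative_def)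
    have "((\<lambda>t. \<mu> (fst (\<gamma> t))) has_derivative (\<lambda>h. pdv \<mu> (fst (h *\<^sub>R X (\<gamma> t))) (fst (\<gamma> t)))) (at t within {a..b})"
      by (rule has_derivative_compose[OF has_derivative_fst[OF g] pdv_has_derivative[OF \<mu>]])
    from has_derivative_diff[OF has_derivative_snd[OF g] this]
    show "(w has_real_derivative snd (X (\<gamma> t)) - pdv \<mu> (fst (X (\<gamma> t))) (fst (\<gamma> t))) (at t within {a..b})"
      unfolding has_field_derivative_def w_def
      by (rule has_derivative_eq_rhs) (simp add: fun_eq_iff linear_scale[OF pdv_linear[OF \<mu>]] algebra_simps)
    show "\<bar>snd (X (\<gamma> t)) - pdv \<mu> (fst (X (\<gamma> t))) (fst (\<gamma> t))\<bar> \<le> L * \<bar>w t\<bar>"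
      unfolding w_def using L \<gamma> t by blast
  qed (use t0 w_def in auto)
  then show "\<gamma> ` {a..b} \<subseteq> {p \<in> U. snd p = \<mu> (fst p)}"
    using \<gamma> by (auto simp: w_def)
qed

lemma graph_Ck_submanifold:
  fixes \<mu> :: "'a::euclidean_space \<Rightarrow> real"
  assumes \<mu>: "Ck_on k UNIV \<mu>" and U: "open U"
  shows "\<exists>d. Ck_submanifold k d {p \<in> U. snd p = \<mu> (fst p)}"
proof -
  \<comment> \<open>Shearing by \<open>\<mu>\<close> flattens the graph, and the opposite shear
    \<open>\<Psi>\<close> is an explicit inverse of the same class.\<close>
  define \<Phi> where "\<Phi> p = p + (-1) *\<^sub>R (0, \<mu> (fst p))" for p :: "'a \<times> real"
  define \<Psi> where "\<Psi> p = p + 1 *\<^sub>R (0, \<mu> (fst p))" for p :: "'a \<times> real"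
  have inv: "\<Psi> (\<Phi> p) = p" "\<Phi> (\<Psi> p) = p" for p
    by (cases p, simp add: \<Phi>_def \<Psi>_def)+
  have "Ck_on k UNIV (\<lambda>p. p + c *\<^sub>R (0, \<mu> (fst p)))" for c
  proof (intro Ck_on_add Ck_on_scaleR Ck_on_const open_UNIV)
    have "Ck_on k UNIV (\<lambda>p::'a\<times>real. \<mu> (fst p))"
      by (rule Ck_on_linear_comp[OF open_UNIV bounded_linear_fst _ \<mu>]) simp
    then show "Ck_on k UNIV (\<lambda>p::'a\<times>real. (0::'a, \<mu> (fst p)))"
      by (rule Ck_on_bounded_linear[OF open_UNIV, rotated])
        (intro bounded_linear_Pair bounded_linear_zero bounded_linear_ident)
    show "Ck_on k UNIV (\<lambda>p::'a\<times>real. p)"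
    proof (cases k)
      case (Suc n)
      then show ?thesis
        by (auto simp: pdv_bounded_linear[OF bounded_linear_ident] Ck_on_const simp del: Ck_on.simps(1))
    qed auto
  qed
  then have Ck: "Ck_on k UNIV \<Phi>" "Ck_on k UNIV \<Psi>" unfolding \<Phi>_def[abs_def] \<Psi>_def[abs_def] by blast+
  have img: "\<Phi> ` U = \<Psi> -` U" using inv by (auto simp: image_iff) metis
  have "open (\<Psi> -` U)" using open_vimage[OF U Ck_on_continuous[OF Ck(2)]] .
  then have oi: "open (\<Phi> ` U)" unfolding img .
  have inj: "inj_on \<Phi> U" using inv by (metis inj_onI)
  have ii: "inv_into U \<Phi> z = \<Psi> z" if "z \<in> \<Phi> ` U" for z
    using that inj inv by (auto simp: inv_into_f_f)
  have "Ck_on k (\<Phi> ` U) (inv_into U \<Phi>)"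
    by (rule Ck_on_cong_imp[OF oi Ck_on_subset[OF Ck(2)]]) (auto simp: ii)
  then have chart: "Ck_chart k U \<Phi>"
    unfolding Ck_chart_def using U oi inj Ck_on_subset[OF Ck(1)] by blast
  define L where "L = (UNIV :: 'a set) \<times> {0::real}"
  have "subspace L" unfolding L_def by (auto simp: subspace_def zero_prod_def)
  moreover have "\<Phi> ` ({p \<in> U. snd p = \<mu> (fst p)} \<inter> U) = L \<inter> \<Phi> ` U"
    by (auto simp: L_def \<Phi>_def image_iff)
  ultimately have "Ck_submanifold k (dim L) {p \<in> U. snd p = \<mu> (fst p)}"
    unfolding Ck_submanifold_def using chart by blast
  then show ?thesis ..
qed

section \<open>Hausdorff convergence of graphs\<close>

lemma hausdorff_dist_nonneg: "0 \<le> hausdorff_dist A B"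
  unfolding hausdorff_dist_def by (rule Inf_greatest) auto

lemma hausdorff_dist_le:
  assumes "0 \<le> e" "A \<subseteq> (\<Union>b\<in>B. cball b e)" "B \<subseteq> (\<Union>a\<in>A. cball a e)"
  shows "hausdorff_dist A B \<le> ereal e"
  unfolding hausdorff_dist_def by (rule Inf_lower) (use assms in auto)

lemma tendsto_hausdorff_dist_0:
  assumes "\<And>e. e > 0 \<Longrightarrow> \<forall>\<^sub>F \<delta> in F. A \<delta> \<subseteq> (\<Union>b\<in>B. cball b e) \<and> B \<subseteq> (\<Union>a\<in>A \<delta>. cball a e)"
  shows "((\<lambda>\<delta>. hausdorff_dist (A \<delta>) B) \<longlongrightarrow> 0) F"
proof (rule order_tendstoI)
  fix a :: ereal assume "a < 0"
  then show "\<forall>\<^sub>F \<delta> in F. a < hausdorff_dist (A \<delta>) B"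
    using hausdorff_dist_nonneg less_le_trans by (blast intro: always_eventually)
next
  fix a :: ereal assume "0 < a"
  then obtain e where e: "0 < ereal e" "ereal e < a" using ereal_dense2 by blast
  then have "e > 0" by simp
  from assms[OF this] show "\<forall>\<^sub>F \<delta> in F. hausdorff_dist (A \<delta>) B < a"
  proof eventually_elim
    case (elim \<delta>)
    then have "hausdorff_dist (A \<delta>) B \<le> ereal e"
      using \<open>e > 0\<close> by (intro hausdorff_dist_le) auto
    then show ?case using e(2) by (rule le_less_trans)
  qed
qed

text \<open>The points of \<open>K\<close> away from the limit set form a compact set on which |y|
  has a positive minimum, so a graph of height at most \<open>\<delta> C\<close> eventually misses
  it. Conversely, by \<open>pos\<close> every limit point is close to a point of the switching
  manifold interior to \<open>K\<close>, whose vertical lift to the graph stays in \<open>K\<close>;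
  a finite cover makes this uniform.\<close>

lemma graph_hausdorff_limit:
  fixes \<mu> :: "real \<Rightarrow> 'a::euclidean_space \<Rightarrow> real"
  assumes \<mu>: "\<forall>\<^sub>F \<delta> in at_right 0. \<forall>x. \<bar>\<mu> \<delta> x\<bar> \<le> \<delta> * C"
    and K: "compact K" "K \<subseteq> U" "U \<subseteq> U\<^sub>0"
    and pos: "switching U\<^sub>0 snd \<inter> K \<subseteq> closure (switching U\<^sub>0 snd \<inter> interior K)"
  shows "((\<lambda>\<delta>. hausdorff_dist ({p \<in> U. snd p = \<mu> \<delta> (fst p)} \<inter> K) (switching U\<^sub>0 snd \<inter> K)) \<longlongrightarrow> 0) (at_right 0)"
proof (rule tendsto_hausdorff_dist_0)
  fix e :: real assume e: "e > 0"
  define Z where "Z = switching U\<^sub>0 snd \<inter> K"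
  have Z: "Z = {p \<in> K. snd p = 0}" using K by (auto simp: Z_def switching_def)
  have "closed {p :: 'a \<times> real. snd p = 0}"
    by (intro closed_Collect_eq continuous_intros)
  from compact_Int_closed[OF K(1) this] have "compact Z"
    unfolding Z by (simp add: Int_def)
  have lim: "((\<lambda>\<delta>. \<delta> * C) \<longlongrightarrow> 0) (at_right 0)"
    by (auto intro!: tendsto_eq_intros)
  have mlim: "((\<lambda>\<delta>. \<mu> \<delta> x) \<longlongrightarrow> 0) (at_right 0)" for x
    by (rule Lim_null_comparison[OF _ lim]) (use \<mu> in eventually_elim, simp)
  have 1: "\<forall>\<^sub>F \<delta> in at_right 0. {p \<in> U. snd p = \<mu> \<delta> (fst p)} \<inter> K \<subseteq> (\<Union>b\<in>Z. cball b e)"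
  proof (cases "K - (\<Union>b\<in>Z. ball b e) = {}")
    case True
    then show ?thesis by (intro always_eventually) force
  next
    case False
    define W where "W = K - (\<Union>b\<in>Z. ball b e)"
    have "compact W" unfolding W_def by (intro compact_diff K(1)) auto
    then have "\<exists>p0\<in>W. \<forall>p\<in>W. \<bar>snd p0\<bar> \<le> \<bar>snd p\<bar>"
      using False unfolding W_def[symmetric]
      by (rule continuous_attains_inf) (intro continuous_intros)
    then obtain p0 where p0: "p0 \<in> W" "\<And>p. p \<in> W \<Longrightarrow> \<bar>snd p0\<bar> \<le> \<bar>snd p\<bar>" by blast
    have "p0 \<in> (\<Union>b\<in>Z. ball b e)" if "p0 \<in> Z" using that e by (intro UN_I[of p0]) auto
    then have "snd p0 \<noteq> 0" using p0(1) by (auto simp: W_def Z)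
    then have "\<forall>\<^sub>F \<delta> in at_right 0. \<delta> * C < \<bar>snd p0\<bar>" by (intro order_tendstoD(2)[OF lim]) simp
    then show ?thesis using \<mu>
    proof eventually_elim
      case (elim \<delta>)
      show ?case
      proof
        fix p assume p: "p \<in> {p \<in> U. snd p = \<mu> \<delta> (fst p)} \<inter> K"
        then have "\<bar>snd p\<bar> < \<bar>snd p0\<bar>" using elim by (auto intro: le_less_trans)
        then have "p \<notin> W" using p0(2)[of p] by linarith
        then have "p \<in> (\<Union>b\<in>Z. ball b e)" using p by (simp add: W_def)
        then show "p \<in> (\<Union>b\<in>Z. cball b e)" using ball_subset_cball by blast
      qed
    qed
  qed
  have "Z \<subseteq> (\<Union>z\<in>switching U\<^sub>0 snd \<inter> interior K. ball z (e / 2))"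
  proof
    fix p assume "p \<in> Z"
    then have "p \<in> closure (switching U\<^sub>0 snd \<inter> interior K)" using pos by (auto simp: Z_def)
    then obtain z where "z \<in> switching U\<^sub>0 snd \<inter> interior K" "dist z p < e / 2"
      using e unfolding closure_approachable by (meson half_gt_zero)
    then show "p \<in> (\<Union>z\<in>switching U\<^sub>0 snd \<inter> interior K. ball z (e / 2))" by auto
  qed
  note cover = this
  obtain T where T: "T \<subseteq> switching U\<^sub>0 snd \<inter> interior K" "finite T" "Z \<subseteq> (\<Union>z\<in>T. ball z (e / 2))"
    by (rule compactE_image[OF \<open>compact Z\<close> _ cover]) auto
  have "\<forall>\<^sub>F \<delta> in at_right 0. \<forall>z\<in>T. (fst z, \<mu> \<delta> (fst z)) \<in> interior K \<inter> ball z (e / 2)"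
  proof (intro eventually_ball_finite T(2) ballI)
    fix z assume z: "z \<in> T"
    have z0: "(fst z, 0) = z" using z T(1) by (auto simp: switching_def prod_eq_iff)
    have "((\<lambda>\<delta>. (fst z, \<mu> \<delta> (fst z))) \<longlongrightarrow> (fst z, 0)) (at_right 0)"
      by (intro tendsto_intros mlim)
    then have "((\<lambda>\<delta>. (fst z, \<mu> \<delta> (fst z))) \<longlongrightarrow> z) (at_right 0)"
      unfolding z0 .
    then show "\<forall>\<^sub>F \<delta> in at_right 0. (fst z, \<mu> \<delta> (fst z)) \<in> interior K \<inter> ball z (e / 2)"
      by (rule topological_tendstoD) (use z T(1) e in auto)
  qed
  then have 2: "\<forall>\<^sub>F \<delta> in at_right 0. Z \<subseteq> (\<Union>a\<in>{p \<in> U. snd p = \<mu> \<delta> (fst p)} \<inter> K. cball a e)"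
  proof eventually_elim
    case (elim \<delta>)
    show ?case
    proof
      fix p assume "p \<in> Z"
      then obtain z where z: "z \<in> T" "dist z p < e / 2" using T(3) by auto
      define a where "a = (fst z, \<mu> \<delta> (fst z))"
      have "a \<in> interior K" "dist z a < e / 2" using elim z(1) by (auto simp: a_def)
      then have "a \<in> {p \<in> U. snd p = \<mu> \<delta> (fst p)} \<inter> K"
        using interior_subset K(2) by (auto simp: a_def)
      moreover have "dist a p \<le> e"
        using dist_triangle[of a p z] z(2) \<open>dist z a < e / 2\<close> by (simp add: dist_commute)
      ultimately show "p \<in> (\<Union>a\<in>{p \<in> U. snd p = \<mu> \<delta> (fst p)} \<inter> K. cball a e)" by auto
    qed
  qed
  show "\<forall>\<^sub>F \<delta> in at_right 0. {p \<in> U. snd p = \<mu> \<delta> (fst p)} \<inter> K \<subseteq> (\<Union>b\<in>switching U\<^sub>0 snd \<inter> K. cball b e) \<and>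
      switching U\<^sub>0 snd \<inter> K \<subseteq> (\<Union>a\<in>{p \<in> U. snd p = \<mu> \<delta> (fst p)} \<inter> K. cball a e)"
    using eventually_conj[OF 1 2] unfolding Z_def .
qed

text \<open>For each \<open>d\<close> a witness is taken for the largest \<open>k\<close> with
  \<open>k \<le> 1/d\<close> and \<open>d < D k\<close>; the first condition leaves finitely many
  candidates, and \<open>anti\<close> passes down to smaller orders. Any fixed \<open>k\<close> is
  admissible for small \<open>d\<close>. This serves the definition of \<open>r_sliding\<close>,
  where one family must reach every finite order eventually.\<close>

lemma diagonal_choice:
  fixes P :: "nat \<Rightarrow> real \<Rightarrow> 'b \<Rightarrow> bool"
  assumes ex: "\<And>k. \<exists>D>0. \<forall>d\<in>{0<..<D}. \<exists>m. P k d m"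
    and anti: "\<And>j k d m. P k d m \<Longrightarrow> j \<le> k \<Longrightarrow> P j d m"
  shows "\<exists>m. \<forall>k. \<forall>\<^sub>F d in at_right 0. P k d (m d)"
proof -
  from ex obtain D where D: "\<And>k. D k > 0" "\<And>k d. d \<in> {0<..<D k} \<Longrightarrow> \<exists>m. P k d m" by metis
  have "\<exists>m. \<forall>k. real k \<le> 1 / d \<and> d < D k \<longrightarrow> P k d m" if d: "d > 0" for d
  proof (cases "\<exists>k. real k \<le> 1 / d \<and> d < D k")
    case True
    define A where "A = {k. real k \<le> 1 / d \<and> d < D k}"
    have "A \<subseteq> {..nat \<lfloor>1 / d\<rfloor>}" by (auto simp: A_def le_nat_floor)
    then have A: "finite A" "A \<noteq> {}" using True finite_subset by (auto simp: A_def)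
    have "d < D (Max A)" using Max_in[OF A] by (simp add: A_def)
    then obtain m where m: "P (Max A) d m" using D(2) d by fastforce
    have "P k d m" if "real k \<le> 1 / d \<and> d < D k" for k
      by (rule anti[OF m]) (use that A in \<open>auto simp: A_def\<close>)
    then show ?thesis by blast
  qed auto
  then obtain m where m: "\<And>d k. d > 0 \<Longrightarrow> real k \<le> 1 / d \<and> d < D k \<Longrightarrow> P k d (m d)" by metis
  have "\<forall>\<^sub>F d in at_right 0. P k d (m d)" for k
  proof -
    have "\<forall>\<^sub>F d in at_right 0. d \<in> {0<..<min (D k) (1 / (real k + 1))}"
      using D(1) by (intro eventually_at_right_real) auto
    then show ?thesis
    proof eventually_elim
      case (elim d)
      have "real k \<le> 1 / d" using elim by (auto simp: field_simps)
      then show ?case using elim m[of d k] by auto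
    qed
  qed
  then show ?thesis by blast
qed

section \<open>Sewing points and the sliding vector field\<close>

lemma Ck_chart_inverse:
  assumes "Ck_chart (Suc k) U \<Phi>" "q \<in> U"
  defines "\<Psi> \<equiv> inv_into U \<Phi>"
  shows "pdv \<Psi> (pdv \<Phi> v q) (\<Phi> q) = v" "pdv \<Phi> (pdv \<Psi> v (\<Phi> q)) q = v"
proof -
  have U: "open U" "open (\<Phi> ` U)" "inj_on \<Phi> U" "Ck_on (Suc k) U \<Phi>" "Ck_on (Suc k) (\<Phi> ` U) \<Psi>"
    using assms by (auto simp: Ck_chart_def simp del: Ck_on.simps)
  have d\<Phi>: "\<Phi> differentiable at q" using Ck_on_differentiable[OF U(4) assms(2)] .
  have d\<Psi>: "\<Psi> differentiable at (\<Phi> q)" using Ck_on_differentiable[OF U(5)] assms(2) by blast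
  have \<Psi>\<Phi>: "\<Psi> (\<Phi> x) = x" if "x \<in> U" for x using U(3) that by (simp add: \<Psi>_def)
  have \<Phi>\<Psi>: "\<Phi> (\<Psi> z) = z" if "z \<in> \<Phi> ` U" for z using that by (simp add: \<Psi>_def f_inv_into_f)
  have "pdv (\<lambda>x. \<Psi> (\<Phi> x)) v q = pdv \<Psi> (pdv \<Phi> v q) (\<Phi> q)"
    by (rule pdv_eqI[OF has_derivative_compose[OF pdv_has_derivative[OF d\<Phi>] pdv_has_derivative[OF d\<Psi>]]])
  moreover have "pdv (\<lambda>x. \<Psi> (\<Phi> x)) v q = pdv (\<lambda>x. x) v q"
    by (rule pdv_cong(1)[OF U(1) assms(2) \<Psi>\<Phi>])
  ultimately show "pdv \<Psi> (pdv \<Phi> v q) (\<Phi> q) = v"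
    by (simp add: pdv_bounded_linear[OF bounded_linear_ident])
  have d\<Phi>': "\<Phi> differentiable at (\<Psi> (\<Phi> q))" using d\<Phi> \<Psi>\<Phi>[OF assms(2)] by simp
  have "pdv (\<lambda>z. \<Phi> (\<Psi> z)) v (\<Phi> q) = pdv \<Phi> (pdv \<Psi> v (\<Phi> q)) (\<Psi> (\<Phi> q))"
    by (rule pdv_eqI[OF has_derivative_compose[OF pdv_has_derivative[OF d\<Psi>] pdv_has_derivative[OF d\<Phi>']]])
  moreover have "pdv (\<lambda>z. \<Phi> (\<Psi> z)) v (\<Phi> q) = pdv (\<lambda>x. x) v (\<Phi> q)"
    by (rule pdv_cong(1)[OF U(2) _ \<Phi>\<Psi>]) (use assms(2) in auto)
  ultimately show "pdv \<Phi> (pdv \<Psi> v (\<Phi> q)) q = v"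
    by (simp add: pdv_bounded_linear[OF bounded_linear_ident] \<Psi>\<Phi>[OF assms(2)])
qed

text \<open>The straightening chart pulls \<open>(0, 1)\<close> back to a continuous line field \<open>l\<close> that is transverse
  to the switching manifold and spanned by the regularization for every small \<open>\<delta>\<close>.\<close>

lemma r_sewing_line_field:
  fixes X :: "real \<Rightarrow> 'a::euclidean_space \<times> real \<Rightarrow> 'a \<times> real"
  assumes "p \<in> r_sewing U\<^sub>0 X"
  obtains U l where "open U" "p \<in> U" "U \<subseteq> U\<^sub>0" "snd p = 0" "continuous_on U l" "snd (l p) \<noteq> 0"
    "\<forall>\<^sub>F \<delta> in at_right 0. \<forall>q\<in>U. \<exists>\<alpha>. \<alpha> \<noteq> 0 \<and> X \<delta> q = \<alpha> *\<^sub>R l q"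
proof -
  from assms obtain U \<Phi> where p: "p \<in> switching U\<^sub>0 snd" "p \<in> U" and U0: "U \<subseteq> U\<^sub>0"
    and chart: "\<And>k. Ck_chart k U \<Phi>"
    and \<Sigma>: "\<And>q. q \<in> U \<Longrightarrow> q \<in> switching U\<^sub>0 snd \<longleftrightarrow> snd (\<Phi> q) = 0"
    and gen: "\<forall>\<^sub>F \<delta> in at_right 0. \<forall>q\<in>U. \<exists>\<alpha>. \<alpha> \<noteq> 0 \<and> pdv \<Phi> (X \<delta> q) q = \<alpha> *\<^sub>R (0, 1)"
    unfolding r_sewing_def by blast
  define \<Psi> where "\<Psi> = inv_into U \<Phi>"
  have U: "open U" "open (\<Phi> ` U)" "Ck_on (Suc 0) U \<Phi>" "Ck_on (Suc 0) (\<Phi> ` U) \<Psi>"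
    using chart[of "Suc 0"] by (auto simp: Ck_chart_def \<Psi>_def simp del: Ck_on.simps)
  note inv = Ck_chart_inverse[OF chart[of "Suc 0"], folded \<Psi>_def]
  define l where "l q = pdv \<Psi> (0, 1) (\<Phi> q)" for q
  have "continuous_on U l"
  proof -
    have "continuous_on (\<Phi> ` U) (pdv \<Psi> (0, 1))" using Ck_on_continuous[OF Ck_on_pdv[OF U(4)]] .
    then have "continuous_on U (pdv \<Psi> (0, 1) \<circ> \<Phi>)"
      by (rule continuous_on_compose[OF Ck_on_continuous[OF U(3)]])
    then show ?thesis by (simp add: l_def[abs_def] o_def)
  qed
  moreover have "snd (l p) \<noteq> 0"
  proof
    \<comment> \<open>A horizontal \<open>l p\<close> would be tangent to the switching manifold. As
      \<open>\<Phi>\<close> maps this manifold into \<open>snd = 0\<close>, the image of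
      \<open>l p\<close>, which is \<open>(0, 1)\<close>, would have last component 0.\<close>
    assume "snd (l p) = 0"
    then obtain v where v: "l p = (v, 0)" by (metis prod.collapse)
    obtain x0 where x0: "p = (x0, 0)" using p(1) by (auto simp: switching_def prod_eq_iff)
    define T where "T = (\<lambda>x. (x, 0::real)) -` U"
    have T: "open T" "x0 \<in> T"
      unfolding T_def using p(2) x0 by (auto intro!: open_vimage[OF U(1)] continuous_intros)
    have d\<Phi>: "\<Phi> differentiable at (x0, 0)" using Ck_on_differentiable[OF U(3) p(2)] x0 by simp
    have "((\<lambda>x. snd (\<Phi> (x, 0))) has_derivative (\<lambda>v. snd (pdv \<Phi> (v, 0) (x0, 0)))) (at x0)"
      by (rule has_derivative_snd[OF has_derivative_compose[OF has_derivative_Pair[OF has_derivative_ident has_derivative_const] pdv_has_derivative[OF d\<Phi>]]])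
    from pdv_eqI[OF this] have "snd (pdv \<Phi> (v, 0) (x0, 0)) = pdv (\<lambda>x. snd (\<Phi> (x, 0))) v x0" by simp
    also have "\<dots> = pdv (\<lambda>x. 0) v x0"
    proof (rule pdv_cong(1)[OF T])
      fix x assume "x \<in> T"
      then have "(x, 0) \<in> U" by (simp add: T_def)
      then show "snd (\<Phi> (x, 0)) = 0" using \<Sigma>[of "(x, 0)"] U0 by (auto simp: switching_def)
    qed
    finally have "snd (pdv \<Phi> (l p) p) = 0" using v x0 by simp
    then show False using inv(2)[OF p(2), of "(0, 1)"] by (simp add: l_def)
  qed
  moreover have "\<forall>\<^sub>F \<delta> in at_right 0. \<forall>q\<in>U. \<exists>\<alpha>. \<alpha> \<noteq> 0 \<and> X \<delta> q = \<alpha> *\<^sub>R l q"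
    using gen
  proof eventually_elim
    case (elim \<delta>)
    show ?case
    proof
      fix q assume q: "q \<in> U"
      then obtain \<alpha> where \<alpha>: "\<alpha> \<noteq> 0" "pdv \<Phi> (X \<delta> q) q = \<alpha> *\<^sub>R (0, 1)" using elim by blast
      have "\<Psi> differentiable at (\<Phi> q)" using Ck_on_differentiable[OF U(4)] q by blast
      then have "pdv \<Psi> (\<alpha> *\<^sub>R (0, 1)) (\<Phi> q) = \<alpha> *\<^sub>R l q"
        unfolding l_def by (rule linear_scale[OF pdv_linear])
      then show "\<exists>\<alpha>. \<alpha> \<noteq> 0 \<and> X \<delta> q = \<alpha> *\<^sub>R l q" using inv(1)[OF q, of "X \<delta> q"] \<alpha> by metis
    qed
  qed
  moreover have "snd p = 0" using p(1) by (simp add: switching_def)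
  ultimately show ?thesis using that[of U l] U(1) p(2) U0 by blast
qed

text \<open>A point of the switching manifold lies in the transition layer for every
  \<open>\<delta>\<close>, so \<open>Xp p\<close> and \<open>Xm p\<close> are reached only as
  limits: first \<open>\<delta>\<close> tends to 0 at fixed height \<open>y\<close>, then
  \<open>y\<close> tends to 0 from above or below. Such a limit of nonzero multiples of
  \<open>l\<close> may vanish; where it does not, \<open>Xp p\<close> and \<open>Xm p\<close>
  inherit the transversality of \<open>l p\<close>.\<close>

lemma r_sewing_subset_sewing:
  fixes U\<^sub>0 :: "('a::euclidean_space \<times> real) set" and \<psi> :: "'a \<Rightarrow> real \<Rightarrow> real"
  assumes cont: "continuous_on U\<^sub>0 Xp" "continuous_on U\<^sub>0 Xm"
    and \<psi>: "\<And>x. (x, 0) \<in> U\<^sub>0 \<Longrightarrow> continuous_on UNIV (\<psi> x)"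
    and m1: "\<And>x t. (x, 0) \<in> U\<^sub>0 \<Longrightarrow> t \<le> -1 \<Longrightarrow> \<psi> x t = -1"
    and p1: "\<And>x t. (x, 0) \<in> U\<^sub>0 \<Longrightarrow> t \<ge> 1 \<Longrightarrow> \<psi> x t = 1"
  shows "r_sewing U\<^sub>0 (regularization \<psi> Xp Xm) - {p. Xp p = 0 \<or> Xm p = 0} \<subseteq> sewing U\<^sub>0 snd Xp Xm"
proof
  fix p assume p: "p \<in> r_sewing U\<^sub>0 (regularization \<psi> Xp Xm) - {p. Xp p = 0 \<or> Xm p = 0}"
  then have nz: "Xp p \<noteq> 0" "Xm p \<noteq> 0" by auto
  from p obtain U l where U: "open U" "p \<in> U" "U \<subseteq> U\<^sub>0" "snd p = 0" "continuous_on U l" "snd (l p) \<noteq> 0"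
    and gen: "\<forall>\<^sub>F \<delta> in at_right 0. \<forall>q\<in>U. \<exists>\<alpha>. \<alpha> \<noteq> 0 \<and> regularization \<psi> Xp Xm \<delta> q = \<alpha> *\<^sub>R l q"
    using r_sewing_line_field[of p U\<^sub>0 "regularization \<psi> Xp Xm"] by blast
  define x0 where "x0 = fst p"
  have p0: "p = (x0, 0)" using U(4) by (simp add: x0_def prod_eq_iff)
  have x0: "(x0, 0) \<in> U\<^sub>0" using U p0 by auto
  have line: "isCont (\<lambda>y. f (x0, y)) 0" if "continuous_on U f" for f :: "'a \<times> real \<Rightarrow> 'c::topological_space"
  proof -
    have "isCont f (x0, 0)" using that U(1,2) p0 continuous_on_eq_continuous_at by blast
    then show ?thesis by (intro isCont_o2[where f = "\<lambda>y. (x0, y)" and g = f]) (auto intro!: continuous_intros)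
  qed
  have cU: "continuous_on U Xp" "continuous_on U Xm" using cont U(3) continuous_on_subset by blast+
  have inU: "\<forall>\<^sub>F y in nhds 0. (x0, y) \<in> U"
  proof -
    have "open ((\<lambda>y. (x0, y)) -` U)" by (intro open_vimage U(1) continuous_intros)
    moreover have "0 \<in> (\<lambda>y. (x0, y)) -` U" using U(2) p0 by simp
    ultimately show ?thesis using eventually_nhds_in_open by fastforce
  qed
  \<comment> \<open>Parallelism is stated without the multiplier \<open>\<alpha>\<close>, over which
    there is no control as \<open>y\<close> tends to 0; in this form it is preserved by
    limits.\<close>
  have parallel: "snd (l p) *\<^sub>R X p = snd (X p) *\<^sub>R l p"
    if X: "continuous_on U X" and F: "F \<noteq> bot" "F \<le> at 0"
      and ev: "\<forall>\<^sub>F y in F. \<forall>\<^sub>F \<delta> in at_right 0. regularization \<psi> Xp Xm \<delta> (x0, y) = X (x0, y)" for X F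
  proof -
    have lim: "((\<lambda>y. f (x0, y)) \<longlongrightarrow> f p) F" if "continuous_on U f" for f :: "'a \<times> real \<Rightarrow> 'a \<times> real"
      using line[OF that] F(2) by (auto simp: isCont_def p0 intro: tendsto_mono)
    have "\<forall>\<^sub>F y in F. (x0, y) \<in> U"
      using inU F(2) by (metis at_le eventually_nhds_conv_at filter_leD)
    then have eq: "\<forall>\<^sub>F y in F. snd (l (x0, y)) *\<^sub>R X (x0, y) = snd (X (x0, y)) *\<^sub>R l (x0, y)"
      using ev
    proof eventually_elim
      case (elim y)
      have "\<exists>\<delta>. regularization \<psi> Xp Xm \<delta> (x0, y) = X (x0, y) \<and>
          (\<forall>q\<in>U. \<exists>\<alpha>. \<alpha> \<noteq> 0 \<and> regularization \<psi> Xp Xm \<delta> q = \<alpha> *\<^sub>R l q)"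
        by (rule eventually_happens'[OF _ eventually_conj[OF elim(2) gen]]) simp
      then obtain \<alpha> where "X (x0, y) = \<alpha> *\<^sub>R l (x0, y)" using elim(1) by metis
      then show ?case by (simp add: mult.commute)
    qed
    have 1: "((\<lambda>y. snd (l (x0, y)) *\<^sub>R X (x0, y)) \<longlongrightarrow> snd (l p) *\<^sub>R X p) F"
      and 2: "((\<lambda>y. snd (X (x0, y)) *\<^sub>R l (x0, y)) \<longlongrightarrow> snd (X p) *\<^sub>R l p) F"
      by (intro tendsto_intros lim X U(5))+
    from tendsto_unique[OF F(1) Lim_transform_eventually[OF 1 eq] 2] show ?thesis .
  qed
  have "snd (l p) *\<^sub>R Xp p = snd (Xp p) *\<^sub>R l p"
  proof (rule parallel[OF cU(1), of "at_right 0"])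
    have "\<forall>\<^sub>F \<delta> in at_right 0. regularization \<psi> Xp Xm \<delta> (x0, y) = Xp (x0, y)" if "y > 0" for y
      using eventually_at_right_real[OF that]
      by eventually_elim (simp add: regularization_def p1[OF x0] field_simps)
    then show "\<forall>\<^sub>F y in at_right 0. \<forall>\<^sub>F \<delta> in at_right 0. regularization \<psi> Xp Xm \<delta> (x0, y) = Xp (x0, y)"
      by (rule eventually_mono[OF eventually_at_right_less])
  qed (auto simp: at_within_le_at)
  then have sp: "snd (Xp p) \<noteq> 0" using nz U(6) by auto
  have "snd (l p) *\<^sub>R Xm p = snd (Xm p) *\<^sub>R l p"
  proof (rule parallel[OF cU(2), of "at_left 0"])
    have "\<forall>\<^sub>F \<delta> in at_right 0. regularization \<psi> Xp Xm \<delta> (x0, y) = Xm (x0, y)" if "y < 0" for y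
    proof -
      have "0 < - y" using that by simp
      from eventually_at_right_real[OF this] show ?thesis
        by eventually_elim (simp add: regularization_def m1[OF x0] field_simps)
    qed
    moreover have "\<forall>\<^sub>F y in at_left (0::real). y < 0" by (simp add: eventually_at_filter)
    ultimately show "\<forall>\<^sub>F y in at_left 0. \<forall>\<^sub>F \<delta> in at_right 0. regularization \<psi> Xp Xm \<delta> (x0, y) = Xm (x0, y)"
      by (simp add: eventually_mono)
  qed (auto simp: at_within_le_at)
  then have sm: "snd (Xm p) \<noteq> 0" using nz U(6) by auto
  have "\<not> snd (Xp p) * snd (Xm p) < 0"
  proof
    assume neg: "snd (Xp p) * snd (Xm p) < 0"
    have near: "\<forall>\<^sub>F y in nhds 0. snd (f (x0, y)) * snd (f p) > 0" if "continuous_on U f" "snd (f p) \<noteq> 0"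
      for f :: "'a \<times> real \<Rightarrow> 'a \<times> real"
    proof -
      have "((\<lambda>y. f (x0, y)) \<longlongrightarrow> f p) (at 0)"
        using line[OF that(1)] by (simp add: isCont_def p0)
      then have "((\<lambda>y. snd (f (x0, y)) * snd (f p)) \<longlongrightarrow> snd (f p) * snd (f p)) (at 0)"
        by (intro tendsto_mult tendsto_snd tendsto_const)
      moreover have pos: "0 < snd (f p) * snd (f p)" using that(2) by (auto simp: zero_less_mult_iff)
      ultimately have "\<forall>\<^sub>F y in at 0. 0 < snd (f (x0, y)) * snd (f p)" by (rule order_tendstoD)
      then show ?thesis using pos p0 by (simp add: eventually_nhds_conv_at)
    qed
    have "\<forall>\<^sub>F y in nhds 0. (x0, y) \<in> U \<and> snd (l (x0, y)) * snd (l p) > 0 \<and>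
        snd (Xp (x0, y)) * snd (Xp p) > 0 \<and> snd (Xm (x0, y)) * snd (Xm p) > 0"
      by (intro eventually_conj inU near U(5,6) cU sp sm)
    then obtain r where r: "r > 0" "\<And>y. \<bar>y\<bar> < r \<Longrightarrow> (x0, y) \<in> U \<and> snd (l (x0, y)) * snd (l p) > 0 \<and>
        snd (Xp (x0, y)) * snd (Xp p) > 0 \<and> snd (Xm (x0, y)) * snd (Xm p) > 0"
      by (auto simp: eventually_nhds_metric dist_real_def)
    have "\<exists>\<delta>. \<delta> \<in> {0<..<r} \<and> (\<forall>q\<in>U. \<exists>\<alpha>. \<alpha> \<noteq> 0 \<and> regularization \<psi> Xp Xm \<delta> q = \<alpha> *\<^sub>R l q)"
      by (rule eventually_happens'[OF _ eventually_conj[OF eventually_at_right_real[OF r(1)] gen]]) simp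
    then obtain \<delta> where \<delta>: "0 < \<delta>" "\<delta> < r"
      "\<And>q. q \<in> U \<Longrightarrow> \<exists>\<alpha>. \<alpha> \<noteq> 0 \<and> regularization \<psi> Xp Xm \<delta> q = \<alpha> *\<^sub>R l q" by auto
    \<comment> \<open>Across the layer the last component goes from the sign of \<open>Xm p\<close>
      at \<open>-\<delta>\<close> to that of \<open>Xp p\<close> at \<open>\<delta>\<close>. As
      \<open>\<delta> < r\<close>, the line field is still transverse there, so a zero of
      \<open>G\<close> contradicts \<open>\<alpha> \<noteq> 0\<close>.\<close>
    define G where "G y = snd (regularization \<psi> Xp Xm \<delta> (x0, y))" for y
    have sub: "(\<lambda>y. (x0, y)) ` {-\<delta>..\<delta>} \<subseteq> U" using r(2) \<delta> by force
    have c: "continuous_on {-\<delta>..\<delta>} (\<lambda>y. f (x0, y))" if "continuous_on U f" for f :: "'a \<times> real \<Rightarrow> 'a \<times> real"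
      by (rule continuous_on_compose2[OF that _ sub]) (intro continuous_intros)
    have "continuous_on {-\<delta>..\<delta>} (\<lambda>y. \<psi> x0 (y / \<delta>))"
      by (rule continuous_on_compose2[OF \<psi>[OF x0]]) (use \<delta> in \<open>auto intro!: continuous_intros\<close>)
    then have "continuous_on {-\<delta>..\<delta>} G"
      unfolding G_def[abs_def] regularization_def fst_conv snd_conv
      by (intro continuous_intros c cU) auto
    moreover have "G \<delta> = snd (Xp (x0, \<delta>))" "G (-\<delta>) = snd (Xm (x0, -\<delta>))"
      using p1[OF x0, of 1] m1[OF x0, of "-1"] \<delta> by (auto simp: G_def regularization_def)
    moreover have "snd (Xp (x0, \<delta>)) * snd (Xp p) > 0" "snd (Xm (x0, -\<delta>)) * snd (Xm p) > 0"
      using r(2)[of \<delta>] r(2)[of "-\<delta>"] \<delta> by auto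
    ultimately have "\<exists>y. -\<delta> \<le> y \<and> y \<le> \<delta> \<and> G y = 0"
      using neg \<delta> IVT'[of G "-\<delta>" 0 \<delta>] IVT2'[of G \<delta> 0 "-\<delta>"]
      by (auto simp: mult_less_0_iff zero_less_mult_iff)
    then obtain y where "-\<delta> \<le> y" "y \<le> \<delta>" and G0: "G y = 0" by blast
    then have y: "\<bar>y\<bar> < r" "G y = 0" using \<delta>(2) by linarith+
    then obtain \<alpha> where "\<alpha> \<noteq> 0" "regularization \<psi> Xp Xm \<delta> (x0, y) = \<alpha> *\<^sub>R l (x0, y)"
      using \<delta>(3) r(2) by blast
    then show False using y(2) r(2)[OF y(1)] by (simp add: G_def)
  qed
  then have "snd (Xp p) * snd (Xm p) > 0" using sp sm by (simp add: not_less order_less_le)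
  then show "p \<in> sewing U\<^sub>0 snd Xp Xm" using x0 p0 by (simp add: sewing_def switching_def)
qed

text \<open>The witnesses \<open>U\<close> and \<open>S\<close> for one point serve all points of
  the switching manifold in \<open>U\<close>; \<open>R\<close> collects the conditions that do not
  mention the point.\<close>

lemma open_r_sliding: "open {x. (x, 0) \<in> r_sliding U\<^sub>0 X}"
proof (subst open_subopen, intro ballI)
  fix x assume x: "x \<in> {x. (x, 0) \<in> r_sliding U\<^sub>0 X}"
  define R where "R U S \<longleftrightarrow> (\<forall>\<^sub>F \<delta> in at_right 0. S \<delta> \<subseteq> U \<and> invariant_in U (X \<delta>) (S \<delta>)) \<and>
     (\<forall>k. \<forall>\<^sub>F \<delta> in at_right 0. \<exists>d. Ck_submanifold k d (S \<delta>)) \<and>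
     (\<forall>K. compact K \<and> K \<subseteq> U \<and> switching U\<^sub>0 snd \<inter> K \<subseteq> closure (switching U\<^sub>0 snd \<inter> interior K) \<longrightarrow>
        ((\<lambda>\<delta>. hausdorff_dist (S \<delta> \<inter> K) (switching U\<^sub>0 snd \<inter> K)) \<longlongrightarrow> 0) (at_right 0))" for U S
  have eq: "p \<in> r_sliding U\<^sub>0 X \<longleftrightarrow> p \<in> switching U\<^sub>0 snd \<and> (\<exists>U S. open U \<and> p \<in> U \<and> U \<subseteq> U\<^sub>0 \<and> R U S)" for p
    unfolding r_sliding_def R_def by simp
  obtain U S where U: "open U" "(x, 0) \<in> U" "U \<subseteq> U\<^sub>0" "R U S" using x unfolding mem_Collect_eq eq by blast
  have "(x', 0) \<in> r_sliding U\<^sub>0 X" if "(x', 0) \<in> U" for x'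
    unfolding eq using U that by (auto simp: switching_def)
  moreover have "open ((\<lambda>x. (x, 0)) -` U)" by (intro open_vimage U(1) continuous_intros)
  ultimately show "\<exists>T. open T \<and> x \<in> T \<and> T \<subseteq> {x. (x, 0) \<in> r_sliding U\<^sub>0 X}"
    using U(2) by (intro exI[of _ "(\<lambda>x. (x, 0)) -` U"]) auto
qed

lemma smooth_on_sliding_field:
  assumes "open U\<^sub>0" "smooth_on U\<^sub>0 Xp" "smooth_on U\<^sub>0 Xm"
    and T: "open T" "\<And>x. x \<in> T \<Longrightarrow> (x, 0) \<in> U\<^sub>0"
    and ne: "\<And>x. x \<in> T \<Longrightarrow> snd (Xp (x, 0)) \<noteq> snd (Xm (x, 0))"
  shows "smooth_on T (\<lambda>x. sliding_field snd Xp Xm (x, 0))"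
  unfolding smooth_on_def
proof
  fix k
  have A: "bounded_linear (\<lambda>x. (x, 0))"
    by (intro bounded_linear_Pair bounded_linear_zero bounded_linear_ident)
  have c: "Ck_on k T (\<lambda>x. Xp (x, 0))" "Ck_on k T (\<lambda>x. Xm (x, 0))"
    using assms(2,3) T(2)
    by (auto simp: smooth_on_def intro!: Ck_on_linear_comp[OF T(1) A, where S = U\<^sub>0])
  have g: "Ck_on k T (\<lambda>x. snd (Xp (x, 0)))" "Ck_on k T (\<lambda>x. snd (Xm (x, 0)))"
    by (intro Ck_on_bounded_linear[OF T(1) bounded_linear_snd] c)+
  have "Ck_on k T (\<lambda>x. inverse (snd (Xp (x, 0)) + (-1) *\<^sub>R snd (Xm (x, 0))) *\<^sub>R
      (snd (Xp (x, 0)) *\<^sub>R Xm (x, 0) + (-1) *\<^sub>R (snd (Xm (x, 0)) *\<^sub>R Xp (x, 0))))"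
    by (intro Ck_on_scaleR Ck_on_add Ck_on_inverse Ck_on_const T(1) g c) (use ne in auto)
  then show "Ck_on k T (\<lambda>x. sliding_field snd Xp Xm (x, 0))"
    by (simp add: sliding_field_def)
qed

section \<open>Sliding points\<close>

text \<open>Because \<open>a < b\<close>, the open sets |s| > a and |s| < b cover the line. On the
  first all derivatives vanish, on the second the given bounds apply.\<close>

lemma ubd_extend_zero:
  fixes f :: "'i \<Rightarrow> real \<Rightarrow> real"
  assumes "a < b"
  shows "ubd n {-b<..<b} I f \<Longrightarrow> (\<And>i s. i \<in> I \<Longrightarrow> \<bar>s\<bar> > a \<Longrightarrow> f i s = 0) \<Longrightarrow> ubd n UNIV I f"
proof (induction n arbitrary: f)
  case 0
  obtain C where C: "C \<ge> 0" "\<And>i s. i \<in> I \<Longrightarrow> s \<in> {-b<..<b} \<Longrightarrow> \<bar>f i s\<bar> \<le> C"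
    using ubd_bound0[OF 0(1)] by metis
  have "\<bar>f i s\<bar> \<le> C" if "i \<in> I" for i s
  proof (cases "\<bar>s\<bar> > a")
    case False
    then have "s \<in> {-b<..<b}" using assms by (auto simp: abs_if split: if_splits)
    then show ?thesis by (rule C(2)[OF that])
  qed (use 0(2)[OF that] C(1) in auto)
  then show ?case by auto
next
  case (Suc n)
  have out: "open {s::real. a < \<bar>s\<bar>}" by (intro open_Collect_less continuous_intros)
  have zero: "pdv (f i) v s = 0" "f i differentiable at s" if "i \<in> I" "\<bar>s\<bar> > a" for i s v
    using pdv_cong(1)[OF out, of s "f i" "\<lambda>_. 0" v] pdv_cong(2)[OF out, of s "f i" "\<lambda>_. 0"]
      Suc.prems(2)[OF that(1)] that(2) by auto
  have "ubd n UNIV I f" by (rule Suc.IH[OF ubd_SucD[OF Suc.prems(1)] Suc.prems(2)])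
  then have "ubd 0 UNIV I f" by (rule ubd_mono) simp
  moreover have "f i differentiable at s" if "i \<in> I" for i s
  proof (cases "\<bar>s\<bar> > a")
    case False
    then have "s \<in> {-b<..<b}" using assms by (auto simp: abs_if split: if_splits)
    then show ?thesis by (rule ubd_differentiable[OF Suc.prems(1) that])
  qed (use zero that in blast)
  moreover have "ubd n UNIV I (\<lambda>i. pdv (f i) b)" if "b \<in> Basis" for b
    by (rule Suc.IH) (use Suc.prems(1) that zero in auto)
  ultimately show ?case by (rule ubd_SucI)
qed

lemma lubd_affine:
  fixes L :: "'a::euclidean_space \<Rightarrow> real"
  assumes "bounded_linear L" "open D"
  shows "lubd n D I (\<lambda>_ x. c + L x)"
proof (rule lubd_add[OF assms(2)])
  show "lubd n D I (\<lambda>_ x. c)"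
    by (rule ubd_imp_lubd[OF ubd_const[where c = "\<lambda>_. c" and C = "\<bar>c\<bar>"]]) auto
  show "lubd n D I (\<lambda>_. L)"
  proof (rule lubd_bounded_linear[OF assms(1)])
    show "\<bar>L b\<bar> \<le> Max ((\<lambda>b. \<bar>L b\<bar>) ` Basis)" if "b \<in> Basis" for b :: 'a using that by auto
  qed (rule assms(2))
qed

text \<open>The function \<open>s * \<beta> (2 - s) * \<beta> (2 + s)\<close> is the identity for
  |s| \<le> 1 and 0 for |s| > 3, by the two plateaus of \<open>\<beta>\<close>. For |s| < 4 the
  arguments stay in (-2, 6), inside the interval where \<open>\<beta>\<close> has bounds.\<close>

lemma cutoff_identity:
  fixes \<beta> :: "real \<Rightarrow> real"
  assumes \<beta>: "\<And>n. ubd n {-7<..<7} {()} (\<lambda>_. \<beta>)" and 0: "\<And>t. t \<le> -1 \<Longrightarrow> \<beta> t = 0" and 1: "\<And>t. t \<ge> 1 \<Longrightarrow> \<beta> t = 1"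
    and \<beta>01: "\<And>t. 0 \<le> \<beta> t \<and> \<beta> t \<le> 1"
  obtains \<Theta> where "\<And>n. ubd n UNIV {()} (\<lambda>_. \<Theta>)" "\<And>s. \<bar>s\<bar> \<le> 1 \<Longrightarrow> \<Theta> s = s" "\<And>s. \<bar>\<Theta> s\<bar> \<le> 3"
proof -
  define \<Theta> where "\<Theta> s = s * (\<beta> (2 - s) * \<beta> (2 + s))" for s
  have out: "\<Theta> s = 0" if "\<bar>s\<bar> > 3" for s
  proof (cases "s > 0")
    case True
    then show ?thesis using that 0[of "2 - s"] by (simp add: \<Theta>_def)
  next
    case False
    then show ?thesis using that 0[of "2 + s"] by (simp add: \<Theta>_def)
  qed
  have "ubd n UNIV {()} (\<lambda>_. \<Theta>)" for n
  proof (rule ubd_extend_zero[of 3 4])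
    have shift: "ubd n {-4<..<4} {()} (\<lambda>_ s. \<beta> (2 + c * s))" if "\<bar>c\<bar> = 1" for c
    proof (rule ubd_comp[OF _ _ \<beta>, where Z = "\<lambda>_ s. 2 + c * s"])
      show "2 + c * s \<in> {-7<..<7}" if "s \<in> {-4<..<4}" for s
        using that \<open>\<bar>c\<bar> = 1\<close> by (auto simp: abs_if split: if_splits)
      show "lubd n {-4<..<4} {()} (\<lambda>_ s. (2 + c * s) \<bullet> b)" if "b \<in> Basis" for b :: real
        using that lubd_affine[OF bounded_linear_mult_right, of "{-4<..<4}" n "{()}" 2 c] by simp
    qed auto
    have "ubd n {-4<..<4} {()} (\<lambda>_ s::real. s)"
    proof (rule ubd_lubdI)
      show "ubd 0 {-4<..<4} {()} (\<lambda>_ s::real. s)" by (auto intro!: exI[of _ 4])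
      show "lubd n {-4<..<4} {()} (\<lambda>_ s::real. s)"
        using lubd_affine[OF bounded_linear_ident, of "{-4<..<4}" n "{()}" 0] by simp
    qed
    then have "ubd n {-4<..<4} {()} (\<lambda>_ s. s * (\<beta> (2 + (-1) * s) * \<beta> (2 + 1 * s)))"
      by (intro ubd_mult shift) auto
    then show "ubd n {-4<..<4} {()} (\<lambda>_. \<Theta>)" by (simp add: \<Theta>_def[abs_def] del: ubd.simps)
  qed (use out in auto)
  moreover have "\<Theta> s = s" if "\<bar>s\<bar> \<le> 1" for s using that 1[of "2 - s"] 1[of "2 + s"] by (simp add: \<Theta>_def)
  moreover have "\<bar>\<Theta> s\<bar> \<le> 3" for s
  proof (cases "\<bar>s\<bar> > 3")
    case False
    have "\<bar>\<Theta> s\<bar> \<le> \<bar>s\<bar> * 1"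
      unfolding \<Theta>_def abs_mult using \<beta>01[of "2 - s"] \<beta>01[of "2 + s"]
      by (intro mult_left_mono mult_le_one) auto
    then show ?thesis using False by simp
  qed (simp add: out)
  ultimately show ?thesis using that by blast
qed

locale filippov =
  fixes U\<^sub>0 :: "('a::euclidean_space \<times> real) set"
    and Xp Xm :: "'a \<times> real \<Rightarrow> 'a \<times> real"
    and \<psi> :: "'a \<Rightarrow> real \<Rightarrow> real"
  assumes open_U0: "open U\<^sub>0"
    and smooth: "smooth_on U\<^sub>0 Xp" "smooth_on U\<^sub>0 Xm"
    and \<psi>_smooth: "smooth_on ({x. (x, 0) \<in> U\<^sub>0} \<times> UNIV) (\<lambda>(x, t). \<psi> x t)"
    and \<psi>_range: "\<And>x t. (x, 0) \<in> U\<^sub>0 \<Longrightarrow> \<psi> x t \<in> {-1..1}"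
    and \<psi>_minus: "\<And>x t. (x, 0) \<in> U\<^sub>0 \<Longrightarrow> t \<le> -1 \<Longrightarrow> \<psi> x t = -1"
    and \<psi>_plus: "\<And>x t. (x, 0) \<in> U\<^sub>0 \<Longrightarrow> t \<ge> 1 \<Longrightarrow> \<psi> x t = 1"
begin

text \<open>The regularization in the rescaled variables \<open>(x, \<tau>, \<delta>)\<close>, \<open>y = \<delta> \<tau>\<close>. Unlike the original
  family it is smooth up to \<open>\<delta> = 0\<close>.\<close>

definition blend :: "'a \<times> real \<times> real \<Rightarrow> 'a \<times> real" where
  "blend = (\<lambda>(x, \<tau>, \<delta>). ((1 + \<psi> x \<tau>) / 2) *\<^sub>R Xp (x, \<delta> * \<tau>) + ((1 - \<psi> x \<tau>) / 2) *\<^sub>R Xm (x, \<delta> * \<tau>))"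

lemma regularization_blend: "\<delta> \<noteq> 0 \<Longrightarrow> regularization \<psi> Xp Xm \<delta> (x, y) = blend (x, y / \<delta>, \<delta>)"
  by (simp add: regularization_def blend_def)

text \<open>The condition \<open>d * T \<le> R\<close> keeps \<open>y = \<delta> \<tau>\<close>
  inside the domain of the fields. The range of \<open>\<delta>\<close> contains 0, so the bounds
  persist in the singular limit.\<close>

lemma blend_ubd:
  assumes R: "cball x0 R \<times> {-R..R} \<subseteq> U\<^sub>0" "R > 0" and Td: "T > 0" "d > 0" "d * T \<le> R"
  shows "ubd n (ball x0 R \<times> {-T<..<T} \<times> {-d<..<d}) {()} (\<lambda>_ p. blend p \<bullet> c)"
proof -
  define D where "D = ball x0 R \<times> {-T<..<T} \<times> {-d<..<d}"
  have D: "open D" unfolding D_def by (intro open_Times) auto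
  have lin: "ubd n D {()} (\<lambda>_. L)" if "bounded_linear L" "\<And>p. p \<in> D \<Longrightarrow> \<bar>L p\<bar> \<le> C" for L C
  proof (rule ubd_lubdI)
    show "ubd 0 D {()} (\<lambda>_. L)" unfolding ubd.simps using that(2) by blast
    show "lubd n D {()} (\<lambda>_. L)" using lubd_affine[OF that(1) D, of n "{()}" 0] by simp
  qed
  have \<tau>: "ubd n D {()} (\<lambda>_ p. fst (snd p))"
    by (rule lin[where C = T]) (auto simp: D_def intro!: bounded_linear_compose[OF bounded_linear_fst bounded_linear_snd])
  have \<delta>: "ubd n D {()} (\<lambda>_ p. snd (snd p))"
    by (rule lin[where C = d]) (auto simp: D_def intro!: bounded_linear_compose[OF bounded_linear_snd bounded_linear_snd])
  have x: "lubd n D {()} (\<lambda>_ p. fst p \<bullet> b)" for b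
    using lubd_affine[OF bounded_linear_compose[OF bounded_linear_inner_left bounded_linear_fst] D, of n "{()}" 0 b] by simp
  have comp: "ubd n D {()} (\<lambda>_ p. f (fst p, s p))"
    if f: "Ck_on n S f" and K: "cball x0 R \<times> {-r..r} \<subseteq> S" and s: "ubd n D {()} (\<lambda>_. s)"
      and sr: "\<And>p. p \<in> D \<Longrightarrow> \<bar>s p\<bar> < r" for f :: "'a \<times> real \<Rightarrow> real" and S r s
  proof (rule ubd_comp[OF D, where f = "\<lambda>_. f" and Z = "\<lambda>_ p. (fst p, s p)"])
    show "ubd n (ball x0 R \<times> {-r<..<r}) {()} (\<lambda>_. f)"
      by (rule Ck_on_ubd[OF _ K _ f]) (auto intro: compact_Times)
    show "(fst p, s p) \<in> ball x0 R \<times> {-r<..<r}" if "p \<in> D" for p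
      using sr[OF that] that by (auto simp: D_def abs_less_iff)
    fix c :: "'a \<times> real" assume "c \<in> Basis"
    then consider b where "b \<in> Basis" "c = (b, 0)" | "c = (0, 1)" by (auto simp: Basis_prod_def)
    then show "lubd n D {()} (\<lambda>_ p. (fst p, s p) \<bullet> c)"
      by cases (simp_all add: x ubd_imp_lubd[OF s])
  qed
  have sub: "cball x0 R \<times> {-r..r} \<subseteq> {x. (x, 0) \<in> U\<^sub>0} \<times> UNIV" for r using R by auto
  have "ubd n D {()} (\<lambda>_ p. (\<lambda>(x, t). \<psi> x t) (fst p, fst (snd p)))"
    by (rule comp[OF _ sub \<tau>]) (use \<psi>_smooth in \<open>auto simp: smooth_on_def D_def abs_less_iff\<close>)
  then have \<psi>: "ubd n D {()} (\<lambda>_ p. \<psi> (fst p) (fst (snd p)))" by simp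
  have small: "\<bar>snd (snd p) * fst (snd p)\<bar> < R" if "p \<in> D" for p
  proof -
    have "\<bar>snd (snd p) * fst (snd p)\<bar> < d * T"
      unfolding abs_mult using that Td by (intro mult_strict_mono') (auto simp: D_def abs_less_iff)
    then show ?thesis using Td(3) by simp
  qed
  have X: "ubd n D {()} (\<lambda>_ p. Y (fst p, snd (snd p) * fst (snd p)) \<bullet> c)" if "smooth_on U\<^sub>0 Y" for Y :: "'a \<times> real \<Rightarrow> 'a \<times> real"
  proof (rule comp[where f = "\<lambda>q. Y q \<bullet> c", OF _ R(1)])
    show "Ck_on n U\<^sub>0 (\<lambda>q. Y q \<bullet> c)"
      using that by (intro Ck_on_bounded_linear[OF open_U0 bounded_linear_inner_left]) (auto simp: smooth_on_def)
    show "ubd n D {()} (\<lambda>_ p. snd (snd p) * fst (snd p))" by (rule ubd_mult[OF D \<delta> \<tau>])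
  qed (rule small)
  have const: "ubd n D {()} (\<lambda>_ _. a)" for a :: real by (rule ubd_const[where c = "\<lambda>_. a" and C = "\<bar>a\<bar>"]) auto
  have "ubd n D {()} (\<lambda>_ p. (1 / 2) * (1 + \<psi> (fst p) (fst (snd p))) * (Xp (fst p, snd (snd p) * fst (snd p)) \<bullet> c)
      + (1 / 2) * (1 - \<psi> (fst p) (fst (snd p))) * (Xm (fst p, snd (snd p) * fst (snd p)) \<bullet> c))"
    by (intro ubd_add ubd_mult ubd_diff D const \<psi> X smooth)
  then show ?thesis
    unfolding D_def[symmetric] by (rule ubd_cong_imp[OF D]) (auto simp: blend_def inner_add_left)
qed

end

section \<open>The rescaled system near a sliding point\<close>

context filippov
begin

lemma \<psi>_continuous:
  assumes "(x, 0) \<in> U\<^sub>0"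
  shows "continuous_on UNIV (\<psi> x)"
proof -
  have "continuous_on ({x. (x, 0) \<in> U\<^sub>0} \<times> UNIV) (\<lambda>(x, t). \<psi> x t)"
    using \<psi>_smooth Ck_on_continuous by (auto simp: smooth_on_def)
  then have "continuous_on UNIV (\<lambda>t. (\<lambda>(x, t). \<psi> x t) (x, t))"
    by (rule continuous_on_compose2) (use assms in \<open>auto intro!: continuous_intros\<close>)
  then show ?thesis by simp
qed

lemma \<psi>_differentiable:
  assumes "(x, 0) \<in> U\<^sub>0"
  shows "(\<psi> x has_real_derivative deriv (\<psi> x) t) (at t)"
proof -
  have "(\<lambda>(x, t). \<psi> x t) differentiable at (x, t)"
    by (rule Ck_on_differentiable[of 0 "{x. (x, 0) \<in> U\<^sub>0} \<times> UNIV"])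
      (use \<psi>_smooth assms in \<open>auto simp: smooth_on_def simp del: Ck_on.simps\<close>)
  then have "(\<lambda>(x, t). \<psi> x t) differentiable at ((x, 0) + t *\<^sub>R (0, 1))" by simp
  from deriv_along_line[OF this] show ?thesis
    by (auto simp: DERIV_deriv_iff_real_differentiable real_differentiable_def)
qed

text \<open>The constant may degenerate as \<open>\<delta>\<close> tends to 0; the invariance
  argument uses it for one \<open>\<delta>\<close> at a time.\<close>

lemma regularization_lipschitz:
  assumes R: "cball x0 R \<times> {-R..R} \<subseteq> U\<^sub>0" "R > 0" and \<delta>: "\<delta> > 0"
  shows "\<exists>L\<ge>0. \<forall>x\<in>ball x0 R. \<forall>y\<in>{-R/2<..<R/2}. \<forall>y'\<in>{-R/2<..<R/2}.
    norm (regularization \<psi> Xp Xm \<delta> (x, y) - regularization \<psi> Xp Xm \<delta> (x, y')) \<le> L * \<bar>y - y'\<bar>"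
proof -
  \<comment> \<open>The ranges of \<open>\<tau>\<close> and \<open>\<delta>\<close> multiply to
    \<open>R/(2 \<delta>) * 2 \<delta> = R\<close>, as \<open>blend_ubd\<close> demands, and cover
    |y| < R/2 for the given \<open>\<delta>\<close>.\<close>
  define D where "D = ball x0 R \<times> {-(R/(2*\<delta>))<..<R/(2*\<delta>)} \<times> {-(2*\<delta>)<..<2*\<delta>}"
  have "convex D" unfolding D_def by (intro convex_Times) auto
  have "\<exists>L. \<forall>c\<in>Basis. L c \<ge> 0 \<and> (\<forall>p\<in>D. \<forall>q\<in>D. \<bar>blend p \<bullet> c - blend q \<bullet> c\<bar> \<le> L c * norm (p - q))"
  proof (intro bchoice ballI)
    fix c :: "'a \<times> real"
    have "ubd (Suc 0) D {()} (\<lambda>_ p. blend p \<bullet> c)"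
      unfolding D_def by (rule blend_ubd[OF R]) (use R(2) \<delta> in auto)
    from ubd_lipschitz[OF this \<open>convex D\<close>]
    show "\<exists>L. L \<ge> 0 \<and> (\<forall>p\<in>D. \<forall>q\<in>D. \<bar>blend p \<bullet> c - blend q \<bullet> c\<bar> \<le> L * norm (p - q))" by simp
  qed
  then obtain L where L: "\<And>c. c \<in> Basis \<Longrightarrow> L c \<ge> 0"
    "\<And>c p q. c \<in> Basis \<Longrightarrow> p \<in> D \<Longrightarrow> q \<in> D \<Longrightarrow> \<bar>blend p \<bullet> c - blend q \<bullet> c\<bar> \<le> L c * norm (p - q)"
    by metis
  have "norm (regularization \<psi> Xp Xm \<delta> (x, y) - regularization \<psi> Xp Xm \<delta> (x, y')) \<le> (\<Sum>c\<in>Basis. L c) / \<delta> * \<bar>y - y'\<bar>"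
    if x: "x \<in> ball x0 R" and y: "y \<in> {-R/2<..<R/2}" "y' \<in> {-R/2<..<R/2}" for x y y'
  proof -
    have D: "(x, y / \<delta>, \<delta>) \<in> D" "(x, y' / \<delta>, \<delta>) \<in> D"
      using x y \<delta> by (auto simp: D_def field_simps)
    have n: "norm ((x, y / \<delta>, \<delta>) - (x, y' / \<delta>, \<delta>)) = \<bar>y - y'\<bar> / \<delta>"
      using \<delta> by (simp add: norm_Pair flip: diff_divide_distrib)
    have "norm (blend (x, y / \<delta>, \<delta>) - blend (x, y' / \<delta>, \<delta>)) \<le> (\<Sum>c\<in>Basis. L c * (\<bar>y - y'\<bar> / \<delta>))"
      by (rule order_trans[OF norm_le_l1 sum_mono])
        (use L(2)[OF _ D] in \<open>simp only: inner_diff_left n\<close>)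
    then show ?thesis using \<delta> by (simp add: regularization_blend sum_distrib_right sum_divide_distrib)
  qed
  moreover have "(\<Sum>c\<in>Basis. L c) / \<delta> \<ge> 0" using L(1) \<delta> by (intro divide_nonneg_pos sum_nonneg)
  ultimately show ?thesis by blast
qed

text \<open>In the variable \<open>\<tau>\<close> the system reads x' = f, \<open>\<delta>\<close>
  \<open>\<tau>\<close>' = G, and \<open>\<mu> = \<delta> (\<tau>0 + m)\<close> is invariant when
  \<open>\<delta>\<close> Dm f = G. At \<open>\<delta> = 0\<close> the function G has a
  nondegenerate zero \<open>\<tau>0\<close> over \<open>x0\<close>. Cutting off near it and dividing
  by \<open>\<kappa>\<close> yields an instance of \<open>slow_fast\<close>. The cutoff is inactive
  over \<open>ball x0 r\<close>, hence the equation is claimed there only.\<close>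

lemma slow_manifolds_at:
  assumes p: "(x0, 0) \<in> sliding U\<^sub>0 snd Xp Xm"
    and reg: "\<And>t. \<bar>t\<bar> < 1 \<Longrightarrow> deriv (\<psi> x0) t \<noteq> 0"
    and R: "cball x0 R \<times> {-R..R} \<subseteq> U\<^sub>0" "R > 0"
  shows "\<exists>r>0. r \<le> R \<and> (\<forall>k. \<exists>D>0. \<forall>d\<in>{0<..<D}. \<exists>\<mu>. Ck_on (Suc k) UNIV \<mu> \<and> (\<forall>x. \<bar>\<mu> x\<bar> \<le> d * 2) \<and>
    (\<forall>x\<in>ball x0 r. pdv \<mu> (fst (regularization \<psi> Xp Xm d (x, \<mu> x))) x = snd (regularization \<psi> Xp Xm d (x, \<mu> x))))"
proof -
  have x0: "(x0, 0) \<in> U\<^sub>0" using R by auto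
  define g1 where "g1 = snd (Xp (x0, 0))"
  define g2 where "g2 = snd (Xm (x0, 0))"
  have neg: "g1 * g2 < 0" using p by (simp add: sliding_def g1_def g2_def)
  define dd where "dd = min 1 (R / 7)"
  have dd: "dd > 0" "dd \<le> 1" "dd * 7 \<le> R" using R(2) by (auto simp: dd_def)
  define D where "D = ball x0 R \<times> {-7<..<7::real} \<times> {-dd<..<dd}"
  have D: "open D" "convex D" unfolding D_def by (intro open_Times convex_Times; simp)+
  have blend: "ubd n D {()} (\<lambda>_ p. blend p \<bullet> c)" for n c
    unfolding D_def by (rule blend_ubd[OF R]) (use dd in auto)
  define G where "G p = snd (blend p)" for p
  have G: "ubd n D {()} (\<lambda>_. G)" for n
    using blend[of n "(0, 1)"] by (simp add: G_def[abs_def] inner_prod_def del: ubd.simps)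
  have dG: "G differentiable at p" if "p \<in> D" for p using ubd_differentiable[OF G _ that] by simp
  obtain LG where LG: "LG \<ge> 0" "\<And>p q. p \<in> D \<Longrightarrow> q \<in> D \<Longrightarrow> \<bar>G p - G q\<bar> \<le> LG * norm (p - q)"
    using ubd_lipschitz[OF G[of "Suc 0"] D(2)] by auto
  define Q where "Q = pdv G (0, 1, 0)"
  have "ubd (Suc 0) D {()} (\<lambda>_. Q)"
    using G[of "Suc (Suc 0)"] unfolding Q_def by (subst (asm) ubd.simps) (auto simp: Basis_prod_def)
  from ubd_lipschitz[OF this D(2)]
  obtain LQ where LQ: "LQ \<ge> 0" "\<And>p q. p \<in> D \<Longrightarrow> q \<in> D \<Longrightarrow> \<bar>Q p - Q q\<bar> \<le> LQ * norm (p - q)"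
    by auto
  have G0: "G (x0, \<tau>, 0) = (1 + \<psi> x0 \<tau>) / 2 * g1 + (1 - \<psi> x0 \<tau>) / 2 * g2" for \<tau>
    by (simp add: G_def blend_def g1_def g2_def)
  have "continuous_on {-1..1} (\<lambda>\<tau>. G (x0, \<tau>, 0))"
    unfolding G0 by (intro continuous_intros continuous_on_subset[OF \<psi>_continuous[OF x0]]) auto
  moreover have "G (x0, -1, 0) = g2" "G (x0, 1, 0) = g1"
    using \<psi>_minus[OF x0, of "-1"] \<psi>_plus[OF x0, of 1] by (auto simp: G0)
  ultimately have "\<exists>\<tau>. -1 \<le> \<tau> \<and> \<tau> \<le> 1 \<and> G (x0, \<tau>, 0) = 0"
    using neg IVT'[of "\<lambda>\<tau>. G (x0, \<tau>, 0)" "-1" 0 1] IVT2'[of "\<lambda>\<tau>. G (x0, \<tau>, 0)" 1 0 "-1"]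
    by (auto simp: mult_less_0_iff)
  then obtain \<tau>0 where \<tau>0: "-1 \<le> \<tau>0" "\<tau>0 \<le> 1" "G (x0, \<tau>0, 0) = 0" by blast
  have "\<tau>0 \<noteq> -1" "\<tau>0 \<noteq> 1"
    using \<tau>0(3) \<open>G (x0, -1, 0) = g2\<close> \<open>G (x0, 1, 0) = g1\<close> neg by auto
  with \<tau>0 have \<tau>01: "\<bar>\<tau>0\<bar> < 1" by auto
  define p0 where "p0 = (x0, \<tau>0, 0::real)"
  have p0: "p0 \<in> D" using \<tau>01 R(2) dd by (auto simp: p0_def D_def)
  define \<kappa> where "\<kappa> = Q p0"
  \<comment> \<open>This is normal hyperbolicity of the critical manifold G = 0 at
    \<open>p0\<close>: the hypothesis on the derivative of \<open>\<psi>\<close> and the opposite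
    signs of \<open>g1\<close> and \<open>g2\<close> make \<open>\<kappa>\<close> nonzero.\<close>
  have "\<kappa> = deriv (\<psi> x0) \<tau>0 * (g1 - g2) / 2"
  proof (rule DERIV_unique)
    show "((\<lambda>\<tau>. G (x0, \<tau>, 0)) has_real_derivative \<kappa>) (at \<tau>0)"
      using deriv_along_line[of G "(x0, 0, 0)" \<tau>0 "(0, 1, 0)"] dG[OF p0]
      by (simp add: \<kappa>_def Q_def p0_def)
    show "((\<lambda>\<tau>. G (x0, \<tau>, 0)) has_real_derivative deriv (\<psi> x0) \<tau>0 * (g1 - g2) / 2) (at \<tau>0)"
      unfolding G0 by (auto intro!: derivative_eq_intros \<psi>_differentiable[OF x0] simp: field_simps)
  qed
  moreover have "g1 \<noteq> g2" using neg by (auto simp: mult_less_0_iff)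
  ultimately have \<kappa>: "\<kappa> \<noteq> 0" using reg[OF \<tau>01] by (simp del: eq_divide_eq_numeral1)

  \<comment> \<open>Rescaled to the range [0, 1], the transition function at \<open>x0\<close>
    becomes the \<open>\<beta>\<close> from which the cutoff is built.\<close>
  have "ubd n {-7<..<7} {()} (\<lambda>_ t. (1 + \<psi> x0 t) * (1 / 2))" for n
  proof -
    have ball: "ubd n (ball x0 R \<times> {-7<..<7}) {()} (\<lambda>_. \<lambda>(x, t). \<psi> x t)"
    proof (rule Ck_on_ubd)
      show "compact (cball x0 R \<times> {-7..7::real})" by (intro compact_Times) auto
      show "cball x0 R \<times> {-7..7} \<subseteq> {x. (x, 0) \<in> U\<^sub>0} \<times> UNIV" using R by auto
    qed (use \<psi>_smooth in \<open>auto simp: smooth_on_def\<close>)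
    have "ubd n {-7<..<7} {()} (\<lambda>_ t. (\<lambda>(x, t). \<psi> x t) (x0, t))"
    proof (rule ubd_comp[OF _ _ ball, where Z = "\<lambda>_ t. (x0, t)"])
      fix c :: "'a \<times> real"
      have "lubd n {-7<..<7} {()} (\<lambda>_ t. x0 \<bullet> fst c + t * snd c)"
        by (rule lubd_affine[OF bounded_linear_mult_left]) simp
      then show "lubd n {-7<..<7} {()} (\<lambda>_ t. (x0, t) \<bullet> c)" by (simp add: inner_prod_def)
    qed (use R in auto)
    moreover have "ubd n {-7<..<7} {()} (\<lambda>_ _. a)" for a :: real
      by (rule ubd_const[where c = "\<lambda>_. a" and C = "\<bar>a\<bar>"]) auto
    ultimately show ?thesis by (intro ubd_mult ubd_add) auto
  qed
  then obtain \<Theta> where \<Theta>: "\<And>n. ubd n UNIV {()} (\<lambda>_. \<Theta>)" "\<And>s. \<bar>s\<bar> \<le> 1 \<Longrightarrow> \<Theta> s = s" "\<And>s. \<bar>\<Theta> s\<bar> \<le> 3"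
  proof (rule cutoff_identity)
    show "0 \<le> (1 + \<psi> x0 t) * (1 / 2) \<and> (1 + \<psi> x0 t) * (1 / 2) \<le> 1" for t
      using \<psi>_range[OF x0, of t] by simp
  qed (use \<psi>_minus[OF x0] \<psi>_plus[OF x0] in auto)
  have "ubd 0 UNIV {()} (\<lambda>_. pdv \<Theta> 1)" using \<Theta>(1)[of "Suc 0"] by simp
  then obtain C0 where C0: "C0 \<ge> 0" "\<And>s. \<bar>pdv \<Theta> 1 s\<bar> \<le> C0" by (rule ubd_bound0) auto
  have d\<Theta>: "(\<Theta> has_real_derivative pdv \<Theta> 1 s) (at s)" for s
    using deriv_along_line[of \<Theta> 0 s 1] ubd_differentiable[OF \<Theta>(1), of "()" s] by simp

  \<comment> \<open>Within distance \<open>\<omega>\<close> of \<open>p0\<close> the fast derivative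
    \<open>Q\<close> differs from \<open>\<kappa>\<close> by at most
    \<open>|\<kappa>| / (2 (C0 + 1))\<close>, which brings the slope of \<open>N\<close> below 1/2.
    The displacements in x, \<open>\<tau>\<close> and \<open>\<delta>\<close> each receive a third
    of \<open>\<omega>\<close>.\<close>
  define \<omega> where "\<omega> = \<bar>\<kappa>\<bar> / (2 * (C0 + 1) * (LQ + 1))"
  have \<omega>: "\<omega> > 0" using \<kappa> C0(1) LQ(1) by (simp add: \<omega>_def)
  \<comment> \<open>The range of the cutoff \<open>\<theta>\<close> is \<open>3 \<eta>\<close>: it
    must fit into \<open>\<omega>/3\<close>, and \<open>3 \<eta> \<le> 1\<close> keeps
    \<open>\<tau>\<close> well inside (-7, 7).\<close>
  define \<eta> where "\<eta> = min (1 / 3) (\<omega> / 9)"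
  have \<eta>: "\<eta> > 0" "3 * \<eta> \<le> 1" "3 * \<eta> \<le> \<omega> / 3" using \<omega> by (auto simp: \<eta>_def)
  \<comment> \<open>Within distance \<open>\<omega>'\<close> of \<open>p0\<close>, |G| is at most
    \<open>|\<kappa>| \<eta> / 2\<close>, so \<open>|N (x, 0)| \<le> \<eta>/2\<close>; the slope 1/2
    contributes another \<open>\<eta>/2\<close> for |s| \<le> \<open>\<eta>\<close>. At s = 0 only x
    and \<open>\<delta>\<close> move, hence the halves of \<open>\<omega>'\<close> below.\<close>
  define \<omega>' where "\<omega>' = \<bar>\<kappa>\<bar> * \<eta> / (2 * (LG + 1))"
  have \<omega>': "\<omega>' > 0" using \<kappa> LG(1) \<eta>(1) by (simp add: \<omega>'_def)
  define q where "q = min (R / 2) (min (\<omega> / 3) (\<omega>' / 2))"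
  have q: "q > 0" "q < R" "q \<le> \<omega> / 3" "q \<le> \<omega>' / 2" using R(2) \<omega> \<omega>' by (auto simp: q_def)
  \<comment> \<open>Each of the \<open>DIM('a)\<close> coordinates of \<open>\<rho> x - x0\<close>
    is at most \<open>3 r\<close>, so their sum stays within \<open>q\<close>.\<close>
  define r where "r = q / (3 * DIM('a))"
  have r: "r > 0" "r \<le> R"
  proof -
    show "r > 0" using q by (simp add: r_def)
    have "1 \<le> 3 * real DIM('a)" using DIM_positive[where 'a='a] by linarith
    then have "r \<le> q / 1" unfolding r_def using q(1) by (intro divide_left_mono) auto
    then show "r \<le> R" using q(2) by simp
  qed
  define d1 where "d1 = min dd (min (\<omega> / 3) (\<omega>' / 2))"
  have d1: "d1 > 0" "d1 \<le> dd" "d1 \<le> \<omega> / 3" "d1 \<le> \<omega>' / 2" using dd \<omega> \<omega>' by (auto simp: d1_def)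
  define E where "E = {0<..<d1}"

  \<comment> \<open>The variables are truncated coordinatewise by rescaled copies of
    \<open>\<Theta>\<close>. Rescaling preserves slopes: the derivative of \<open>\<theta>\<close>
    is bounded by \<open>C0\<close> for every \<open>\<eta>\<close>, which is why
    \<open>\<eta>\<close> could be chosen after \<open>C0\<close>.\<close>
  define \<rho> where "\<rho> x = x0 + (\<Sum>b\<in>Basis. (r * \<Theta> (((x - x0) \<bullet> b) / r)) *\<^sub>R b)" for x :: 'a
  define \<theta> where "\<theta> s = \<eta> * \<Theta> (s / \<eta>)" for s
  have \<rho>_near: "norm (\<rho> x - x0) \<le> q" for x
  proof -
    have "norm (\<rho> x - x0) \<le> (\<Sum>b\<in>(Basis::'a set). r * 3)"
      unfolding \<rho>_def add_diff_cancel_left'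
      by (rule sum_norm_le) (use r \<Theta>(3) in \<open>simp add: abs_mult\<close>)
    then show ?thesis by (simp add: r_def)
  qed
  have \<rho>_id: "\<rho> x = x" if "x \<in> ball x0 r" for x
  proof -
    have "r * \<Theta> (((x - x0) \<bullet> b) / r) = (x - x0) \<bullet> b" if b: "b \<in> Basis" for b
    proof -
      have "\<bar>(x - x0) \<bullet> b\<bar> \<le> r"
        using Basis_le_norm[OF b, of "x - x0"] \<open>x \<in> ball x0 r\<close> by (simp add: dist_norm norm_minus_commute)
      then show ?thesis using r by (simp add: \<Theta>(2) abs_divide)
    qed
    then show ?thesis by (simp add: \<rho>_def euclidean_representation)
  qed
  have \<theta>_bound: "\<bar>\<theta> s\<bar> \<le> 3 * \<eta>" for s
    using mult_left_mono[OF \<Theta>(3)[of "s / \<eta>"], of \<eta>] \<eta>(1) by (simp add: \<theta>_def abs_mult)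
  have \<theta>_id: "\<theta> s = s" if "\<bar>s\<bar> \<le> \<eta>" for s
    using that \<eta>(1) by (simp add: \<theta>_def \<Theta>(2) abs_divide)
  have \<theta>_deriv: "(\<theta> has_real_derivative pdv \<Theta> 1 (s / \<eta>)) (at s)" for s
    unfolding \<theta>_def[abs_def] using \<eta>(1)
    by (auto intro!: derivative_eq_intros DERIV_chain2[OF d\<Theta>])

  define Z where "Z \<delta> z = (\<rho> (fst z), \<tau>0 + \<theta> (snd z), \<delta>)" for \<delta> :: real and z :: "'a \<times> real"
  have ZD: "Z \<delta> z \<in> D" if "\<delta> \<in> E" for \<delta> z
    using \<rho>_near[of "fst z"] \<theta>_bound[of "snd z"] q(2) \<tau>01 \<eta>(2) that d1
    by (auto simp: Z_def D_def E_def dist_norm norm_minus_commute)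
  have Zp0: "norm (Z \<delta> z - p0) \<le> norm (\<rho> (fst z) - x0) + (\<bar>\<theta> (snd z)\<bar> + \<delta>)" if "\<delta> \<in> E" for \<delta> z
  proof -
    have "norm (Z \<delta> z - p0) \<le> norm (\<rho> (fst z) - x0) + norm (\<theta> (snd z), \<delta>)"
      by (simp add: Z_def p0_def norm_Pair_le)
    also have "norm (\<theta> (snd z), \<delta>) \<le> \<bar>\<theta> (snd z)\<bar> + \<delta>"
      using norm_Pair_le[of "\<theta> (snd z)" \<delta>] that by (simp add: E_def)
    finally show ?thesis by simp
  qed
  have \<Theta>_comp: "ubd n UNIV E (\<lambda>_ z. \<Theta> (a + L z))" if "bounded_linear L" for n a and L :: "'a \<times> real \<Rightarrow> real"
  proof (rule ubd_comp[where Z = "\<lambda>_ z. a + L z"])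
    show "ubd n UNIV E (\<lambda>_. \<Theta>)" using ubd_reindex[OF \<Theta>(1), of E "\<lambda>_. ()" UNIV] by simp
    show "lubd n UNIV E (\<lambda>_ z. (a + L z) \<bullet> c)" if "c \<in> Basis" for c
      using that lubd_affine[OF \<open>bounded_linear L\<close>, of UNIV n E a] by simp
  qed auto
  have const: "ubd n UNIV E (\<lambda>_ _. a)" for n and a :: real
    by (rule ubd_const[where c = "\<lambda>_. a" and C = "\<bar>a\<bar>"]) auto
  have \<theta>_ubd: "ubd n UNIV E (\<lambda>_ z :: 'a \<times> real. \<theta> (snd z))" for n
  proof -
    have "bounded_linear (\<lambda>z :: 'a \<times> real. snd z / \<eta>)"
      by (rule bounded_linear_compose[OF bounded_linear_divide bounded_linear_snd])
    then have "ubd n UNIV E (\<lambda>_ z :: 'a \<times> real. \<Theta> (0 + snd z / \<eta>))" by (rule \<Theta>_comp)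
    from ubd_mult[OF open_UNIV const this] show ?thesis by (simp add: \<theta>_def)
  qed
  have Z_lubd: "lubd n UNIV E (\<lambda>\<delta> z. Z \<delta> z \<bullet> c)" if "c \<in> Basis" for n c
  proof -
    from that consider b where "b \<in> Basis" "c = (b, 0, 0)" | "c = (0, 1, 0)" | "c = (0, 0, 1)"
      by (auto simp: Basis_prod_def zero_prod_def)
    then show ?thesis
    proof cases
      case 1
      have "bounded_linear (\<lambda>z :: 'a \<times> real. (fst z \<bullet> b) / r)"
        by (rule bounded_linear_compose[OF bounded_linear_divide
              bounded_linear_compose[OF bounded_linear_inner_left bounded_linear_fst]])
      then have "ubd n UNIV E (\<lambda>_ z :: 'a \<times> real. \<Theta> (- (x0 \<bullet> b) / r + (fst z \<bullet> b) / r))" by (rule \<Theta>_comp)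
      then have "ubd n UNIV E (\<lambda>_ z :: 'a \<times> real. x0 \<bullet> b + r * \<Theta> (- (x0 \<bullet> b) / r + (fst z \<bullet> b) / r))"
        by (intro ubd_add ubd_mult open_UNIV const)
      moreover have "Z \<delta> z \<bullet> c = x0 \<bullet> b + r * \<Theta> (- (x0 \<bullet> b) / r + (fst z \<bullet> b) / r)" for \<delta> z
        using 1 by (simp add: Z_def \<rho>_def inner_add_left inner_sum_left inner_Basis
            inner_diff_left diff_divide_distrib if_distrib[of "\<lambda>x. _ * x"] cong: if_cong)
      ultimately show ?thesis using ubd_imp_lubd by simp
    next
      case 2
      then show ?thesis
        using ubd_imp_lubd[OF ubd_add[OF open_UNIV const \<theta>_ubd, of n \<tau>0]] by (simp add: Z_def)
    next
      case 3
      have "ubd n UNIV E (\<lambda>\<delta> _. \<delta>)" by (rule ubd_const[where C = d1]) (auto simp: E_def)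
      then show ?thesis using 3 ubd_imp_lubd by (simp add: Z_def)
    qed
  qed
  have comp: "ubd n UNIV E (\<lambda>\<delta> z. f (Z \<delta> z))" if "ubd n D {()} (\<lambda>_. f)" for n f
    by (rule ubd_comp[where f = "\<lambda>_. f" and Z = Z, OF _ ZD ubd_reindex[OF that, of E "\<lambda>_. ()" D] Z_lubd]) auto

  define F where "F \<delta> z = fst (blend (Z \<delta> z)) /\<^sub>R \<kappa>" for \<delta> z
  \<comment> \<open>Subtracting \<open>\<theta> s\<close> in place of \<open>s\<close> keeps
    \<open>N\<close> bounded on the whole space; for |s| \<le> \<open>\<eta>\<close> the two agree
    and \<open>s + N\<close> equals G / \<open>\<kappa>\<close>.\<close>
  define N where "N \<delta> z = inverse \<kappa> * G (Z \<delta> z) - \<theta> (snd z)" for \<delta> z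
  have N_ubd: "ubd n UNIV E N" for n
    unfolding N_def[abs_def] by (intro ubd_diff ubd_mult const comp G \<theta>_ubd) auto
  have dN: "N \<delta> differentiable at z" if "\<delta> \<in> E" for \<delta> z using ubd_differentiable[OF N_ubd that] by simp
  have slope: "\<bar>pdv (N \<delta>) (0, 1) z\<bar> \<le> 1 / 2" if \<delta>: "\<delta> \<in> E" for \<delta> z
  proof -
    obtain x s where z: "z = (x, s)" by (cases z)
    define \<tau> where "\<tau> = \<tau>0 + \<theta> s"
    have Zz: "Z \<delta> z = (\<rho> x, \<tau>, \<delta>)" by (simp add: Z_def z \<tau>_def)
    have "pdv (N \<delta>) (0, 1) z = inverse \<kappa> * (Q (Z \<delta> z) * pdv \<Theta> 1 (s / \<eta>)) - pdv \<Theta> 1 (s / \<eta>)"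
    proof (rule DERIV_unique)
      show "((\<lambda>s. N \<delta> (x, s)) has_real_derivative pdv (N \<delta>) (0, 1) z) (at s)"
        using deriv_along_line[of "N \<delta>" "(x, 0)" s "(0, 1)"] dN[OF \<delta>] by (simp add: z)
      have "((\<lambda>t. G (\<rho> x, t, \<delta>)) has_real_derivative Q (Z \<delta> z)) (at \<tau>)"
        using deriv_along_line[of G "(\<rho> x, 0, \<delta>)" \<tau> "(0, 1, 0)"] dG[OF ZD[OF \<delta>, of z]]
        by (simp add: Zz Q_def)
      then have "((\<lambda>s. G (\<rho> x, \<tau>0 + \<theta> s, \<delta>)) has_real_derivative Q (Z \<delta> z) * pdv \<Theta> 1 (s / \<eta>)) (at s)"
        unfolding \<tau>_def by (rule DERIV_chain2) (auto intro!: derivative_eq_intros \<theta>_deriv)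
      then show "((\<lambda>s. N \<delta> (x, s)) has_real_derivative
          inverse \<kappa> * (Q (Z \<delta> z) * pdv \<Theta> 1 (s / \<eta>)) - pdv \<Theta> 1 (s / \<eta>)) (at s)"
        unfolding N_def Z_def fst_conv snd_conv by (intro DERIV_diff DERIV_cmult \<theta>_deriv)
    qed
    also have "\<dots> = inverse \<kappa> * (Q (Z \<delta> z) - \<kappa>) * pdv \<Theta> 1 (s / \<eta>)" using \<kappa> by (simp add: field_simps)
    finally have eq: "\<bar>pdv (N \<delta>) (0, 1) z\<bar> = \<bar>Q (Z \<delta> z) - \<kappa>\<bar> / \<bar>\<kappa>\<bar> * \<bar>pdv \<Theta> 1 (s / \<eta>)\<bar>"
      by (simp add: abs_mult divide_inverse mult_ac)
    have "\<bar>Q (Z \<delta> z) - \<kappa>\<bar> \<le> LQ * norm (Z \<delta> z - p0)" unfolding \<kappa>_def by (rule LQ(2)[OF ZD[OF \<delta>] p0])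
    also have "\<dots> \<le> LQ * \<omega>"
    proof (intro mult_left_mono LQ(1))
      show "norm (Z \<delta> z - p0) \<le> \<omega>"
        using Zp0[OF \<delta>, of z] \<rho>_near[of "fst z"] \<theta>_bound[of "snd z"] q(3) \<eta>(3) d1(3) \<delta> by (auto simp: E_def)
    qed
    also have "\<dots> \<le> (LQ + 1) * \<omega>" using \<omega> by simp
    also have "\<dots> = \<bar>\<kappa>\<bar> / (2 * (C0 + 1))" using LQ(1) by (simp add: \<omega>_def)
    finally have "\<bar>Q (Z \<delta> z) - \<kappa>\<bar> / \<bar>\<kappa>\<bar> \<le> 1 / (2 * (C0 + 1))" using \<kappa> by (simp add: field_simps)
    moreover have "\<bar>pdv \<Theta> 1 (s / \<eta>)\<bar> \<le> C0 + 1" using C0(2)[of "s / \<eta>"] by linarith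
    ultimately have "\<bar>pdv (N \<delta>) (0, 1) z\<bar> \<le> 1 / (2 * (C0 + 1)) * (C0 + 1)"
      unfolding eq using C0(1) by (intro mult_mono) auto
    also have "\<dots> = 1 / 2" using C0(1) by (simp add: field_simps)
    finally show ?thesis .
  qed
  have small: "\<bar>N \<delta> (x, s)\<bar> \<le> \<eta>" if \<delta>: "\<delta> \<in> E" and s: "\<bar>s\<bar> \<le> \<eta>" for \<delta> x s
  proof -
    have "\<theta> 0 = 0" using \<theta>_id[of 0] \<eta>(1) by simp
    have "\<bar>G (Z \<delta> (x, 0)) - G p0\<bar> \<le> LG * norm (Z \<delta> (x, 0) - p0)" by (rule LG(2)[OF ZD[OF \<delta>] p0])
    also have "\<dots> \<le> LG * \<omega>'"
    proof (intro mult_left_mono LG(1))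
      show "norm (Z \<delta> (x, 0) - p0) \<le> \<omega>'"
        using Zp0[OF \<delta>, of "(x, 0)"] \<rho>_near[of x] q(4) d1(4) \<delta> \<open>\<theta> 0 = 0\<close> by (auto simp: E_def)
    qed
    also have "\<dots> \<le> (LG + 1) * \<omega>'" using \<omega>' by simp
    also have "\<dots> = \<bar>\<kappa>\<bar> * (\<eta> / 2)"
    proof -
      have "LG + 1 \<noteq> 0" using LG(1) by linarith
      moreover have "c * (a / (2 * c)) = a / 2" if "c \<noteq> 0" for a c :: real using that by simp
      ultimately have "(LG + 1) * \<omega>' = \<bar>\<kappa>\<bar> * \<eta> / 2" unfolding \<omega>'_def by blast
      then show ?thesis by simp
    qed
    finally have "\<bar>G (Z \<delta> (x, 0))\<bar> \<le> \<bar>\<kappa>\<bar> * (\<eta> / 2)" using \<tau>0(3) by (simp add: p0_def)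
    then have "\<bar>N \<delta> (x, 0)\<bar> \<le> \<eta> / 2"
      using \<kappa> by (simp add: N_def \<open>\<theta> 0 = 0\<close> abs_mult field_simps)
    moreover have "\<bar>N \<delta> (x, s) - N \<delta> (x, 0)\<bar> \<le> \<bar>s\<bar> / 2"
      using slope_lipschitz[where f = "N \<delta>" and x = x and s = s and t = 0, OF dN[OF \<delta>] slope[OF \<delta>]] by simp
    ultimately show ?thesis using s by linarith
  qed
  interpret slow_fast F N d1 \<eta>
  proof
    show "ubd n UNIV {0<..<d1} (\<lambda>d p. F d p \<bullet> c)" for n c
    proof -
      have "ubd n UNIV E (\<lambda>\<delta> z. inverse \<kappa> * (blend (Z \<delta> z) \<bullet> (c, 0)))"
        by (rule ubd_mult[OF open_UNIV const comp[OF blend]])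
      then show ?thesis by (simp add: F_def E_def inner_prod_def del: ubd.simps)
    qed
  qed (use d1 dd(2) \<eta>(1) N_ubd slope small in \<open>auto simp: E_def simp del: ubd.simps\<close>)
  have "\<exists>D>0. \<forall>d\<in>{0<..<D}. \<exists>\<mu>. Ck_on (Suc k) UNIV \<mu> \<and> (\<forall>x. \<bar>\<mu> x\<bar> \<le> d * 2) \<and>
    (\<forall>x\<in>ball x0 r. pdv \<mu> (fst (regularization \<psi> Xp Xm d (x, \<mu> x))) x = snd (regularization \<psi> Xp Xm d (x, \<mu> x)))" for k
  proof -
    obtain D1 where D1: "D1 > 0" "D1 \<le> d1"
      "\<And>d. d \<in> {0<..<D1} \<Longrightarrow> \<exists>m. Ck_on (Suc k) UNIV m \<and> (\<forall>x. \<bar>m x\<bar> \<le> \<eta>) \<and>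
         (\<forall>x. d * pdv m (F d (x, m x)) x = m x + N d (x, m x))"
      using slow_manifold[of k] by blast
    have "\<exists>\<mu>. Ck_on (Suc k) UNIV \<mu> \<and> (\<forall>x. \<bar>\<mu> x\<bar> \<le> d * 2) \<and>
      (\<forall>x\<in>ball x0 r. pdv \<mu> (fst (regularization \<psi> Xp Xm d (x, \<mu> x))) x = snd (regularization \<psi> Xp Xm d (x, \<mu> x)))"
      if d: "d \<in> {0<..<D1}" for d
    proof -
      obtain m where m: "Ck_on (Suc k) UNIV m" "\<And>x. \<bar>m x\<bar> \<le> \<eta>"
        "\<And>x. d * pdv m (F d (x, m x)) x = m x + N d (x, m x)" using D1(3)[OF d] by blast
      define \<mu> where "\<mu> x = d *\<^sub>R (\<tau>0 + m x)" for x
      have "Ck_on (Suc k) UNIV \<mu>"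
        unfolding \<mu>_def[abs_def] by (intro Ck_on_scaleR Ck_on_add Ck_on_const open_UNIV m(1))
      moreover have "\<bar>\<mu> x\<bar> \<le> d * 2" for x
        using d m(2)[of x] \<tau>01 \<eta>(2) by (simp add: \<mu>_def abs_mult)
      moreover have "pdv \<mu> (fst (regularization \<psi> Xp Xm d (x, \<mu> x))) x = snd (regularization \<psi> Xp Xm d (x, \<mu> x))"
        if x: "x \<in> ball x0 r" for x
      proof -
        define B where "B = blend (x, \<tau>0 + m x, d)"
        have dm: "m differentiable at x" using Ck_on_differentiable[OF m(1)] by simp
        have B: "regularization \<psi> Xp Xm d (x, \<mu> x) = B"
          using d by (subst regularization_blend) (auto simp: \<mu>_def B_def)
        have "Z d (x, m x) = (x, \<tau>0 + m x, d)"
          using \<rho>_id[OF x] \<theta>_id[OF m(2)[of x]] by (simp add: Z_def)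
        then have "F d (x, m x) = fst B /\<^sub>R \<kappa>" "N d (x, m x) = inverse \<kappa> * snd B - m x"
          using \<theta>_id[OF m(2)[of x]] by (auto simp: F_def N_def G_def B_def)
        then have "d * pdv m (inverse \<kappa> *\<^sub>R fst B) x = inverse \<kappa> * snd B" using m(3)[of x] by simp
        then have "inverse \<kappa> * (d * pdv m (fst B) x) = inverse \<kappa> * snd B"
          unfolding linear_scale[OF pdv_linear[OF dm]] by (simp add: mult.left_commute)
        then have "d * pdv m (fst B) x = snd B" using \<kappa> by simp
        moreover have "pdv \<mu> (fst B) x = d * pdv m (fst B) x"
          unfolding \<mu>_def[abs_def]
          by (rule pdv_eqI) (auto intro!: derivative_eq_intros pdv_has_derivative[OF dm])
        ultimately show ?thesis by (simp add: B)
      qed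
      ultimately show ?thesis by blast
    qed
    then show ?thesis using D1(1) by blast
  qed
  then show ?thesis using r by blast
qed

end

section \<open>The invariant graphs in the original variables\<close>

context filippov
begin

lemma sliding_subset_r_sliding:
  assumes p: "p \<in> sliding U\<^sub>0 snd Xp Xm" and reg: "\<And>t. \<bar>t\<bar> < 1 \<Longrightarrow> deriv (\<psi> (fst p)) t \<noteq> 0"
  shows "p \<in> r_sliding U\<^sub>0 (regularization \<psi> Xp Xm)"
proof -
  define x0 where "x0 = fst p"
  have \<Sigma>: "p \<in> switching U\<^sub>0 snd" and px0: "p = (x0, 0)"
    using p by (auto simp: sliding_def switching_def x0_def prod_eq_iff)
  then have x0: "(x0, 0) \<in> U\<^sub>0" by (simp add: switching_def)
  obtain A B where AB: "open A" "open B" "x0 \<in> A" "0 \<in> B" "A \<times> B \<subseteq> U\<^sub>0"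
    using open_prod_elim[OF open_U0 x0] by (metis mem_Sigma_iff)
  obtain e1 where e1: "e1 > 0" "cball x0 e1 \<subseteq> A" using AB open_contains_cball by blast
  obtain e2 where e2: "e2 > 0" "cball 0 e2 \<subseteq> B" using AB open_contains_cball by blast
  define R where "R = min e1 e2"
  have R: "cball x0 R \<times> {-R..R} \<subseteq> U\<^sub>0" "R > 0"
  proof -
    have "cball x0 R \<subseteq> A" "{-R..R} \<subseteq> B"
      using e1 e2 by (auto simp: R_def subset_iff dist_real_def)
    then show "cball x0 R \<times> {-R..R} \<subseteq> U\<^sub>0" using AB(5) by blast
  qed (use e1 e2 in \<open>simp add: R_def\<close>)
  from slow_manifolds_at[of x0 R] p reg R
  obtain r where r: "r > 0" "r \<le> R" and ex: "\<And>k. \<exists>D>0. \<forall>d\<in>{0<..<D}. \<exists>\<mu>. Ck_on (Suc k) UNIV \<mu> \<and> (\<forall>x. \<bar>\<mu> x\<bar> \<le> d * 2) \<and>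
    (\<forall>x\<in>ball x0 r. pdv \<mu> (fst (regularization \<psi> Xp Xm d (x, \<mu> x))) x = snd (regularization \<psi> Xp Xm d (x, \<mu> x)))"
    unfolding px0 fst_conv by blast
  define P where "P = (\<lambda>k d \<mu>. Ck_on (Suc k) UNIV \<mu> \<and> (\<forall>x. \<bar>\<mu> x\<bar> \<le> d * 2) \<and>
    (\<forall>x\<in>ball x0 r. pdv \<mu> (fst (regularization \<psi> Xp Xm d (x, \<mu> x))) x = snd (regularization \<psi> Xp Xm d (x, \<mu> x))))"
  have "\<exists>\<mu>. \<forall>k. \<forall>\<^sub>F d in at_right 0. P k d (\<mu> d)"
  proof (rule diagonal_choice)
    show "\<exists>D>0. \<forall>d\<in>{0<..<D}. \<exists>\<mu>. P k d \<mu>" for k using ex unfolding P_def .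
    show "P j d \<mu>" if "P k d \<mu>" "j \<le> k" for j k d \<mu>
      using that Ck_on_mono[of "Suc k" UNIV \<mu> "Suc j"] unfolding P_def by simp
  qed
  then obtain \<mu> where \<mu>: "\<And>k. \<forall>\<^sub>F d in at_right 0. P k d (\<mu> d)" by blast
  define U where "U = ball x0 r \<times> {-R/2<..<R/2}"
  define S where "S d = {q \<in> U. snd q = \<mu> d (fst q)}" for d
  have U: "open U" "p \<in> U" "U \<subseteq> U\<^sub>0"
  proof -
    show "open U" unfolding U_def by (intro open_Times) auto
    show "p \<in> U" using r R(2) by (simp add: U_def px0)
    have "U \<subseteq> cball x0 R \<times> {-R..R}" using r R(2) by (auto simp: U_def)
    then show "U \<subseteq> U\<^sub>0" using R(1) by blast
  qed
  \<comment> \<open>For \<open>d < R/4\<close> the height \<open>2 d\<close> of the graph is below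
    \<open>R/2\<close>, so the graph lies in the strip where the regularization is Lipschitz in
    y.\<close>
  have "\<forall>\<^sub>F d in at_right 0. d \<in> {0<..<R/4}" using R(2) by (intro eventually_at_right_real) simp
  then have inv: "\<forall>\<^sub>F d in at_right 0. S d \<subseteq> U \<and> invariant_in U (regularization \<psi> Xp Xm d) (S d)"
    using \<mu>[of 0]
  proof eventually_elim
    case (elim d)
    define X where "X = regularization \<psi> Xp Xm d"
    have m: "Ck_on (Suc 0) UNIV (\<mu> d)" "\<And>x. \<bar>\<mu> d x\<bar> \<le> d * 2"
      "\<And>x. x \<in> ball x0 r \<Longrightarrow> pdv (\<mu> d) (fst (X (x, \<mu> d x))) x = snd (X (x, \<mu> d x))"
      using elim(2) by (auto simp: P_def X_def simp del: Ck_on.simps)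
    have dm: "\<mu> d differentiable at x" for x using Ck_on_differentiable[OF m(1)] by simp
    have "\<exists>C. \<forall>b\<in>Basis. \<forall>x\<in>cball x0 r. \<bar>pdv (\<mu> d) b x\<bar> \<le> C b"
    proof (intro bchoice ballI)
      fix b :: 'a
      have "ubd 0 (cball x0 r) {()} (\<lambda>_. pdv (\<mu> d) b)"
        by (rule Ck_on_ubd[OF compact_cball subset_UNIV subset_refl Ck_on_pdv[OF m(1)]])
      then show "\<exists>C. \<forall>x\<in>cball x0 r. \<bar>pdv (\<mu> d) b x\<bar> \<le> C" by simp
    qed
    then obtain C where C: "\<And>b x. b \<in> Basis \<Longrightarrow> x \<in> cball x0 r \<Longrightarrow> \<bar>pdv (\<mu> d) b x\<bar> \<le> C b" by blast
    define K where "K = \<bar>\<Sum>b\<in>Basis. C b\<bar>"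
    obtain L where L: "L \<ge> 0" "\<And>x y y'. x \<in> ball x0 R \<Longrightarrow> y \<in> {-R/2<..<R/2} \<Longrightarrow> y' \<in> {-R/2<..<R/2} \<Longrightarrow>
        norm (X (x, y) - X (x, y')) \<le> L * \<bar>y - y'\<bar>"
      using regularization_lipschitz[OF R, of d] elim(1) unfolding X_def by auto
    \<comment> \<open>The defect vanishes at the point of the graph below or above \<open>q\<close>,
      so at \<open>q\<close> it is that of the difference \<open>w\<close> of the two field values,
      which is Lipschitz in the vertical distance.\<close>
    have "\<bar>snd (X q) - pdv (\<mu> d) (fst (X q)) (fst q)\<bar> \<le> (L + K * L) * \<bar>snd q - \<mu> d (fst q)\<bar>" if q: "q \<in> U" for q
    proof -
      obtain x y where xy: "q = (x, y)" by (cases q)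
      have x: "x \<in> ball x0 r" "x \<in> cball x0 r" "x \<in> ball x0 R" using q r by (auto simp: U_def xy)
      define w where "w = X (x, y) - X (x, \<mu> d x)"
      have w: "norm w \<le> L * \<bar>y - \<mu> d x\<bar>"
        unfolding w_def using q m(2)[of x] elim(1) by (intro L(2) x) (auto simp: U_def xy abs_le_iff)
      have "snd (X q) - pdv (\<mu> d) (fst (X q)) x = snd w - pdv (\<mu> d) (fst w) x"
        using m(3)[OF x(1)] linear_diff[OF pdv_linear[OF dm], of x "fst (X (x, y))" "fst (X (x, \<mu> d x))"]
        by (simp add: w_def xy)
      also have "\<bar>\<dots>\<bar> \<le> \<bar>snd w\<bar> + \<bar>pdv (\<mu> d) (fst w) x\<bar>" by (rule abs_triangle_ineq4)
      also have "\<dots> \<le> norm w + K * norm w"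
      proof (rule add_mono)
        show "\<bar>snd w\<bar> \<le> norm w" using norm_snd_le[of "snd w" "fst w"] by simp
        have "\<bar>pdv (\<mu> d) (fst w) x\<bar> \<le> (\<Sum>b\<in>Basis. C b) * norm (fst w)" by (rule pdv_bound[OF dm C[OF _ x(2)]])
        also have "\<dots> \<le> K * norm w" unfolding K_def
          using norm_fst_le[of "fst w" "snd w"] by (intro mult_mono) auto
        finally show "\<bar>pdv (\<mu> d) (fst w) x\<bar> \<le> K * norm w" .
      qed
      also have "\<dots> = (1 + K) * norm w" by (simp add: algebra_simps)
      also have "\<dots> \<le> (1 + K) * (L * \<bar>y - \<mu> d x\<bar>)" using w by (intro mult_left_mono) (auto simp: K_def)
      finally show ?thesis by (simp add: xy algebra_simps)
    qed
    from graph_invariant_in[OF dm this] show ?case unfolding S_def X_def by auto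
  qed
  moreover have "\<forall>\<^sub>F d in at_right 0. \<exists>n. Ck_submanifold k n (S d)" for k
    using \<mu>[of k]
  proof eventually_elim
    case (elim d)
    then have "Ck_on k UNIV (\<mu> d)" unfolding P_def by (blast dest: Ck_on_SucD)
    then show ?case unfolding S_def by (rule graph_Ck_submanifold[OF _ U(1)])
  qed
  moreover have "((\<lambda>d. hausdorff_dist (S d \<inter> K) (switching U\<^sub>0 snd \<inter> K)) \<longlongrightarrow> 0) (at_right 0)"
    if "compact K" "K \<subseteq> U" "switching U\<^sub>0 snd \<inter> K \<subseteq> closure (switching U\<^sub>0 snd \<inter> interior K)" for K
    unfolding S_def
  proof (rule graph_hausdorff_limit[OF _ that(1,2) U(3) that(3)])
    show "\<forall>\<^sub>F d in at_right 0. \<forall>x. \<bar>\<mu> d x\<bar> \<le> d * 2"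
      using \<mu>[of 0] by eventually_elim (simp add: P_def del: Ck_on.simps)
  qed
  ultimately show ?thesis unfolding r_sliding_def using \<Sigma> U by blast
qed

end

text \<open>Zeros of \<open>Xp\<close> or \<open>Xm\<close> are taken out of the first inclusion
  because it fails there: for \<open>Xp = (0, y)\<close>, \<open>Xm = (0, 1)\<close> and
  \<open>\<psi>\<close> odd and increasing in t, the regularization is a positive multiple of
  \<open>(0, 1)\<close> for |y| < 1 and small \<open>\<delta>\<close>, so every point of y = 0 is
  r-sewing, while the product of the two last components vanishes there.\<close>

theorem theorem2:
  fixes U\<^sub>0 :: "('a::euclidean_space \<times> real) set"
    and Xp Xm :: "'a \<times> real \<Rightarrow> 'a \<times> real"
    and \<psi> :: "'a \<Rightarrow> real \<Rightarrow> real"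
  assumes "open U\<^sub>0"
    and "\<And>x y. (x, y) \<in> U\<^sub>0 \<Longrightarrow> (x, 0) \<in> U\<^sub>0"
    and "smooth_on U\<^sub>0 Xp" and "smooth_on U\<^sub>0 Xm"
    and "smooth_on ({x. (x, 0) \<in> U\<^sub>0} \<times> UNIV) (\<lambda>(x, t). \<psi> x t)"
    and "\<And>x t. (x, 0) \<in> U\<^sub>0 \<Longrightarrow> \<psi> x t \<in> {-1..1}"
    and "\<And>x t. (x, 0) \<in> U\<^sub>0 \<Longrightarrow> t \<le> -1 \<Longrightarrow> \<psi> x t = -1"
    and "\<And>x t. (x, 0) \<in> U\<^sub>0 \<Longrightarrow> t \<ge> 1 \<Longrightarrow> \<psi> x t = 1"
    and "\<And>x t. (x, 0) \<in> sliding U\<^sub>0 snd Xp Xm \<Longrightarrow> \<bar>t\<bar> < 1 \<Longrightarrow> deriv (\<psi> x) t \<noteq> 0"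
  shows "r_sewing U\<^sub>0 (regularization \<psi> Xp Xm) - {p. Xp p = 0 \<or> Xm p = 0} \<subseteq> sewing U\<^sub>0 snd Xp Xm \<and>
    sliding U\<^sub>0 snd Xp Xm \<subseteq> r_sliding U\<^sub>0 (regularization \<psi> Xp Xm) \<and>
    ((\<forall>p \<in> r_sliding U\<^sub>0 (regularization \<psi> Xp Xm) - sliding U\<^sub>0 snd Xp Xm. snd (Xp p) \<noteq> snd (Xm p)) \<longrightarrow>
     (\<exists>Y :: 'a \<times> real \<Rightarrow> 'a \<times> real.
        smooth_on {x. (x, 0) \<in> r_sliding U\<^sub>0 (regularization \<psi> Xp Xm)} (\<lambda>x. Y (x, 0)) \<and>
        (\<forall>p \<in> r_sliding U\<^sub>0 (regularization \<psi> Xp Xm). snd (Y p) = 0) \<and>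
        (\<forall>p \<in> sliding U\<^sub>0 snd Xp Xm. Y p = sliding_field snd Xp Xm p)))"
proof (intro conjI impI)
  interpret filippov U\<^sub>0 Xp Xm \<psi>
    using assms by unfold_locales auto
  let ?S = "r_sliding U\<^sub>0 (regularization \<psi> Xp Xm)"
  have "continuous_on U\<^sub>0 Xp" "continuous_on U\<^sub>0 Xm"
    using smooth Ck_on_continuous unfolding smooth_on_def by blast+
  then show "r_sewing U\<^sub>0 (regularization \<psi> Xp Xm) - {p. Xp p = 0 \<or> Xm p = 0} \<subseteq> sewing U\<^sub>0 snd Xp Xm"
    by (rule r_sewing_subset_sewing[OF _ _ \<psi>_continuous \<psi>_minus \<psi>_plus])
  show "sliding U\<^sub>0 snd Xp Xm \<subseteq> ?S"
  proof
    fix p assume p: "p \<in> sliding U\<^sub>0 snd Xp Xm"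
    then have "(fst p, 0) \<in> sliding U\<^sub>0 snd Xp Xm"
      by (metis (mono_tags, lifting) mem_Collect_eq prod.collapse sliding_def switching_def)
    then show "p \<in> ?S" using p assms(9) by (intro sliding_subset_r_sliding) auto
  qed
  assume ne: "\<forall>p \<in> ?S - sliding U\<^sub>0 snd Xp Xm. snd (Xp p) \<noteq> snd (Xm p)"
  \<comment> \<open>On the sliding region opposite signs already separate the two values. The
    defining formula of the sliding field is therefore meaningful on the whole r-sliding region and
    is itself the extension.\<close>
  have "snd (Xp p) \<noteq> snd (Xm p)" if "p \<in> ?S" for p
    using ne that by (cases "p \<in> sliding U\<^sub>0 snd Xp Xm") (auto simp: sliding_def mult_less_0_iff)
  then have "smooth_on {x. (x, 0) \<in> ?S} (\<lambda>x. sliding_field snd Xp Xm (x, 0))"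
    by (intro smooth_on_sliding_field[OF assms(1) smooth open_r_sliding]) (auto simp: r_sliding_def switching_def)
  moreover have "snd (sliding_field snd Xp Xm p) = 0" for p
    by (simp add: sliding_field_def)
  ultimately show "\<exists>Y :: 'a \<times> real \<Rightarrow> 'a \<times> real.
        smooth_on {x. (x, 0) \<in> ?S} (\<lambda>x. Y (x, 0)) \<and> (\<forall>p \<in> ?S. snd (Y p) = 0) \<and>
        (\<forall>p \<in> sliding U\<^sub>0 snd Xp Xm. Y p = sliding_field snd Xp Xm p)"
    by blast
qed

end
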